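(* Let $V=\bigoplus_{t\in\mathbb{F}_{13}}V_t$ be the $78$-dimensional real vector space, and let $G=\langle a,b,c,d,e\rangle$ be the group of real-linear automorphisms of $V$, defined in the context. Let $[\cdot,\cdot]$ be the unique $G$-invariant real-bilinear product on $V$ with $$[(1,0,0)_0,(1,0,0)_1]=(\overline{\omega},1,1)_3-(1,\overline{\omega},\overline{\omega})_9,$$ which makes $V$ into a Lie algebra (the compact real form of $E_6$). For $t\in\mathbb{F}_{13}$ let $W_t=\{(x,y,y)_t : x,y\in\mathbb{C}\}\subset V_t$, a real space of dimension $4$, and let $W=\bigoplus_tW_t$, of real dimension $52$. Then $W$ is invariant under $a,b,c,d$, is closed under the Lie product, and with this product is the compact real form of the simple Lie algebra of type $F_4$.
   Context: Let $\omega=e^{2\pi i/3}$, $\overline{\omega}=\omega^2$, $\theta=\omega-\overline{\omega}=\sqrt{-3}$. For each $t\in\mathbb{F}_{13}=\{0,1,\dots,12\}$ let $V_t$ be a copy of $\mathbb{C}^3$, regarded as a $6$-dimensional real vector space; for $v\in\mathbb{C}^3$ write $v_t$ for the corresponding vector of $V_t$. Let $V=\bigoplus_{t}V_t$ (real dimension $78$). Vectors of $\mathbb{C}^3$ are row vectors; a matrix acts on them by right multiplication, and $v_tM$ means $(vM)_t$. Complex scalars are only notation: all maps and products are real-(bi)linear. Group elements act on the right (products $gh$ mean first $g$, then $h$). Define real-linear automorphisms of $V$ as follows (subscripts mod $13$). $a$: $v_t\mapsto v_{t+1}$. $b$: $(x,y,z)_t\mapsto(\omega x,\overline{\omega}y,\overline{\omega}z)_{3t}$.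 $c$: with $$M_1=\tfrac{\theta}{3}\begin{pmatrix}\omega&1&1\\1&\omega&1\\1&1&\omega\end{pmatrix},\ M_2=\tfrac{\theta}{3}\begin{pmatrix}1&1&1\\1&\overline{\omega}&\omega\\1&\omega&\overline{\omega}\end{pmatrix},\ M_3=\tfrac{\theta}{3}\begin{pmatrix}\omega&\omega&\omega\\\overline{\omega}&\omega&1\\\overline{\omega}&1&\omega\end{pmatrix},\ M_4=\tfrac{\theta}{3}\begin{pmatrix}1&\omega&\omega\\\overline{\omega}&\overline{\omega}&\omega\\\overline{\omega}&\omega&\overline{\omega}\end{pmatrix},$$ $c$ maps $(x,y,z)_0\mapsto-(\overline{x},\overline{z},\overline{y})_0$; $(x,y,z)_1\mapsto-(x,z,y)_1$; $(x,y,z)_3\mapsto-(\omega x,\overline{\omega}z,\overline{\omega}y)_9$; $(x,y,z)_9\mapsto-(\overline{\omega}x,\omega z,\omega y)_3$; $(x,y,z)_4\mapsto(\overline{x},\overline{y},\overline{z})_{10}$; $(x,y,z)_{10}\mapsto(\overline{x},\overline{y},\overline{z})_4$; $(x,y,z)_{12}\mapsto(\overline{x},\overline{y},\overline{z})_{12}$; $(x,y,z)_2\mapsto(\overline{x},\overline{y},\overline{z})_2M_1$; $(x,y,z)_8\mapsto(\overline{x},\overline{y},\overline{z})_8M_2$; $(x,y,z)_5\mapsto(\overline{x},\overline{y},\overline{z})_6M_3$; $(x,y,z)_6\mapsto(\overline{x},\overline{y},\overline{z})_5M_3^{\top}$; $(x,y,z)_7\mapsto(\overline{x},\overline{y},\overline{z})_{11}M_4$;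 $(x,y,z)_{11}\mapsto(\overline{x},\overline{y},\overline{z})_7M_4^{\top}$. $d$: $v_t\mapsto\delta_tv_t$ where $(\delta_0,\dots,\delta_{12})=(1,\omega,1,\omega,\omega,\omega,\overline{\omega},\overline{\omega},1,\omega,\overline{\omega},\omega,1)$. $e$: $(x,y,z)_0\mapsto(x,y,z)_0$; $(x,y,z)_t\mapsto(z,x,y)_t$ for $t=1,11$; $(x,y,z)_2\mapsto(\overline{\omega}y,z,\omega x)_2$; $(x,y,z)_t\mapsto(\overline{\omega}z,\omega x,y)_t$ for $t=3,7$; $(x,y,z)_t\mapsto(x,\omega y,\overline{\omega}z)_t$ for $t=4,10,12$; $(x,y,z)_5\mapsto(y,z,x)_5$; $(x,y,z)_6\mapsto(\omega y,z,\overline{\omega}x)_6$; $(x,y,z)_t\mapsto(\omega z,\overline{\omega}x,y)_t$ for $t=8,9$. Put $G=\langle a,b,c,d,e\rangle$. A bilinear product on $V$ is $G$-invariant if $[u^g,v^g]=[u,v]^g$ for all $u,v\in V$, $g\in G$. It is known that there is exactly one $G$-invariant real-bilinear product on $V$ with the value given in the claim. "Compact real form of type $F_4$" means: a simple real Lie algebra with negative definite Killing form whose complexification is the complex simple Lie algebra of type $F_4$. *)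

theory Defs
  imports
    "HOL-Analysis.Analysis"
    "HOL-Library.Numeral_Type"
    "HOL-Algebra.Generated_Groups"
    "HOL-Algebra.Bij"
begin

section \<open>Lie algebras on a subspace of a vector space\<close>

locale lie_algebra = vector_space scale
  for scale :: "'k::field \<Rightarrow> 'a::ab_group_add \<Rightarrow> 'a" +
  fixes L :: "'a set" and br :: "'a \<Rightarrow> 'a \<Rightarrow> 'a"
  assumes subspace_carrier: "subspace L"
    and br_closed: "\<And>x y. x \<in> L \<Longrightarrow> y \<in> L \<Longrightarrow> br x y \<in> L"
    and br_add_left: "\<And>x y z. x \<in> L \<Longrightarrow> y \<in> L \<Longrightarrow> z \<in> L \<Longrightarrow> br (x + y) z = br x z + br y z"
    and br_add_right: "\<And>x y z. x \<in> L \<Longrightarrow> y \<in> L \<Longrightarrow> z \<in> L \<Longrightarrow> br x (y + z) = br x y + br x z"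
    and br_scale_left: "\<And>r x y. x \<in> L \<Longrightarrow> y \<in> L \<Longrightarrow> br (scale r x) y = scale r (br x y)"
    and br_scale_right: "\<And>r x y. x \<in> L \<Longrightarrow> y \<in> L \<Longrightarrow> br x (scale r y) = scale r (br x y)"
    and br_alternating: "\<And>x. x \<in> L \<Longrightarrow> br x x = 0"
    and jacobi: "\<And>x y z. x \<in> L \<Longrightarrow> y \<in> L \<Longrightarrow> z \<in> L \<Longrightarrow>
      br (br x y) z + br (br y z) x + br (br z x) y = 0"
begin

definition finite_dim :: bool where
  "finite_dim \<longleftrightarrow> (\<exists>Bs. finite Bs \<and> span Bs = L)"

definition lie_ideal :: "'a set \<Rightarrow> bool" where
  "lie_ideal I \<longleftrightarrow> subspace I \<and> I \<subseteq> L \<and> (\<forall>x\<in>L. \<forall>y\<in>I. br x y \<in> I)"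

definition lie_simple :: bool where
  "lie_simple \<longleftrightarrow> (\<exists>x\<in>L. \<exists>y\<in>L. br x y \<noteq> 0) \<and> (\<forall>I. lie_ideal I \<longrightarrow> I = {0} \<or> I = L)"

text \<open>Trace of an endomorphism of the finite-dimensional space \<open>L\<close>; it does not depend on
  the basis chosen.\<close>

definition trace_on :: "('a \<Rightarrow> 'a) \<Rightarrow> 'k" where
  "trace_on f = (let Bs = (SOME Bs. independent Bs \<and> span Bs = L)
                 in \<Sum>b\<in>Bs. representation Bs (f b) b)"

definition killing :: "'a \<Rightarrow> 'a \<Rightarrow> 'k" where
  "killing x y = trace_on (\<lambda>z. br x (br y z))"

definition lie_subalgebra :: "'a set \<Rightarrow> bool" where
  "lie_subalgebra H \<longleftrightarrow> subspace H \<and> H \<subseteq> L \<and> (\<forall>x\<in>H. \<forall>y\<in>H. br x y \<in> H)"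

primrec lower_central :: "'a set \<Rightarrow> nat \<Rightarrow> 'a set" where
  "lower_central H 0 = H"
| "lower_central H (Suc n) = span {br x y |x y. x \<in> H \<and> y \<in> lower_central H n}"

definition nilpotent_subalgebra :: "'a set \<Rightarrow> bool" where
  "nilpotent_subalgebra H \<longleftrightarrow> lie_subalgebra H \<and> (\<exists>n. lower_central H n = {0})"

definition normalizer_of :: "'a set \<Rightarrow> 'a set" where
  "normalizer_of H = {x \<in> L. \<forall>h\<in>H. br x h \<in> H}"

definition cartan_subalgebra :: "'a set \<Rightarrow> bool" where
  "cartan_subalgebra H \<longleftrightarrow> nilpotent_subalgebra H \<and> normalizer_of H = H"

text \<open>Linear functionals on \<open>H\<close> are represented by functions that vanish outside \<open>H\<close>, so that
  equality of functionals is equality of functions.\<close>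

definition dual_on :: "'a set \<Rightarrow> ('a \<Rightarrow> 'k) set" where
  "dual_on H = {f. (\<forall>x\<in>H. \<forall>y\<in>H. f (x + y) = f x + f y) \<and>
                   (\<forall>r. \<forall>x\<in>H. f (scale r x) = r * f x) \<and>
                   (\<forall>x. x \<notin> H \<longrightarrow> f x = 0)}"

definition weight_space :: "'a set \<Rightarrow> ('a \<Rightarrow> 'k) \<Rightarrow> 'a set" where
  "weight_space H f = {x \<in> L. \<forall>h\<in>H. br h x = scale (f h) x}"

definition roots :: "'a set \<Rightarrow> ('a \<Rightarrow> 'k) set" where
  "roots H = {f \<in> dual_on H. f \<noteq> (\<lambda>_. 0) \<and> weight_space H f \<noteq> {0}}"

definition root_base :: "'a set \<Rightarrow> nat \<Rightarrow> (nat \<Rightarrow> 'a \<Rightarrow> 'k) \<Rightarrow> bool" where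
  "root_base H n D \<longleftrightarrow>
     (\<forall>i<n. D i \<in> roots H) \<and>
     (\<forall>c. (\<forall>h. (\<Sum>i<n. c i * D i h) = 0) \<longrightarrow> (\<forall>i<n. c i = 0)) \<and>
     (\<forall>f\<in>roots H. \<exists>m :: nat \<Rightarrow> nat.
        (\<forall>h. f h = (\<Sum>i<n. of_nat (m i) * D i h)) \<or>
        (\<forall>h. f h = - (\<Sum>i<n. of_nat (m i) * D i h)))"

text \<open>In a semisimple complex Lie algebra, \<open>[L\<^sub>f, L\<^sub>-\<^sub>f]\<close> is a line on which \<open>f\<close> does not vanish,
  so every root has exactly one coroot.\<close>

definition is_coroot :: "'a set \<Rightarrow> ('a \<Rightarrow> 'k) \<Rightarrow> 'a \<Rightarrow> bool" where
  "is_coroot H f h \<longleftrightarrow>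
     h \<in> span {br x y |x y. x \<in> weight_space H f \<and> y \<in> weight_space H (\<lambda>u. - f u)} \<and> f h = 2"

text \<open>The \<open>(i, j)\<close> entry of the Cartan matrix is the value of the \<open>i\<close>-th simple root on the
  \<open>j\<close>-th simple coroot.\<close>

definition has_cartan_matrix :: "nat \<Rightarrow> (nat \<Rightarrow> nat \<Rightarrow> int) \<Rightarrow> bool" where
  "has_cartan_matrix n A \<longleftrightarrow>
     (\<exists>H D. cartan_subalgebra H \<and> root_base H n D \<and>
        (\<forall>j<n. \<exists>h. is_coroot H (D j) h \<and> (\<forall>i<n. D i h = of_int (A i j))))"

end

definition complex_simple_of_type ::
  "nat \<Rightarrow> (nat \<Rightarrow> nat \<Rightarrow> int) \<Rightarrow> (complex \<Rightarrow> 'a::ab_group_add \<Rightarrow> 'a) \<Rightarrow> 'a set \<Rightarrow> ('a \<Rightarrow> 'a \<Rightarrow> 'a) \<Rightarrow> bool"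
  where "complex_simple_of_type n A sc L br \<longleftrightarrow>
     lie_algebra sc L br \<and> lie_algebra.finite_dim sc L \<and>
     lie_algebra.lie_simple sc L br \<and> lie_algebra.has_cartan_matrix sc L br n A"

text \<open>The complexification of a real Lie algebra \<open>L\<close> has carrier \<open>L \<times> L\<close>, the pair \<open>(u, v)\<close>
  standing for \<open>u + \<i> v\<close>.\<close>

definition complexified_scale :: "complex \<Rightarrow> 'a \<times> 'a \<Rightarrow> 'a \<times> ('a::real_vector)" where
  "complexified_scale c p =
     (Re c *\<^sub>R fst p - Im c *\<^sub>R snd p, Re c *\<^sub>R snd p + Im c *\<^sub>R fst p)"

definition complexified_bracket ::
  "('a \<Rightarrow> 'a \<Rightarrow> 'a) \<Rightarrow> 'a \<times> 'a \<Rightarrow> 'a \<times> 'a \<Rightarrow> 'a \<times> ('a::real_vector)" where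
  "complexified_bracket br p q =
     (br (fst p) (fst q) - br (snd p) (snd q), br (fst p) (snd q) + br (snd p) (fst q))"

definition compact_real_form_of_type ::
  "nat \<Rightarrow> (nat \<Rightarrow> nat \<Rightarrow> int) \<Rightarrow> 'a::real_vector set \<Rightarrow> ('a \<Rightarrow> 'a \<Rightarrow> 'a) \<Rightarrow> bool" where
  "compact_real_form_of_type n A L br \<longleftrightarrow>
     lie_algebra scaleR L br \<and>
     lie_algebra.finite_dim scaleR L \<and>
     lie_algebra.lie_simple scaleR L br \<and>
     (\<forall>x\<in>L. x \<noteq> 0 \<longrightarrow> lie_algebra.killing scaleR L br x x < 0) \<and>
     complex_simple_of_type n A complexified_scale (L \<times> L) (complexified_bracket br)"

text \<open>Bourbaki numbering, with simple roots 0, 1 long and 2, 3 short.\<close>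

definition cartan_matrix_F4 :: "nat \<Rightarrow> nat \<Rightarrow> int" where
  "cartan_matrix_F4 i j =
     [[ 2, -1,  0,  0],
      [-1,  2, -2,  0],
      [ 0, -1,  2, -1],
      [ 0,  0, -1,  2]] ! i ! j"

abbreviation compact_F4 :: "'a::real_vector set \<Rightarrow> ('a \<Rightarrow> 'a \<Rightarrow> 'a) \<Rightarrow> bool" where
  "compact_F4 \<equiv> compact_real_form_of_type 4 cartan_matrix_F4"


section \<open>The space \<open>V\<close> and the group \<open>G\<close>\<close>

definition \<omega> :: complex where "\<omega> = exp (2 * of_real pi * \<i> / 3)"

abbreviation \<omega>' :: complex where "\<omega>' \<equiv> cnj \<omega>"

definition \<theta> :: complex where "\<theta> = \<omega> - \<omega>'"

text \<open>The type \<open>13\<close> is the ring of integers modulo 13, so index arithmetic is modulo 13.\<close>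

type_synonym V = "(complex^3)^13"

abbreviation at_index :: "13 \<Rightarrow> complex \<Rightarrow> complex \<Rightarrow> complex \<Rightarrow> V" where
  "at_index t x y z \<equiv> axis t (vector [x, y, z])"

text \<open>The additive map on \<open>V\<close> whose restriction to the summand with index \<open>t\<close> is \<open>f t\<close>.\<close>

definition extend_sum :: "(13 \<Rightarrow> complex^3 \<Rightarrow> V) \<Rightarrow> V \<Rightarrow> V" where
  "extend_sum f v = (\<Sum>t\<in>UNIV. f t (v $ t))"

definition gen_a :: "V \<Rightarrow> V" where
  "gen_a = extend_sum (\<lambda>t v. axis (t + 1) v)"

definition gen_b :: "V \<Rightarrow> V" where
  "gen_b = extend_sum (\<lambda>t v. at_index (3 * t) (\<omega> * v $ 1) (\<omega>' * v $ 2) (\<omega>' * v $ 3))"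

definition scaled_matrix :: "complex list list \<Rightarrow> complex^3^3" where
  "scaled_matrix rs = (\<chi> i j. \<theta> / 3 * (vector (map vector rs) :: complex^3^3) $ i $ j)"

definition M1 :: "complex^3^3" where
  "M1 = scaled_matrix [[\<omega>, 1, 1], [1, \<omega>, 1], [1, 1, \<omega>]]"

definition M2 :: "complex^3^3" where
  "M2 = scaled_matrix [[1, 1, 1], [1, \<omega>', \<omega>], [1, \<omega>, \<omega>']]"

definition M3 :: "complex^3^3" where
  "M3 = scaled_matrix [[\<omega>, \<omega>, \<omega>], [\<omega>', \<omega>, 1], [\<omega>', 1, \<omega>]]"

definition M4 :: "complex^3^3" where
  "M4 = scaled_matrix [[1, \<omega>, \<omega>], [\<omega>', \<omega>', \<omega>], [\<omega>', \<omega>, \<omega>']]"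

definition gen_c :: "V \<Rightarrow> V" where
  "gen_c = extend_sum (\<lambda>t v.
     let x = v $ 1; y = v $ 2; z = v $ 3;
         conj_v = (vector [cnj x, cnj y, cnj z] :: complex^3) in
     if t = 0 then - at_index 0 (cnj x) (cnj z) (cnj y)
     else if t = 1 then - at_index 1 x z y
     else if t = 3 then - at_index 9 (\<omega> * x) (\<omega>' * z) (\<omega>' * y)
     else if t = 9 then - at_index 3 (\<omega>' * x) (\<omega> * z) (\<omega> * y)
     else if t = 4 then axis 10 conj_v
     else if t = 10 then axis 4 conj_v
     else if t = 12 then axis 12 conj_v
     else if t = 2 then axis 2 (conj_v v* M1)
     else if t = 8 then axis 8 (conj_v v* M2)
     else if t = 5 then axis 6 (conj_v v* M3)
     else if t = 6 then axis 5 (conj_v v* transpose M3)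
     else if t = 7 then axis 11 (conj_v v* M4)
     else axis 7 (conj_v v* transpose M4))"

definition gen_d :: "V \<Rightarrow> V" where
  "gen_d = extend_sum (\<lambda>t v.
     axis t ((if t \<in> {0, 2, 8, 12} then 1 else if t \<in> {6, 7, 10} then \<omega>' else \<omega>) *s v))"

definition gen_e :: "V \<Rightarrow> V" where
  "gen_e = extend_sum (\<lambda>t v.
     let x = v $ 1; y = v $ 2; z = v $ 3 in
     if t = 0 then at_index t x y z
     else if t \<in> {1, 11} then at_index t z x y
     else if t = 2 then at_index t (\<omega>' * y) z (\<omega> * x)
     else if t \<in> {3, 7} then at_index t (\<omega>' * z) (\<omega> * x) y
     else if t \<in> {4, 10, 12} then at_index t x (\<omega> * y) (\<omega>' * z)
     else if t = 5 then at_index t y z x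
     else if t = 6 then at_index t (\<omega> * y) z (\<omega>' * x)
     else at_index t (\<omega> * z) (\<omega>' * x) y)"

text \<open>Only the set underlying \<open>G\<close> matters below, so it is irrelevant that the product of
  \<^const>\<open>BijGroup\<close> is written in the order opposite to that of a right action.\<close>

definition G :: "(V \<Rightarrow> V) set" where
  "G = generate (BijGroup UNIV) {gen_a, gen_b, gen_c, gen_d, gen_e}"

definition G_invariant :: "(V \<Rightarrow> V \<Rightarrow> V) \<Rightarrow> bool" where
  "G_invariant br \<longleftrightarrow> (\<forall>g\<in>G. \<forall>u v. br (g u) (g v) = g (br u v))"


section \<open>The subspace \<open>W\<close>\<close>

definition W_component :: "13 \<Rightarrow> V set" where
  "W_component t = {at_index t x y y |x y. True}"

definition W :: "V set" where
  "W = span (\<Union>t. W_component t)"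

end

theory Submission
  imports Defs
begin

text \<open>
  The thirteen summands are the points of the projective plane of order 3, whose lines are the
  translates \<open>k + {0, 1, 3, 9}\<close> of a perfect difference set.  The given value of the product lies on
  the line \<open>k = 0\<close>.  Conjugates of \<open>d\<close> and \<open>e\<close> by powers of \<open>a\<close> multiply \<open>V\<^sub>0\<close> and \<open>V\<^sub>1\<close> by cube
  roots of unity and permute their coordinate axes, so they turn that one value into the whole
  product \<open>V\<^sub>0 \<times> V\<^sub>1\<close> (\<open>br_01\<close>).  For suitable orthonormal frames of the four summands of a line
  (vectors \<open>X\<close>, frame index \<open>m\<close>) the product then splits into three commuting copies of one and the
  same eight-dimensional algebra, \<open>su(3)\<close> decomposed into four orthogonal Cartan subalgebras; \<open>b\<close> and
  \<open>c\<close> supply the products of the other pairs of points of the line (\<open>br_X\<close>).  As any two points lie on a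
  line, and as symmetries force \<open>[V\<^sub>t, V\<^sub>t] = 0\<close> (\<open>br_same\<close>), the product is completely known, and
  antisymmetry can be read off.

  The Jacobi identity holds on a line by computation in \<open>su(3)\<close> (\<open>jacobiator_X\<close>).  The symmetries are
  transitive on triangles of the plane (\<open>triples_transitive\<close>), and those fixing the three vertices of
  a triangle permute the triples of coordinate axes transitively up to cube roots of unity, so one
  triple of vectors suffices (\<open>jacobiator_triangle_base\<close>).

  The frames are chosen so that \<open>W\<close> is the set of vectors whose second and third frame coordinates
  agree, for every line at once.  Hence each line meets \<open>W\<close> in the first copy of \<open>su(3)\<close> plus the
  diagonal of the other two (vectors \<open>Y\<close>), which gives closure (\<open>br_W_closed\<close>).  These two pieces
  will carry the long and the short roots of \<open>F\<^sub>4\<close>.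

  The component of \<open>W\<close> at \<open>0\<close> is abelian of real dimension 4.  On each of the four lines through \<open>0\<close>
  it acts on the remaining summands by circulant matrices, which are diagonalised by cube roots of
  unity; this yields six long and six short roots per line, 48 in all (\<open>roots_cartan\<close>).  The component
  at \<open>0\<close> therefore complexifies to a Cartan subalgebra, and four of the roots form a base with the Cartan
  matrix of \<open>F\<^sub>4\<close> (\<open>has_cartan_matrix_W\<close>).

  The frames are orthonormal, so the standard inner product is invariant (\<open>skew\<close>), and the Killing
  form satisfies \<open>\<kappa>(x, x) = - \<Sum>\<bar>[x, b]\<bar>\<^sup>2\<close>, the sum being over an orthonormal basis; it is negative on
  noncentral elements (\<open>killing_negative\<close>).  For simplicity, invariance makes the orthogonal
  projection onto an ideal commute with all inner derivations.  Additive maps of \<open>W\<close> with this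
  property are real scalars (\<open>central_scalar\<close>): on a line they are scalar on the long and on the short
  part, and consecutive lines share a summand in which their long and short parts differ.  So the
  projection is \<open>0\<close> or \<open>1\<close>, over \<open>\<complex>\<close> as well as over \<open>\<real>\<close> (\<open>complex_simple_if_central\<close>).
\<close>

section \<open>Eisenstein arithmetic and coordinates\<close>

lemma omega_Complex: "\<omega> = Complex (-1/2) (sqrt 3 / 2)"
proof -
  have "2 * complex_of_real pi * \<i> / 3 = \<i> * complex_of_real (2 * pi / 3)" by simp
  then have "\<omega> = cis (2 * pi / 3)" by (simp add: \<omega>_def cis_conv_exp mult.commute)
  then show ?thesis by (simp add: cis.code cos_120 sin_120)
qed

lemma Re_omega [simp]: "Re \<omega> = -1/2" and Im_omega [simp]: "Im \<omega> = sqrt 3 / 2"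
  by (simp_all add: omega_Complex)

lemma cnj_omega: "cnj \<omega> = -1 - \<omega>"
  by (simp add: complex_eq_iff)

lemma omega_square: "\<omega> * \<omega> = -1 - \<omega>"
  by (simp add: complex_eq_iff)

lemma omega_square_mult: "\<omega> * (\<omega> * z) = - z - \<omega> * z"
  using omega_square by (metis (no_types) left_diff_distrib mult.assoc mult_minus1)

lemma theta_omega: "\<theta> = 2 * \<omega> + 1"
  by (simp add: \<theta>_def cnj_omega)

lemmas eisenstein = cnj_omega omega_square omega_square_mult theta_omega

lemma complex_as_omega:
  "z = (Re z + Im z / sqrt 3) *\<^sub>R 1 + (2 * Im z / sqrt 3) *\<^sub>R \<omega>"
  by (simp add: complex_eq_iff field_simps)

text \<open>The real basis \<open>1, \<omega>\<close> is convenient because multiplication by \<open>\<omega>\<close> on a summand is realised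
  by symmetries: an identity between real-linear maps that is preserved by them need only be
  checked at \<open>1\<close>.\<close>
lemma linear_eq_complex:
  fixes f g :: "complex \<Rightarrow> 'a::real_vector"
  assumes "linear f" "linear g" "f 1 = g 1" "f \<omega> = g \<omega>"
  shows "f z = g z"
proof -
  have "f ((Re z + Im z / sqrt 3) *\<^sub>R 1 + (2 * Im z / sqrt 3) *\<^sub>R \<omega>)
      = g ((Re z + Im z / sqrt 3) *\<^sub>R 1 + (2 * Im z / sqrt 3) *\<^sub>R \<omega>)"
    unfolding linear_add[OF assms(1)] linear_add[OF assms(2)]
      linear_scale[OF assms(1)] linear_scale[OF assms(2)] assms(3,4) ..
  then show ?thesis by (simp only: complex_as_omega[symmetric])
qed

lemma vector3_expand: "v = vector [v $ 1, v $ 2, v $ 3]" for v :: "complex^3"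
  by (simp add: vec_eq_iff forall_3 vector_3)

lemma vector3_eq_iff [simp]:
  "(vector [x, y, z] :: complex^3) = vector [x', y', z'] \<longleftrightarrow> x = x' \<and> y = y' \<and> z = z'"
  by (auto simp: vec_eq_iff forall_3 vector_3)

lemma vector3_ops [simp]:
  "(vector [x, y, z] :: complex^3) + vector [x', y', z'] = vector [x + x', y + y', z + z']"
  "(vector [x, y, z] :: complex^3) - vector [x', y', z'] = vector [x - x', y - y', z - z']"
  "- (vector [x, y, z] :: complex^3) = vector [- x, - y, - z]"
  "c *s (vector [x, y, z] :: complex^3) = vector [c * x, c * y, c * z]"
  "r *\<^sub>R (vector [x, y, z] :: complex^3) = vector [r *\<^sub>R x, r *\<^sub>R y, r *\<^sub>R z]"
  by (simp_all add: vec_eq_iff forall_3 vector_3)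

lemma vector3_zero: "(0 :: complex^3) = vector [0, 0, 0]"
  by (simp add: vec_eq_iff forall_3 vector_3)

lemma axis_vector3:
  "axis 1 z = (vector [z, 0, 0] :: complex^3)" "axis 2 z = (vector [0, z, 0] :: complex^3)"
  "axis 3 z = (vector [0, 0, z] :: complex^3)"
  by (simp_all add: vec_eq_iff forall_3 vector_3 axis_def)

lemma vector3_mult_matrix:
  fixes A :: "complex^3^3"
  shows "(vector [x, y, z] :: complex^3) v* A
     = vector [x * A $ 1 $ 1 + y * A $ 2 $ 1 + z * A $ 3 $ 1,
               x * A $ 1 $ 2 + y * A $ 2 $ 2 + z * A $ 3 $ 2,
               x * A $ 1 $ 3 + y * A $ 2 $ 3 + z * A $ 3 $ 3]"
  by (simp add: vec_eq_iff forall_3 vector_3 vector_matrix_mult_def sum_3 mult.commute)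

lemma scaled_matrix_nth:
  "scaled_matrix [[a, b, c], [d, e, f], [g, h, i]] $ 1 = \<theta> / 3 *s vector [a, b, c]"
  "scaled_matrix [[a, b, c], [d, e, f], [g, h, i]] $ 2 = \<theta> / 3 *s vector [d, e, f]"
  "scaled_matrix [[a, b, c], [d, e, f], [g, h, i]] $ 3 = \<theta> / 3 *s vector [g, h, i]"
  by (simp_all add: scaled_matrix_def vec_eq_iff forall_3 vector_3)

lemma axis_add: "axis t (u + v) = axis t u + axis t v" for u v :: "complex^3"
  by (simp add: vec_eq_iff axis_def)
lemma axis_diff: "axis t (u - v) = axis t u - axis t v" for u v :: "complex^3"
  by (simp add: vec_eq_iff axis_def)
lemma axis_minus: "axis t (- v) = - axis t v" for v :: "complex^3"
  by (simp add: vec_eq_iff axis_def)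
lemma axis_scaleR: "axis t (r *\<^sub>R v) = r *\<^sub>R axis t v" for v :: "complex^3"
  by (simp add: vec_eq_iff axis_def)
lemma axis_zero [simp]: "axis t 0 = (0 :: V)"
  by (simp add: vec_eq_iff axis_def)

lemma linear_axis: "linear (axis t :: complex^3 \<Rightarrow> V)"
  by (rule linearI) (simp_all add: axis_add axis_scaleR)

lemma sum_axis: "(\<Sum>t\<in>UNIV. axis t (v $ t)) = (v :: V)"
  by (simp add: vec_eq_iff axis_def)

lemma linear_eq_vector3:
  fixes f g :: "complex^3 \<Rightarrow> 'a::real_vector"
  assumes f: "linear f" and g: "linear g"
    and "\<And>i. f (axis i 1) = g (axis i 1)" "\<And>i. f (axis i \<omega>) = g (axis i \<omega>)"
  shows "f v = g v"
proof -
  have ax: "linear (axis i :: complex \<Rightarrow> complex^3)" for i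
    by (rule linearI) (simp_all add: vec_eq_iff axis_def)
  have *: "f (axis i z) = g (axis i z)" for i z
    using linear_eq_complex[OF linear_compose[OF ax f] linear_compose[OF ax g], of i i z] assms(3,4)
    by (simp add: o_def)
  have v: "v = (\<Sum>i\<in>UNIV. axis i (v $ i))" by (simp add: vec_eq_iff axis_def)
  show ?thesis
    by (subst (1 2) v) (simp add: linear_sum[OF f] linear_sum[OF g] *)
qed

lemma exhaust_13:
  "t \<in> {0, 1, 2, 3, 4, 5, 6, 7, 8, 9, 10, 11, 12}" for t :: 13
proof -
  have "finite (UNIV :: 13 set)" by simp
  have "card {0, 1, 2, 3, 4, 5, 6, 7, 8, 9, 10, 11, 12 :: 13} = CARD(13)" by simp
  then have "{0, 1, 2, 3, 4, 5, 6, 7, 8, 9, 10, 11, 12 :: 13} = UNIV"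
    by (simp only: card_subset_eq[OF \<open>finite UNIV\<close> subset_UNIV])
  then show ?thesis by blast
qed

lemma forall_13:
  "(\<forall>t::13. P t) \<longleftrightarrow> P 0 \<and> P 1 \<and> P 2 \<and> P 3 \<and> P 4 \<and> P 5 \<and> P 6 \<and> P 7 \<and> P 8 \<and> P 9
     \<and> P 10 \<and> P 11 \<and> P 12"
  using exhaust_13 by (metis empty_iff insert_iff)


section \<open>The generators\<close>

lemma extend_sum_axis:
  assumes "\<And>s. f s 0 = 0"
  shows "extend_sum f (axis t v) = f t v"
proof -
  have "extend_sum f (axis t v) = (\<Sum>s\<in>UNIV. if s = t then f t v else 0)"
    unfolding extend_sum_def by (rule sum.cong) (auto simp: axis_def assms)
  then show ?thesis by simp
qed

lemma linear_extend_sum: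
  assumes "\<And>t. linear (f t)"
  shows "linear (extend_sum f)"
  unfolding extend_sum_def
  by (rule linearI)
    (simp_all add: linear_add[OF assms] linear_scale[OF assms] sum.distrib scaleR_sum_right)

lemma gen_a_axis: "gen_a (axis t v) = axis (t + 1) v"
  unfolding gen_a_def by (subst extend_sum_axis) simp_all

lemma gen_b_axis:
  "gen_b (at_index t x y z) = at_index (3 * t) (\<omega> * x) (\<omega>' * y) (\<omega>' * z)"
  unfolding gen_b_def by (subst extend_sum_axis) (simp_all add: vector3_zero[symmetric])

lemma gen_d_axis:
  "gen_d (axis t v) =
     axis t ((if t \<in> {0, 2, 8, 12} then 1 else if t \<in> {6, 7, 10} then \<omega>' else \<omega>) *s v)"
  unfolding gen_d_def by (subst extend_sum_axis) (simp_all add: vector3_zero[symmetric])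

lemma gen_e_axis:
  "gen_e (at_index t x y z) =
    (if t = 0 then at_index t x y z
     else if t \<in> {1, 11} then at_index t z x y
     else if t = 2 then at_index t (\<omega>' * y) z (\<omega> * x)
     else if t \<in> {3, 7} then at_index t (\<omega>' * z) (\<omega> * x) y
     else if t \<in> {4, 10, 12} then at_index t x (\<omega> * y) (\<omega>' * z)
     else if t = 5 then at_index t y z x
     else if t = 6 then at_index t (\<omega> * y) z (\<omega>' * x)
     else at_index t (\<omega> * z) (\<omega>' * x) y)"
  unfolding gen_e_def by (subst extend_sum_axis) (simp_all add: vector3_zero[symmetric] Let_def)

lemma gen_c_axis:
  "gen_c (at_index t x y z) = (let conj_v = (vector [cnj x, cnj y, cnj z] :: complex^3) in
     if t = 0 then - at_index 0 (cnj x) (cnj z) (cnj y)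
     else if t = 1 then - at_index 1 x z y
     else if t = 3 then - at_index 9 (\<omega> * x) (\<omega>' * z) (\<omega>' * y)
     else if t = 9 then - at_index 3 (\<omega>' * x) (\<omega> * z) (\<omega> * y)
     else if t = 4 then axis 10 conj_v
     else if t = 10 then axis 4 conj_v
     else if t = 12 then axis 12 conj_v
     else if t = 2 then axis 2 (conj_v v* M1)
     else if t = 8 then axis 8 (conj_v v* M2)
     else if t = 5 then axis 6 (conj_v v* M3)
     else if t = 6 then axis 5 (conj_v v* transpose M3)
     else if t = 7 then axis 11 (conj_v v* M4)
     else axis 7 (conj_v v* transpose M4))"
  unfolding gen_c_def
  by (subst extend_sum_axis) (simp_all add: vector3_zero[symmetric] Let_def)

lemma linear_vector3:
  assumes "linear f" "linear g" "linear h"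
  shows "linear (\<lambda>v. vector [f v, g v, h v] :: complex^3)"
  by (rule linearI)
    (simp_all add: linear_add[OF assms(1)] linear_add[OF assms(2)] linear_add[OF assms(3)]
      linear_scale[OF assms(1)] linear_scale[OF assms(2)] linear_scale[OF assms(3)])

lemma linear_axis_comp: "linear f \<Longrightarrow> linear (\<lambda>v. axis t (f v) :: V)"
  using linear_compose[OF _ linear_axis] by (simp add: o_def)

lemma linear_mult_nth: "linear (\<lambda>v :: complex^3. c * v $ i)"
  by (rule linearI) (simp_all add: algebra_simps)

lemma linear_gen_a: "linear gen_a"
  unfolding gen_a_def by (intro linear_extend_sum linear_axis)

lemma linear_gen_b: "linear gen_b"
  unfolding gen_b_def
  by (intro linear_extend_sum linear_axis_comp linear_vector3 linear_mult_nth)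

lemma linear_gen_d: "linear gen_d"
  unfolding gen_d_def
  by (intro linear_extend_sum linear_axis_comp linearI) (simp_all add: vec_eq_iff algebra_simps)

lemma linear_if: "linear f \<Longrightarrow> linear g \<Longrightarrow> linear (\<lambda>v. if b then f v else g v)"
  by (cases b) simp_all

lemma linear_nth: "linear (\<lambda>v :: complex^3. v $ i)"
  by (rule linearI) simp_all

lemma linear_gen_e: "linear gen_e"
  unfolding gen_e_def Let_def
  by (intro linear_extend_sum linear_if linear_axis_comp linear_vector3 linear_mult_nth linear_nth)

lemma linear_gen_c: "linear gen_c"
proof -
  have cnj_nth: "linear (\<lambda>v :: complex^3. cnj (v $ i))" for i
    by (rule linearI) simp_all
  have neg: "linear (\<lambda>v. - f v)" if "linear f" for f :: "complex^3 \<Rightarrow> V"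
    using linear_compose_neg[OF that] .
  have mat: "linear (\<lambda>v. f v v* A)" if "linear f" for f :: "complex^3 \<Rightarrow> complex^3" and A
    by (rule linearI) (simp_all add: linear_add[OF that] linear_scale[OF that]
        vector_matrix_mult_def vec_eq_iff algebra_simps sum.distrib scaleR_sum_right)
  show ?thesis
    unfolding gen_c_def Let_def
    by (intro linear_extend_sum linear_if neg linear_axis_comp linear_vector3 linear_mult_nth
        linear_nth cnj_nth mat)
qed

section \<open>Symmetries and frames of lines\<close>

definition shift :: "13 \<Rightarrow> V \<Rightarrow> V" where
  "shift k v = (\<chi> t. v $ (t - k))"

lemma shift_axis [simp]: "shift k (axis t v) = axis (k + t) v"
  by (auto simp: shift_def axis_def vec_eq_iff algebra_simps)

lemma linear_shift: "linear (shift k)"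
  by (rule linearI) (simp_all add: shift_def vec_eq_iff)

lemma shift_shift: "shift k (shift l v) = shift (k + l) v"
  by (simp add: shift_def vec_eq_iff algebra_simps)

lemma linear_eq_V:
  fixes f g :: "V \<Rightarrow> 'a::real_vector"
  assumes f: "linear f" and g: "linear g" and "\<And>t v. f (axis t v) = g (axis t v)"
  shows "f v = g v"
proof -
  have "f (\<Sum>t\<in>UNIV. axis t (v $ t)) = g (\<Sum>t\<in>UNIV. axis t (v $ t))"
    by (simp add: linear_sum[OF f] linear_sum[OF g] assms(3))
  then show ?thesis by (simp only: sum_axis)
qed

lemma gen_a_shift: "gen_a = shift 1"
  using linear_eq_V[OF linear_gen_a linear_shift[of 1]]
  by (auto simp: gen_a_axis add.commute fun_eq_iff)

lemma induct_13:
  fixes t :: 13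
  assumes "P 0" and step: "\<And>t. P t \<Longrightarrow> P (t + 1)"
  shows "P t"
proof -
  have "P 1" using step[OF \<open>P 0\<close>] by simp
  then have "P 2" using step by fastforce
  then have "P 3" using step by fastforce
  then have "P 4" using step by fastforce
  then have "P 5" using step by fastforce
  then have "P 6" using step by fastforce
  then have "P 7" using step by fastforce
  then have "P 8" using step by fastforce
  then have "P 9" using step by fastforce
  then have "P 10" using step by fastforce
  then have "P 11" using step by fastforce
  then have "P 12" using step by fastforce
  show ?thesis using exhaust_13[of t] \<open>P 0\<close> \<open>P 1\<close> \<open>P 2\<close> \<open>P 3\<close> \<open>P 4\<close> \<open>P 5\<close> \<open>P 6\<close>
      \<open>P 7\<close> \<open>P 8\<close> \<open>P 9\<close> \<open>P 10\<close> \<open>P 11\<close> \<open>P 12\<close> by blast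
qed

text \<open>The rows of \<open>frame t\<close> are an orthonormal basis of the summand in position \<open>t\<close> of a line;
  only \<open>t = 0, 1, 3, 9\<close> are meaningful. The rows along which the product splits are determined
  up to phases. The phases are chosen such that the three resulting copies of \<open>su(3)\<close> have the
  same real structure constants, and such that the second and third rows are exchanged by
  swapping the last two coordinates.\<close>
definition frame :: "13 \<Rightarrow> complex^3^3" where
  "frame t =
    (if t = 0 then vector [vector [1, 0, 0], vector [0, 1, 0], vector [0, 0, 1]]
     else if t = 1 then scaled_matrix [[\<omega>', \<omega>', \<omega>'], [\<omega>, \<omega>', 1], [\<omega>, 1, \<omega>']]
     else if t = 3 then scaled_matrix [[\<omega>, \<omega>', \<omega>'], [\<omega>, 1, \<omega>], [\<omega>, \<omega>, 1]]
     else scaled_matrix [[\<omega>', \<omega>, \<omega>], [\<omega>', \<omega>', 1], [\<omega>', 1, \<omega>']])"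

definition X :: "13 \<Rightarrow> 13 \<Rightarrow> 3 \<Rightarrow> complex \<Rightarrow> V" where
  "X k t m z = axis (k + t) (z *s frame t $ m)"

lemmas frame_simps =
  frame_def[of 0, simplified] frame_def[of 1, simplified] frame_def[of 3, simplified]
  frame_def[of 9, simplified]

lemma X_linear: "linear (X k t m)"
  unfolding X_def by (intro linear_axis_comp linearI) (simp_all add: vec_eq_iff algebra_simps)

lemma X_explicit:
  "X k 0 1 z = at_index k z 0 0" "X k 0 2 z = at_index k 0 z 0" "X k 0 3 z = at_index k 0 0 z"
  "X k 1 1 z = axis (k + 1) (\<theta> / 3 * z *s vector [\<omega>', \<omega>', \<omega>'])"
  "X k 1 2 z = axis (k + 1) (\<theta> / 3 * z *s vector [\<omega>, \<omega>', 1])"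
  "X k 1 3 z = axis (k + 1) (\<theta> / 3 * z *s vector [\<omega>, 1, \<omega>'])"
  "X k 3 1 z = axis (k + 3) (\<theta> / 3 * z *s vector [\<omega>, \<omega>', \<omega>'])"
  "X k 3 2 z = axis (k + 3) (\<theta> / 3 * z *s vector [\<omega>, 1, \<omega>])"
  "X k 3 3 z = axis (k + 3) (\<theta> / 3 * z *s vector [\<omega>, \<omega>, 1])"
  "X k 9 1 z = axis (k + 9) (\<theta> / 3 * z *s vector [\<omega>', \<omega>, \<omega>])"
  "X k 9 2 z = axis (k + 9) (\<theta> / 3 * z *s vector [\<omega>', \<omega>', 1])"
  "X k 9 3 z = axis (k + 9) (\<theta> / 3 * z *s vector [\<omega>', 1, \<omega>'])"
  by (simp_all add: X_def frame_simps scaled_matrix_nth mult_ac)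

locale e6_product =
  fixes br :: "V \<Rightarrow> V \<Rightarrow> V"
  assumes bil: "bilinear br" and inv: "G_invariant br"
    and value_01: "br (at_index 0 1 0 0) (at_index 1 1 0 0) =
           at_index 3 \<omega>' 1 1 - at_index 9 1 \<omega>' \<omega>'"
begin

lemmas br_simps = bilinear_ladd[OF bil] bilinear_radd[OF bil] bilinear_lmul[OF bil]
  bilinear_rmul[OF bil] bilinear_lneg[OF bil] bilinear_rneg[OF bil] bilinear_lzero[OF bil]
  bilinear_rzero[OF bil] bilinear_lsub[OF bil] bilinear_rsub[OF bil]

lemma linear_br: "linear (br u)" "linear (\<lambda>u. br u v)"
  using bil by (simp_all add: bilinear_def)

text \<open>Elements of \<open>G\<close> enter only through these two properties, which pass to composites and
  conjugates without any computation in the generated group.\<close>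
definition symmetry :: "(V \<Rightarrow> V) \<Rightarrow> bool" where
  "symmetry g \<longleftrightarrow> linear g \<and> (\<forall>u v. br (g u) (g v) = g (br u v))"

lemma symmetry_generators:
  "symmetry gen_a" "symmetry gen_b" "symmetry gen_c" "symmetry gen_d" "symmetry gen_e"
  using inv linear_gen_a linear_gen_b linear_gen_c linear_gen_d linear_gen_e
  by (auto simp: symmetry_def G_invariant_def G_def intro!: generate.incl)

lemma symmetry_comp: "symmetry g \<Longrightarrow> symmetry h \<Longrightarrow> symmetry (g \<circ> h)"
  by (auto simp: symmetry_def linear_compose)

lemma symmetry_shift: "symmetry (shift k)"
proof (induction k rule: induct_13)
  case 1 show ?case by (simp add: symmetry_def shift_def module_hom_ident)
next
  case (2 k)
  have "shift (k + 1) = gen_a \<circ> shift k"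
    by (simp add: gen_a_shift fun_eq_iff shift_shift add.commute)
  then show ?case using symmetry_comp[OF symmetry_generators(1) 2] by (simp only:)
qed

definition conj_shift :: "13 \<Rightarrow> (V \<Rightarrow> V) \<Rightarrow> V \<Rightarrow> V" where
  "conj_shift k g = shift k \<circ> g \<circ> shift (- k)"

lemma symmetry_conj_shift: "symmetry g \<Longrightarrow> symmetry (conj_shift k g)"
  unfolding conj_shift_def by (intro symmetry_comp symmetry_shift)

lemma symmetryD: "symmetry g \<Longrightarrow> br (g u) (g v) = g (br u v)"
  by (simp add: symmetry_def)

lemma symmetry_linear:
  assumes "symmetry g"
  shows "g (u + v) = g u + g v" "g (u - v) = g u - g v" "g (- u) = - g u" "g (r *\<^sub>R u) = r *\<^sub>R g u"
    "g 0 = 0"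
  using assms linear_add linear_diff linear_neg linear_scale linear_0
  unfolding symmetry_def by blast+

text \<open>The product \<open>V\<^sub>0 \<times> V\<^sub>1 \<rightarrow> V\<^sub>3 \<oplus> V\<^sub>9\<close> in standard coordinates. The linear forms \<open>a, b, c\<close> in
  \<open>w\<close> are, up to a factor, the coordinates with respect to \<open>frame 1\<close>, and the arguments of
  \<open>at_index 3\<close> and \<open>at_index 9\<close> are combinations of the rows of \<open>frame 3\<close> and \<open>frame 9\<close>.\<close>
definition line01 :: "complex^3 \<Rightarrow> complex^3 \<Rightarrow> V" where
  "line01 v w =
    (let a = \<omega> * (w $ 1 + w $ 2 + w $ 3); b = \<omega>' * w $ 1 + \<omega> * w $ 2 + w $ 3;
         c = \<omega>' * w $ 1 + w $ 2 + \<omega> * w $ 3;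
         p = v $ 1 * a; q = v $ 2 * b; r = v $ 3 * c;
         p' = cnj (v $ 1) * a; q' = cnj (v $ 2) * b; r' = cnj (v $ 3) * c in
     at_index 3 (\<omega> * p + \<omega> * q + \<omega> * r) (\<omega>' * p + q + \<omega> * r) (\<omega>' * p + \<omega> * q + r)
   - at_index 9 (\<omega>' * p' + \<omega>' * q' + \<omega>' * r') (\<omega> * p' + \<omega>' * q' + r') (\<omega> * p' + q' + \<omega>' * r'))"

text \<open>The formula is invariant under four symmetries that preserve \<open>V\<^sub>0\<close> and \<open>V\<^sub>1\<close>; their images
  of the one given value contain all products of coordinate vectors \<open>1\<close> and \<open>\<omega>\<close>, and these span
  over the reals.\<close>
lemma br_01: "br (axis 0 v) (axis 1 w) = line01 v w"
proof -
  define P where "P v w \<longleftrightarrow> br (axis 0 v) (axis 1 w) = line01 v w" for v w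
  note S = symmetry_generators
  have move: "P v w \<Longrightarrow> P v' w'"
    if "symmetry g" "g (axis 0 v) = axis 0 v'" "g (axis 1 w) = axis 1 w'"
      "g (line01 v w) = line01 v' w'" for g v v' w w'
    using symmetryD[OF that(1), of "axis 0 v" "axis 1 w"] that by (simp add: P_def)
  have r1: "P v (\<omega> *s w)" if "P v w" for v w
  proof -
    obtain x y z x' y' z' where vw: "v = vector [x, y, z]" "w = vector [x', y', z']"
      using vector3_expand by metis
    show ?thesis
      by (rule move[OF S(4) _ _ _ that])
        (simp_all add: vw gen_d_axis line01_def Let_def symmetry_linear[OF S(4)] eisenstein
          algebra_simps)
  qed
  have r2: "P (\<omega> *s v) w" if "P v w" for v w
  proof -
    obtain x y z x' y' z' where vw: "v = vector [x, y, z]" "w = vector [x', y', z']"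
      using vector3_expand by metis
    \<comment> \<open>multiplies \<open>V\<^sub>0\<close> by \<open>\<delta>\<^sub>1 = \<omega>\<close> and fixes \<open>V\<^sub>1\<close>, as \<open>\<delta>\<^sub>2 = 1\<close>\<close>
    have sym: "symmetry (conj_shift 12 gen_d)" by (rule symmetry_conj_shift[OF S(4)])
    show ?thesis
      by (rule move[OF sym _ _ _ that])
        (simp_all add: vw conj_shift_def gen_d_axis line01_def Let_def symmetry_linear[OF S(4)]
          symmetry_linear[OF symmetry_shift] eisenstein algebra_simps)
  qed
  have r3: "P v (vector [w $ 3, w $ 1, w $ 2])" if "P v w" for v w
  proof -
    obtain x y z x' y' z' where vw: "v = vector [x, y, z]" "w = vector [x', y', z']"
      using vector3_expand by metis
    show ?thesis
      by (rule move[OF S(5) _ _ _ that])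
        (simp_all add: vw gen_e_axis line01_def Let_def symmetry_linear[OF S(5)] eisenstein
          algebra_simps)
  qed
  have r4: "P (vector [\<omega>' * v $ 3, \<omega> * v $ 1, v $ 2]) (vector [w $ 1, \<omega> * w $ 2, \<omega>' * w $ 3])"
    if "P v w" for v w
  proof -
    obtain x y z x' y' z' where vw: "v = vector [x, y, z]" "w = vector [x', y', z']"
      using vector3_expand by metis
    \<comment> \<open>acts on \<open>V\<^sub>0\<close>, \<open>V\<^sub>1\<close> as \<open>e\<close> does on \<open>V\<^sub>3\<close>, \<open>V\<^sub>4\<close>: cyclically on axes, and diagonally\<close>
    have sym: "symmetry (conj_shift 10 gen_e)" by (rule symmetry_conj_shift[OF S(5)])
    show ?thesis
      by (rule move[OF sym _ _ _ that])
        (simp_all add: vw conj_shift_def gen_e_axis line01_def Let_def symmetry_linear[OF S(5)]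
          symmetry_linear[OF symmetry_shift] eisenstein algebra_simps)
  qed
  have cube: "\<omega> *s (\<omega> *s (\<omega> *s v)) = v" "\<omega> *s (\<omega> *s v) = \<omega>' *s v" for v :: "complex^3"
    by (simp_all add: vec_eq_iff eisenstein algebra_simps)
  have unit: "P (\<omega> *s v) w \<longleftrightarrow> P v w" "P v (\<omega> *s w) \<longleftrightarrow> P v w"
     "P (\<omega>' *s v) w \<longleftrightarrow> P v w" "P v (\<omega>' *s w) \<longleftrightarrow> P v w" for v w
    using r1 r2 by (metis cube)+
  have e1: "P (axis 1 1) (axis 1 1)"
    unfolding P_def axis_vector3 value_01 line01_def Let_def
    by (simp add: eisenstein algebra_simps)
  have axis4: "axis 4 z = (vector [z, 0, 0] :: complex^3)" for z
  proof -
    have "(4 :: 3) = 1" by simp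
    then show ?thesis using axis_vector3(1) by metis
  qed
  have next_w: "P v (axis (j + 1) 1)" if "P v (axis j 1)" for v j
    using r3[OF that] exhaust_3[of j] by (auto simp: axis_vector3 axis4)
  have next_v: "P (axis (i + 1) 1) (axis j 1)" if prem: "P (axis i 1) (axis j 1)" for i j
  proof -
    note e = unit[where v = "axis 1 1", unfolded axis_vector3, simplified]
      unit[where v = "axis 2 1", unfolded axis_vector3, simplified]
      unit[where v = "axis 3 1", unfolded axis_vector3, simplified]
      unit[where w = "axis 1 1", unfolded axis_vector3, simplified]
      unit[where w = "axis 2 1", unfolded axis_vector3, simplified]
      unit[where w = "axis 3 1", unfolded axis_vector3, simplified]
    show ?thesis
      using r4[OF prem] exhaust_3[of i] exhaust_3[of j] by (auto simp: axis_vector3 axis4 e)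
  qed
  have all: "P (axis i 1) (axis j 1)" for i j
  proof -
    have "P (axis 1 1) (axis j 1)" for j
      using e1 next_w[of _ 1] next_w[of _ 2] exhaust_3[of j] by auto
    then show ?thesis using next_v[of 1 j] next_v[of 2 j] exhaust_3[of i] by auto
  qed
  have u: "axis i \<omega> = \<omega> *s (axis i 1 :: complex^3)" for i
    by (simp add: vec_eq_iff axis_def)
  have lin1: "linear (\<lambda>v. line01 v w)" for w
    unfolding line01_def Let_def
    by (rule linearI) (simp_all add: axis_add[symmetric] axis_diff[symmetric] axis_scaleR[symmetric] algebra_simps)
  have lin2: "linear (\<lambda>w. line01 v w)" for v
    unfolding line01_def Let_def
    by (rule linearI) (simp_all add: axis_add[symmetric] axis_diff[symmetric] axis_scaleR[symmetric] algebra_simps)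
  have units: "P v (axis j w)" if "w = 1 \<or> w = \<omega>" for v j w
  proof -
    have *: "P (axis i z) (axis j w)" if "z = 1 \<or> z = \<omega>" for i z
      using all \<open>w = 1 \<or> w = \<omega>\<close> that by (auto simp: u unit)
    show ?thesis
      unfolding P_def
      by (rule linear_eq_vector3[OF linear_compose[OF linear_axis linear_br(2), unfolded o_def] lin1])
        (rule *[unfolded P_def], simp)+
  qed
  show ?thesis
    by (rule linear_eq_vector3[OF linear_compose[OF linear_axis linear_br(1), unfolded o_def] lin2])
      (rule units[unfolded P_def], simp)+
qed

end

section \<open>The product along a line\<close>

text \<open>In frame coordinates \<open>b\<close> multiplies by \<open>twist m\<close> or its conjugate, and \<open>c\<close> permutes the
  frame index by \<open>flip\<close>.\<close>
definition twist :: "3 \<Rightarrow> complex" where "twist m = (if m = 1 then \<omega> else \<omega>')"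
definition flip :: "3 \<Rightarrow> 3" where "flip m = (if m = 1 then 1 else if m = 2 then 3 else 2)"

lemma twist_simps [simp]: "twist 1 = \<omega>" "twist 2 = \<omega>'" "twist 3 = \<omega>'"
  by (simp_all add: twist_def)
lemma flip_simps [simp]: "flip 1 = 1" "flip 2 = 3" "flip 3 = 2"
  by (simp_all add: flip_def)
lemma flip_flip [simp]: "flip (flip m) = m"
  using exhaust_3[of m] by auto
lemma flip_eq_iff [simp]: "flip m = flip m' \<longleftrightarrow> m = m'"
  by (metis flip_flip)
lemma twist_flip [simp]: "twist (flip m) = twist m"
  using exhaust_3[of m] by auto
lemma twist_cancel [simp]:
  "twist m * (cnj (twist m) * z) = z" "cnj (twist m) * (twist m * z) = z"
  "twist m * (twist m * z) = cnj (twist m) * z" "cnj (twist m) * (cnj (twist m) * z) = twist m * z"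
  using exhaust_3[of m] by (auto simp: eisenstein algebra_simps)

lemmas X_ops =
  linear_add[OF X_linear] linear_diff[OF X_linear] linear_neg[OF X_linear]
  linear_scale[OF X_linear] linear_0[OF X_linear]

lemma gen_b_X:
  "gen_b (X 0 0 m z) = X 0 0 m (twist m * z)"
  "gen_b (X 0 1 m z) = X 0 3 m (cnj (twist m) * z)"
  "gen_b (X 0 3 m z) = X 0 9 m z"
  "gen_b (X 0 9 m z) = X 0 1 m (twist m * z)"
  using exhaust_3[of m]
  by (auto simp: X_explicit gen_b_axis axis_eq_axis eisenstein field_simps)

text \<open>The line \<open>5 = {5, 6, 8, 1}\<close> is preserved by \<open>c\<close>, which exchanges its first two points.
  This is the source of the products in reversed order, since antisymmetry is not yet
  available.\<close>
lemma gen_c_X_5: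
  "gen_c (X 5 0 m z) = X 5 1 (flip m) (cnj (twist m) * cnj z)"
  "gen_c (X 5 1 m z) = X 5 0 (flip m) (cnj (twist m) * cnj z)"
  "gen_c (X 5 3 m z) = - X 5 3 (flip m) (twist m * cnj z)"
  "gen_c (X 5 9 m z) = - X 5 9 (flip m) z"
  using exhaust_3[of m]
  by (auto simp: X_explicit gen_c_axis vector3_mult_matrix transpose_def M2_def M3_def
      scaled_matrix_nth axis_minus[symmetric] axis_eq_axis eisenstein field_simps)

text \<open>The map \<open>c\<close> carries line \<open>8\<close> to line \<open>7\<close> and the positions \<open>0, 1\<close> to \<open>1, 9\<close>. Together with
  the cyclic action of \<open>b\<close> on the positions \<open>1, 3, 9\<close> this reaches every ordered pair of
  positions.\<close>
lemma gen_c_X_8: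
  "gen_c (X 8 0 m z) = X 7 1 (flip m) (twist m * cnj z)"
  "gen_c (X 8 1 m z) = - X 7 9 (flip m) (cnj (twist m) * z)"
  "gen_c (X 8 3 m z) = X 7 0 (flip m) (cnj (twist m) * cnj z)"
  "gen_c (X 8 9 m z) = - X 7 3 (flip m) (cnj z)"
  using exhaust_3[of m]
  by (auto simp: X_explicit gen_c_axis vector3_mult_matrix transpose_def M2_def M4_def
      scaled_matrix_nth axis_minus[symmetric] axis_eq_axis eisenstein field_simps)

lemma shift_X: "shift l (X k t m z) = X (l + k) t m z"
  by (simp add: X_def add.assoc)

context e6_product
begin

lemma br_X_eq_shift: "br (X k s m z) (X k t m' w) = shift k (br (X 0 s m z) (X 0 t m' w))"
  using symmetryD[OF symmetry_shift, of k "X 0 s m z" "X 0 t m' w"] by (simp add: shift_X)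

text \<open>Translation by \<open>a\<close> identifies all lines, so a product may be computed on the line where a
  symmetry is easiest to use.\<close>
lemma br_X_transfer:
  assumes "\<And>m z m' w. br (X l s m z) (X l t m' w) = (if m = m' then F l m z w else 0)"
    and "\<And>m z w. F k m z w = shift (k - l) (F l m z w)"
  shows "br (X k s m z) (X k t m' w) = (if m = m' then F k m z w else 0)"
proof -
  have "br (X k s m z) (X k t m' w) = shift (k - l) (br (X l s m z) (X l t m' w))"
    by (simp add: br_X_eq_shift[of k] br_X_eq_shift[of l] shift_shift)
  then show ?thesis
    by (simp add: assms symmetry_linear[OF symmetry_shift])
qed

lemmas shift_ops = symmetry_linear[OF symmetry_shift]
lemmas b_ops = symmetry_linear[OF symmetry_generators(2)]
lemmas c_ops = symmetry_linear[OF symmetry_generators(3)]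

lemma br_X_01_base:
  "br (X 0 0 m z) (X 0 1 m' w)
    = (if m = m' then X 0 3 m (3 * z * w) - X 0 9 m (3 * cnj z * w) else 0)"
proof -
  \<comment> \<open>the factor \<open>\<theta> / 3\<close> of the frame is absorbed into \<open>u\<close> so that the goal becomes polynomial in \<open>\<omega>\<close>\<close>
  define u where "u = \<theta> / 3 * w"
  have args: "X 0 1 1 w = at_index 1 (\<omega>' * u) (\<omega>' * u) (\<omega>' * u)"
    "X 0 1 2 w = at_index 1 (\<omega> * u) (\<omega>' * u) u"
    "X 0 1 3 w = at_index 1 (\<omega> * u) u (\<omega>' * u)"
    by (simp_all add: X_explicit u_def mult_ac)
  have res: "X 0 3 1 (3 * z * w) = at_index 3 (\<omega> * (3 * z * u)) (\<omega>' * (3 * z * u)) (\<omega>' * (3 * z * u))"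
    "X 0 3 2 (3 * z * w) = at_index 3 (\<omega> * (3 * z * u)) (3 * z * u) (\<omega> * (3 * z * u))"
    "X 0 3 3 (3 * z * w) = at_index 3 (\<omega> * (3 * z * u)) (\<omega> * (3 * z * u)) (3 * z * u)"
    "X 0 9 1 (3 * z * w) = at_index 9 (\<omega>' * (3 * z * u)) (\<omega> * (3 * z * u)) (\<omega> * (3 * z * u))"
    "X 0 9 2 (3 * z * w) = at_index 9 (\<omega>' * (3 * z * u)) (\<omega>' * (3 * z * u)) (3 * z * u)"
    "X 0 9 3 (3 * z * w) = at_index 9 (\<omega>' * (3 * z * u)) (3 * z * u) (\<omega>' * (3 * z * u))" for z
    by (simp_all add: X_explicit u_def mult_ac)
  show ?thesis
    using exhaust_3[of m] exhaust_3[of m']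
    by (elim disjE; simp only: res args X_explicit(1-3))
      (simp_all add: br_01 line01_def Let_def vector3_zero[symmetric] eisenstein algebra_simps)
qed

lemma br_X_01:
  "br (X k 0 m z) (X k 1 m' w)
    = (if m = m' then X k 3 m (3 * z * w) - X k 9 m (3 * cnj z * w) else 0)"
  by (rule br_X_transfer[where l = 0 and
        F = "\<lambda>k m z w. X k 3 m (3 * z * w) - X k 9 m (3 * cnj z * w)", OF br_X_01_base]) (simp add: shift_ops shift_X)

lemma br_X_10:
  "br (X k 1 m z) (X k 0 m' w)
    = (if m = m' then X k 9 m (3 * z * cnj w) - X k 3 m (3 * z * w) else 0)"
proof (rule br_X_transfer[where l = 5 and
      F = "\<lambda>k m z w. X k 9 m (3 * z * cnj w) - X k 3 m (3 * z * w)"])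
  fix m m' z w
  have "br (X 5 1 m z) (X 5 0 m' w)
    = gen_c (br (X 5 0 (flip m) (cnj (twist m) * cnj z)) (X 5 1 (flip m') (cnj (twist m') * cnj w)))"
    by (simp add: symmetryD[OF symmetry_generators(3), symmetric] gen_c_X_5)
  then show "br (X 5 1 m z) (X 5 0 m' w)
    = (if m = m' then X 5 9 m (3 * z * cnj w) - X 5 3 m (3 * z * w) else 0)"
    by (auto simp: br_X_01 c_ops gen_c_X_5 mult_ac)
qed (simp add: shift_ops shift_X)

lemma br_X_19:
  "br (X k 1 m z) (X k 9 m' w)
    = (if m = m' then - X k 0 m (3 * z * cnj w) - X k 3 m (3 * cnj z * cnj w) else 0)"
proof (rule br_X_transfer[where l = 7 and
      F = "\<lambda>k m z w. - X k 0 m (3 * z * cnj w) - X k 3 m (3 * cnj z * cnj w)"])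
  fix m m' z w
  have "br (X 7 1 m z) (X 7 9 m' w)
    = - gen_c (br (X 8 0 (flip m) (twist m * cnj z)) (X 8 1 (flip m') (twist m' * w)))"
    by (simp add: symmetryD[OF symmetry_generators(3), symmetric] gen_c_X_8 bilinear_lneg[OF bil]
        bilinear_rneg[OF bil])
  then show "br (X 7 1 m z) (X 7 9 m' w)
    = (if m = m' then - X 7 0 m (3 * z * cnj w) - X 7 3 m (3 * cnj z * cnj w) else 0)"
    by (simp add: br_X_01 c_ops gen_c_X_8 X_ops mult_ac)
qed (simp add: shift_ops shift_X)

lemma br_X_91:
  "br (X k 9 m z) (X k 1 m' w)
    = (if m = m' then X k 0 m (3 * cnj z * w) + X k 3 m (3 * cnj z * cnj w) else 0)"
proof (rule br_X_transfer[where l = 7 and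
      F = "\<lambda>k m z w. X k 0 m (3 * cnj z * w) + X k 3 m (3 * cnj z * cnj w)"])
  fix m m' z w
  have "br (X 7 9 m z) (X 7 1 m' w)
    = - gen_c (br (X 8 1 (flip m) (twist m * z)) (X 8 0 (flip m') (twist m' * cnj w)))"
    by (simp add: symmetryD[OF symmetry_generators(3), symmetric] gen_c_X_8 bilinear_lneg[OF bil]
        bilinear_rneg[OF bil])
  then show "br (X 7 9 m z) (X 7 1 m' w)
    = (if m = m' then X 7 0 m (3 * cnj z * w) + X 7 3 m (3 * cnj z * cnj w) else 0)"
    by (simp add: br_X_10 c_ops gen_c_X_8 X_ops mult_ac)
qed (simp add: shift_ops shift_X)

lemma br_gen_b_X:
  "br (X 0 0 m z) (X 0 3 m' w) = gen_b (br (X 0 0 m (cnj (twist m) * z)) (X 0 1 m' (twist m' * w)))"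
  "br (X 0 0 m z) (X 0 9 m' w) = gen_b (br (X 0 0 m (cnj (twist m) * z)) (X 0 3 m' w))"
  "br (X 0 3 m z) (X 0 0 m' w) = gen_b (br (X 0 1 m (twist m * z)) (X 0 0 m' (cnj (twist m') * w)))"
  "br (X 0 9 m z) (X 0 0 m' w) = gen_b (br (X 0 3 m z) (X 0 0 m' (cnj (twist m') * w)))"
  "br (X 0 3 m z) (X 0 1 m' w) = gen_b (br (X 0 1 m (twist m * z)) (X 0 9 m' (cnj (twist m') * w)))"
  "br (X 0 9 m z) (X 0 3 m' w) = gen_b (br (X 0 3 m z) (X 0 1 m' (twist m' * w)))"
  "br (X 0 1 m z) (X 0 3 m' w) = gen_b (br (X 0 9 m (cnj (twist m) * z)) (X 0 1 m' (twist m' * w)))"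
  "br (X 0 3 m z) (X 0 9 m' w) = gen_b (br (X 0 1 m (twist m * z)) (X 0 3 m' w))"
  by (simp_all add: symmetryD[OF symmetry_generators(2), symmetric] gen_b_X)

lemma br_X_03_base:
  "br (X 0 0 m z) (X 0 3 m' w)
    = (if m = m' then X 0 9 m (3 * z * w) - X 0 1 m (3 * cnj z * w) else 0)"
  "br (X 0 3 m z) (X 0 0 m' w)
    = (if m = m' then X 0 1 m (3 * z * cnj w) - X 0 9 m (3 * z * w) else 0)"
  "br (X 0 3 m z) (X 0 1 m' w)
    = (if m = m' then - X 0 0 m (3 * z * cnj w) - X 0 9 m (3 * cnj z * cnj w) else 0)"
  "br (X 0 1 m z) (X 0 3 m' w)
    = (if m = m' then X 0 0 m (3 * cnj z * w) + X 0 9 m (3 * cnj z * cnj w) else 0)"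
  by (simp_all add: br_gen_b_X(1,3,5,7) br_X_01 br_X_10 br_X_19 br_X_91 b_ops gen_b_X mult_ac)

lemma br_X_09_base:
  "br (X 0 0 m z) (X 0 9 m' w)
    = (if m = m' then X 0 1 m (3 * z * w) - X 0 3 m (3 * cnj z * w) else 0)"
  "br (X 0 9 m z) (X 0 0 m' w)
    = (if m = m' then X 0 3 m (3 * z * cnj w) - X 0 1 m (3 * z * w) else 0)"
  "br (X 0 9 m z) (X 0 3 m' w)
    = (if m = m' then - X 0 0 m (3 * z * cnj w) - X 0 1 m (3 * cnj z * cnj w) else 0)"
  "br (X 0 3 m z) (X 0 9 m' w)
    = (if m = m' then X 0 0 m (3 * cnj z * w) + X 0 1 m (3 * cnj z * cnj w) else 0)"
  by (simp_all add: br_gen_b_X(2,4,6,8) br_X_03_base b_ops gen_b_X mult_ac)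

lemma br_X_distinct:
  "br (X k 0 m z) (X k 3 m' w)
    = (if m = m' then X k 9 m (3 * z * w) - X k 1 m (3 * cnj z * w) else 0)"
  "br (X k 3 m z) (X k 0 m' w)
    = (if m = m' then X k 1 m (3 * z * cnj w) - X k 9 m (3 * z * w) else 0)"
  "br (X k 3 m z) (X k 1 m' w)
    = (if m = m' then - X k 0 m (3 * z * cnj w) - X k 9 m (3 * cnj z * cnj w) else 0)"
  "br (X k 1 m z) (X k 3 m' w)
    = (if m = m' then X k 0 m (3 * cnj z * w) + X k 9 m (3 * cnj z * cnj w) else 0)"
  "br (X k 0 m z) (X k 9 m' w)
    = (if m = m' then X k 1 m (3 * z * w) - X k 3 m (3 * cnj z * w) else 0)"
  "br (X k 9 m z) (X k 0 m' w)
    = (if m = m' then X k 3 m (3 * z * cnj w) - X k 1 m (3 * z * w) else 0)"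
  "br (X k 9 m z) (X k 3 m' w)
    = (if m = m' then - X k 0 m (3 * z * cnj w) - X k 1 m (3 * cnj z * cnj w) else 0)"
  "br (X k 3 m z) (X k 9 m' w)
    = (if m = m' then X k 0 m (3 * cnj z * w) + X k 1 m (3 * cnj z * cnj w) else 0)"
  by (simp_all add: br_X_eq_shift[of k] br_X_03_base br_X_09_base shift_ops shift_X)

end

section \<open>Vanishing inside a summand\<close>

definition dchar :: "13 \<Rightarrow> complex" where
  "dchar t = (if t \<in> {0, 2, 8, 12} then 1 else if t \<in> {6, 7, 10} then \<omega>' else \<omega>)"

lemma gen_d_nth: "gen_d v $ t = dchar t *s v $ t"
proof -
  have "gen_d v $ t = (\<Sum>s\<in>UNIV. axis s (dchar s *s v $ s) $ t)"
    by (simp only: gen_d_def extend_sum_def dchar_def sum_component)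
  also have "\<dots> = (\<Sum>s\<in>UNIV. if s = t then dchar t *s v $ t else 0)"
    by (rule sum.cong) (auto simp: axis_def)
  finally show ?thesis by simp
qed

lemma omega_neq: "\<omega> \<noteq> 1" "\<omega>' \<noteq> 1" "\<omega> \<noteq> 0"
  by (auto simp: complex_eq_iff)

lemma eigen_zero: "v = \<omega> *s v \<Longrightarrow> v = 0" "v = \<omega>' *s v \<Longrightarrow> v = 0" for v :: "complex^3"
  using omega_neq by (auto simp: vec_eq_iff)

context e6_product
begin

text \<open>The conjugates of \<open>d\<close> that act trivially on \<open>V\<^sub>1\<close> fix every product of two of its vectors,
  whereas on each other summand one of them is a nontrivial cube root of unity.\<close>
lemma br_1_1_support: 
  assumes "p \<noteq> 1"
  shows "br (axis 1 v) (axis 1 w) $ p = 0"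
proof -
  let ?u = "br (axis 1 v) (axis 1 w)"
  have "?u $ p = dchar (p - j) *s ?u $ p" if j: "dchar (1 - j) = 1" for j
  proof -
    let ?g = "conj_shift j gen_d"
    have nth: "?g u $ t = dchar (t - j) *s u $ t" for u t
      by (simp add: conj_shift_def shift_def gen_d_nth)
    have "?g (axis 1 v) = axis 1 v" for v
      using j by (auto simp: vec_eq_iff[of "?g _"] nth axis_def)
    then have "?g ?u = ?u"
      using symmetryD[OF symmetry_conj_shift[OF symmetry_generators(4)], of j "axis 1 v" "axis 1 w"]
      by simp
    then show ?thesis by (metis nth)
  qed
  \<comment> \<open>the conjugating shifts \<open>j\<close> with \<open>\<delta>\<close> equal to 1 at \<open>1 - j\<close>, that is at \<open>0, 2, 8, 12\<close>\<close>
  from this[of 1] this[of 12] this[of 6] this[of 2]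
  have "?u $ p = dchar (p - 1) *s ?u $ p" "?u $ p = dchar (p - 12) *s ?u $ p"
    "?u $ p = dchar (p - 6) *s ?u $ p" "?u $ p = dchar (p - 2) *s ?u $ p"
    by (simp_all add: dchar_def)
  moreover have "dchar (p - 1) \<noteq> 1 \<or> dchar (p - 12) \<noteq> 1 \<or> dchar (p - 6) \<noteq> 1 \<or> dchar (p - 2) \<noteq> 1"
    using exhaust_13[of p] assms omega_neq by (auto simp: dchar_def)
  moreover have "dchar q \<in> {1, \<omega>, \<omega>'}" for q by (simp add: dchar_def)
  ultimately show ?thesis using eigen_zero by (metis empty_iff insert_iff)
qed

text \<open>Symmetries multiply any single axis of \<open>V\<^sub>1\<close> by \<open>\<omega>'\<close>. A product of vectors on two axes
  vanishes because \<open>1 + \<omega>' + \<omega>'\<^sup>2 = 0\<close>; a product of two vectors on one axis lies on that axis,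
  and vanishes because \<open>c\<close> acts on the first axis by \<open>- 1\<close>, while \<open>e\<close> permutes the axes.\<close>
lemma br_1_1: "br (axis 1 v) (axis 1 w) = 0"
proof -
  define scal where "scal i v = (\<chi> j. if j = i then \<omega>' * v $ j else v $ j)" for i and v :: "complex^3"
  note S = symmetry_generators
  have scal: "\<exists>g. symmetry g \<and> (\<forall>v. g (axis 1 v) = axis 1 (scal i v))" for i
  proof -
    \<comment> \<open>on \<open>V\<^sub>1\<close>: \<open>D\<close> is \<open>\<omega>\<close>, \<open>E\<close> is \<open>diag(1, \<omega>, \<omega>')\<close> and \<open>B\<close> is \<open>diag(\<omega>', 1, 1)\<close>\<close>
    define D where "D = gen_d"
    define E where "E = conj_shift 4 gen_e"
    define B where "B = D \<circ> conj_shift 1 gen_b"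
    have sym: "symmetry B" "symmetry (E \<circ> D \<circ> B)" "symmetry (E \<circ> E \<circ> D \<circ> B)"
      unfolding B_def D_def E_def by (intro symmetry_comp symmetry_conj_shift S)+
    have D: "D (at_index 1 x y z) = at_index 1 (\<omega> * x) (\<omega> * y) (\<omega> * z)" for x y z
      by (simp add: D_def gen_d_axis)
    have E: "E (at_index 1 x y z) = at_index 1 x (\<omega> * y) (\<omega>' * z)" for x y z
      by (simp add: E_def conj_shift_def gen_e_axis axis_eq_axis)
    have B: "B (at_index 1 x y z) = at_index 1 (\<omega>' * x) y z" for x y z
      by (simp add: B_def conj_shift_def gen_b_axis D eisenstein algebra_simps)
    have v: "scal i v = vector [if i = 1 then \<omega>' * v $ 1 else v $ 1,
      if i = 2 then \<omega>' * v $ 2 else v $ 2, if i = 3 then \<omega>' * v $ 3 else v $ 3]" for i v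
      by (simp add: scal_def vec_eq_iff forall_3 vector_3)
    have "B (axis 1 v) = axis 1 (scal 1 v)" "(E \<circ> D \<circ> B) (axis 1 v) = axis 1 (scal 2 v)"
      "(E \<circ> E \<circ> D \<circ> B) (axis 1 v) = axis 1 (scal 3 v)" for v
      unfolding v by (subst vector3_expand[of v], simp add: B D E eisenstein algebra_simps)+
    then show ?thesis using sym exhaust_3[of i] by blast
  qed
  define f where "f v w = br (axis 1 v) (axis 1 w) $ 1" for v w
  have f: "br (axis 1 v) (axis 1 w) = axis 1 (f v w)" for v w
    using br_1_1_support by (auto simp: vec_eq_iff[of "br _ _"] f_def axis_def)
  have f_scal: "f (scal i v) (scal i w) = scal i (f v w)" for i v w
  proof -
    obtain g where g: "symmetry g" "\<And>v. g (axis 1 v) = axis 1 (scal i v)" using scal by blast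
    have "axis 1 (f (scal i v) (scal i w)) = (axis 1 (scal i (f v w)) :: V)"
      using symmetryD[OF g(1), of "axis 1 v" "axis 1 w"] by (simp add: g(2) f)
    then show ?thesis by (auto simp: axis_eq_axis)
  qed
  have f_lin: "linear (f v)" "linear (\<lambda>v. f v w)" for v w
    unfolding f_def by (rule linearI; simp add: axis_add axis_scaleR br_simps)+
  have scal_axis: "scal i (axis j z) = axis j (if i = j then \<omega>' * z else z)" for i j z
    by (auto simp: scal_def axis_def vec_eq_iff)
  have sum0: "z + \<omega>' * z + \<omega>' * (\<omega>' * z) = 0" for z
    by (simp add: eisenstein algebra_simps)
  have axis_sum0: "axis i z + axis i (\<omega>' * z) + axis i (\<omega>' * (\<omega>' * z)) = (0 :: complex^3)" for i :: 3 and z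
    using sum0[of z] by (simp add: axis_def vec_eq_iff)
  have off: "f (axis i z) (axis j w) $ k = 0" if "k \<noteq> i" "k \<noteq> j" for i j k z w
  proof -
    have "f (axis i z) (axis j w) = scal k (f (axis i z) (axis j w))"
      using f_scal[of k "axis i z" "axis j w"] that by (simp add: scal_axis)
    then have "f (axis i z) (axis j w) $ k = scal k (f (axis i z) (axis j w)) $ k"
      by (rule arg_cong)
    then show ?thesis using omega_neq by (simp add: scal_def)
  qed
  have distinct: "f (axis i z) (axis j w) = 0" if "i \<noteq> j" for i j z w
  proof -
    let ?u = "f (axis i z) (axis j w)"
    have "f (axis i z + axis i (\<omega>' * z) + axis i (\<omega>' * (\<omega>' * z))) (axis j w)
      = ?u + scal i ?u + scal i (scal i ?u)"
      using f_scal[of i "axis i z" "axis j w"] f_scal[of i "axis i (\<omega>' * z)" "axis j w"] that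
      by (simp add: linear_add[OF f_lin(2)] scal_axis)
    then have "(?u + scal i ?u + scal i (scal i ?u)) $ j = 0"
      by (simp add: axis_sum0 linear_0[OF f_lin(2)])
    then have j: "?u $ j = 0" using that by (simp add: scal_def)
    have "f (axis i z) (axis j w + axis j (\<omega>' * w) + axis j (\<omega>' * (\<omega>' * w)))
      = ?u + scal j ?u + scal j (scal j ?u)"
      using f_scal[of j "axis i z" "axis j w"] f_scal[of j "axis i z" "axis j (\<omega>' * w)"] that
      by (simp add: linear_add[OF f_lin(1)] scal_axis)
    then have "(?u + scal j ?u + scal j (scal j ?u)) $ i = 0"
      by (simp add: axis_sum0 linear_0[OF f_lin(1)])
    then have i: "?u $ i = 0" using that by (simp add: scal_def)
    show ?thesis using i j off[of _ i j] by (metis (no_types) vec_eq_iff zero_index)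
  qed
  have one: "f (axis 1 z) (axis 1 w) = 0" for z w
  proof -
    have c: "gen_c (at_index 1 x y z) = at_index 1 (- x) (- z) (- y)" for x y z
      by (simp add: gen_c_axis axis_minus[symmetric])
    have neg: "gen_c (axis 1 (axis 1 z)) = - axis 1 (axis 1 z)" for z
      by (simp add: axis_vector3 c axis_minus[symmetric])
    have "axis 1 (f (axis 1 z) (axis 1 w)) = gen_c (axis 1 (f (axis 1 z) (axis 1 w)))"
      using symmetryD[OF S(3), of "axis 1 (axis 1 z)" "axis 1 (axis 1 w)"]
      by (simp add: neg br_simps f)
    moreover have "u $ 1 = 0" if "axis 1 u = gen_c (axis 1 u)" for u
    proof -
      obtain x y z where u: "u = vector [x, y, z]" using vector3_expand by metis
      from that have "x = - x" unfolding u c by (auto simp: axis_eq_axis vector3_zero)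
      then show ?thesis by (simp add: u)
    qed
    ultimately have "f (axis 1 z) (axis 1 w) $ 1 = 0" by blast
    then show ?thesis using off[of _ 1 1 z w] by (metis (no_types) vec_eq_iff zero_index)
  qed
  have step: "f (axis (i + 1) z) (axis (i + 1) w) = 0" if "f (axis i z) (axis i w) = 0" for i z w
  proof -
    have axis4: "axis 4 z = (vector [z, 0, 0] :: complex^3)" for z
    proof -
      have "(4 :: 3) = 1" by simp
      then show ?thesis using axis_vector3(1) by metis
    qed
    have e: "gen_e (axis 1 (axis i z)) = axis 1 (axis (i + 1) z)" for z
      using exhaust_3[of i] by (auto simp: axis_vector3 axis4 gen_e_axis)
    have "(axis 1 (f (axis (i + 1) z) (axis (i + 1) w)) :: V) = 0"
      using symmetryD[OF S(5), of "axis 1 (axis i z)" "axis 1 (axis i w)"] that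
      by (simp add: e f symmetry_linear[OF S(5)])
    then show ?thesis by (simp add: axis_eq_0_iff)
  qed
  have same: "f (axis i z) (axis i w) = 0" for i z w
    using one step[of 1 z w] step[of 2 z w] exhaust_3[of i] by auto
  have ax: "f (axis i z) (axis j w) = 0" for i j z w
    using same distinct by (cases "i = j") auto
  have right: "f v (axis j w) = (\<lambda>_. 0) v" for v j w
    by (rule linear_eq_vector3[OF f_lin(2) linear_zero]) (simp_all add: ax)
  have "f v w = (\<lambda>_. 0) w"
    by (rule linear_eq_vector3[OF f_lin(1) linear_zero]) (simp_all add: right)
  then show ?thesis by (simp add: f)
qed

lemma br_same: "br (axis t v) (axis t w) = 0"
  using symmetryD[OF symmetry_shift, of "t - 1" "axis 1 v" "axis 1 w"]
  by (simp add: br_1_1 shift_ops)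

lemma br_X_same: "br (X k t m z) (X k t m' w) = 0"
  by (simp add: X_def br_same)

lemmas br_X = br_X_01 br_X_10 br_X_19 br_X_91 br_X_distinct br_X_same

end

section \<open>Antisymmetry and the Jacobi identity\<close>

definition positions :: "13 set" where "positions = {0, 1, 3, 9}"

text \<open>Orthonormality of the frames makes the coefficients inner products.\<close>
lemma frame_expand:
  assumes "t \<in> positions"
  shows "axis (k + t) v = (\<Sum>m\<in>UNIV. X k t m (\<Sum>j\<in>UNIV. v $ j * cnj (frame t $ m $ j)))"
proof -
  obtain x y z where v: "v = vector [x, y, z]" using vector3_expand by metis
  have "(\<Sum>m\<in>UNIV. (\<Sum>j\<in>UNIV. v $ j * cnj (frame t $ m $ j)) *s frame t $ m) = v"
    using assms unfolding positions_def
    by (auto simp: v sum_3 frame_simps scaled_matrix_nth vector_3 eisenstein field_simps)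
  then have "axis (k + t) v
    = axis (k + t) (\<Sum>m\<in>UNIV. (\<Sum>j\<in>UNIV. v $ j * cnj (frame t $ m $ j)) *s frame t $ m)"
    by (simp only:)
  also have "\<dots> = (\<Sum>m\<in>UNIV. X k t m (\<Sum>j\<in>UNIV. v $ j * cnj (frame t $ m $ j)))"
    unfolding X_def by (rule linear_sum[OF linear_axis])
  finally show ?thesis .
qed

text \<open>The positions are a perfect difference set modulo 13: every nonzero residue is a
  difference of two of them.\<close>
lemma line_through:
  fixes s t :: 13
  assumes "s \<noteq> t"
  obtains k p q where "p \<in> positions" "q \<in> positions" "p \<noteq> q" "s = k + p" "t = k + q"
proof -
  have "\<exists>p\<in>positions. \<exists>q\<in>positions. p - q = d" for d
    using exhaust_13[of d] unfolding positions_def by auto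
  then obtain p q where "p \<in> positions" "q \<in> positions" "p - q = s - t" by blast
  moreover from this have "p \<noteq> q" "s = (s - p) + p" "t = (s - p) + q"
    using assms by (auto simp: algebra_simps)
  ultimately show thesis using that by blast
qed

context e6_product
begin

lemma br_antisym_X:
  assumes "p \<in> positions" "q \<in> positions"
  shows "br (X k p m z) (X k q m' w) = - br (X k q m' w) (X k p m z)"
  using assms unfolding positions_def by (auto simp: br_X mult_ac)

lemma br_antisym: "br u v = - br v u"
proof -
  have ax: "br (axis s v) (axis t w) = - br (axis t w) (axis s v)" for s t v w
  proof (cases "s = t")
    case True then show ?thesis by (simp add: br_same)
  next
    case False
    then obtain k p q where pq: "p \<in> positions" "q \<in> positions" "s = k + p" "t = k + q"
      using line_through by metis
    show ?thesis
      unfolding pq(3,4) frame_expand[OF pq(1)] frame_expand[OF pq(2)] linear_sum[OF linear_br(1)]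
        linear_sum[OF linear_br(2)] br_antisym_X[OF pq(1,2)] sum_negf
      by (subst sum.swap) (rule refl)
  qed
  have lin: "linear (\<lambda>u. - br v u)" "linear (\<lambda>u. - br u v)" for v
    using linear_br linear_compose_neg by blast+
  have right: "br u (axis t w) = - br (axis t w) u" for u t w
    by (rule linear_eq_V[OF linear_br(2) lin(1)]) (rule ax)
  show ?thesis
    by (rule linear_eq_V[OF linear_br(1) lin(2)]) (rule right)
qed

definition jacobiator :: "V \<Rightarrow> V \<Rightarrow> V \<Rightarrow> V" where
  "jacobiator u v w = br (br u v) w + br (br v w) u + br (br w u) v"

lemma jacobiator_cycle: "jacobiator u v w = jacobiator v w u"
  by (simp add: jacobiator_def)

lemma jacobiator_swap: "jacobiator v u w = - jacobiator u v w"
  unfolding jacobiator_def using br_antisym[of u v] br_antisym[of v w] br_antisym[of w u]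
  by (simp add: br_simps)

lemma linear_jacobiator: "linear (\<lambda>u. jacobiator u v w)" "linear (\<lambda>v. jacobiator u v w)" "linear (\<lambda>w. jacobiator u v w)"
  unfolding jacobiator_def by (rule linearI; simp add: br_simps algebra_simps)+

text \<open>Different frame indices commute, so only equal indices matter, and there all three
  brackets are computed in one copy of \<open>su(3)\<close>.\<close>
lemma jacobiator_X:
  assumes "p \<in> positions" "q \<in> positions" "r \<in> positions"
  shows "jacobiator (X k p m x) (X k q m' y) (X k r m'' z) = 0"
proof (cases "m = m' \<and> m' = m''")
  case False
  then show ?thesis
    using assms unfolding positions_def jacobiator_def
    by (elim insertE emptyE) (auto simp: br_X br_simps)
next
  case True
  show ?thesis
    using assms unfolding positions_def jacobiator_def
    by (elim insertE emptyE) (simp_all add: True br_X br_simps X_ops algebra_simps)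
qed

lemma symmetry_jacobiator: "symmetry g \<Longrightarrow> jacobiator (g u) (g v) (g w) = g (jacobiator u v w)"
  by (simp add: jacobiator_def symmetryD symmetry_linear)

end

text \<open>The permutation of the summands that \<open>c\<close> induces.\<close>
definition cperm :: "13 \<Rightarrow> 13" where
  "cperm t = (if t = 3 then 9 else if t = 9 then 3 else if t = 4 then 10 else if t = 10 then 4
     else if t = 5 then 6 else if t = 6 then 5 else if t = 7 then 11 else if t = 11 then 7 else t)"

lemma gen_c_involution: "gen_c (gen_c v) = v"
proof -
  have "gen_c (gen_c (at_index t x y z)) = at_index t x y z" for t x y z
    using exhaust_13[of t]
    by (auto simp: gen_c_axis vector3_mult_matrix transpose_def M1_def M2_def M3_def M4_def
        scaled_matrix_nth axis_minus[symmetric] axis_eq_axis eisenstein field_simps)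
  then have "(gen_c \<circ> gen_c) (axis t v) = id (axis t v)" for t v
    using vector3_expand[of v] by (metis comp_apply id_apply)
  then show ?thesis
    using linear_eq_V[OF linear_compose[OF linear_gen_c linear_gen_c] linear_id] by (metis comp_apply id_apply)
qed

lemma gen_c_axis_surj: "\<exists>w. axis (cperm t) v = gen_c (axis t w)"
proof -
  have ex: "\<exists>w. gen_c (axis t v) = axis (cperm t) w" for t v
    using exhaust_13[of t]
    by (subst vector3_expand[of v]) (auto simp: gen_c_axis cperm_def axis_minus[symmetric])
  have "cperm (cperm t) = t"
    using exhaust_13[of t] by (auto simp: cperm_def)
  then obtain w where "gen_c (axis (cperm t) v) = axis t w" using ex by metis
  then show ?thesis by (metis gen_c_involution)
qed

lemma gen_b_axis_surj: "\<exists>w. axis (3 * t) v = gen_b (axis t w)"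
proof -
  have "axis (3 * t) v = gen_b (at_index t (\<omega>' * v $ 1) (\<omega> * v $ 2) (\<omega> * v $ 3))"
    by (subst vector3_expand[of v]) (simp add: gen_b_axis eisenstein algebra_simps)
  then show ?thesis by blast
qed

lemma V_eq_iff: "u = v \<longleftrightarrow> (\<forall>t. u $ t = v $ t)" for u v :: V
  by (rule vec_eq_iff)

lemmas V_eq_iff_13 = V_eq_iff[unfolded forall_13]

context e6_product
begin

lemma br_axis_frames:
  assumes "p \<in> positions" "q \<in> positions" "s = k + p" "t = k + q"
  shows "br (axis s v) (axis t w) = (\<Sum>m\<in>UNIV.
    br (X k p m (\<Sum>j\<in>UNIV. v $ j * cnj (frame p $ m $ j)))
       (X k q m (\<Sum>j\<in>UNIV. w $ j * cnj (frame q $ m $ j))))"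
proof -
  have off: "br (X k p m x) (X k q m' y) = 0" if "m \<noteq> m'" for m m' x y
    using assms(1,2) that unfolding positions_def by (auto simp: br_X)
  have "br (axis s v) (axis t w) = (\<Sum>m\<in>UNIV. \<Sum>m'\<in>UNIV.
    br (X k p m (\<Sum>j\<in>UNIV. v $ j * cnj (frame p $ m $ j)))
       (X k q m' (\<Sum>j\<in>UNIV. w $ j * cnj (frame q $ m' $ j))))"
    unfolding assms(3,4) frame_expand[OF assms(1)] frame_expand[OF assms(2)]
    by (simp only: linear_sum[OF linear_br(1)] linear_sum[OF linear_br(2)])
       (subst sum.swap, rule refl)
  then show ?thesis by (simp add: sum_3 off)
qed

text \<open>The points \<open>0, 1, 2\<close> are not collinear. The three double brackets lie in \<open>V\<^sub>5 \<oplus> V\<^sub>6 \<oplus> V\<^sub>7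
  \<oplus> V\<^sub>1\<^sub>1\<close>, where the contributions cancel.\<close>
lemma jacobiator_triangle_base:
  "jacobiator (at_index 0 1 0 0) (at_index 1 1 0 0) (at_index 2 1 0 0) = 0"
proof -
  note S = positions_def br_X sum_3 frame_simps scaled_matrix_nth X_explicit V_eq_iff_13 axis_def
    vector3_zero eisenstein field_simps
  let ?e = "\<lambda>t. at_index t 1 0 0"
  have F1: "br (?e 1) (?e 2) = at_index 4 \<omega>' 1 1 - at_index 10 1 \<omega>' \<omega>'"
    using symmetryD[OF symmetry_shift, of 1 "?e 0" "?e 1"] by (simp add: value_01 shift_ops)
  have F2: "br (?e 2) (?e 0) = at_index 8 \<omega>' \<omega>' \<omega>' - at_index 12 \<omega> 1 1"
    by (subst br_axis_frames[of 3 1 _ 12]) (auto simp: S)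
  have F3: "br (at_index 3 \<omega>' 1 1) (?e 2)
      = at_index 5 (2 + \<omega>) (\<omega> - 1) (\<omega> - 1) + at_index 11 (1 - \<omega>) (- 2 - \<omega>) (- 2 - \<omega>)"
    by (subst br_axis_frames[of 1 0 _ 2]) (auto simp: S)
  have F4: "br (at_index 9 1 \<omega>' \<omega>') (?e 2)
      = at_index 6 (\<omega> - 1) (- 1 - 2 * \<omega>) (- 1 - 2 * \<omega>) + at_index 7 (3 + 3 * \<omega>) 0 0"
    by (subst br_axis_frames[of 3 9 _ 6]) (auto simp: S)
  have F5: "br (at_index 4 \<omega>' 1 1) (?e 0)
      = at_index 5 (- 3 - 3 * \<omega>) 0 0 + at_index 7 (1 + 2 * \<omega>) (1 - \<omega>) (1 - \<omega>)"
    by (subst br_axis_frames[of 0 9 _ 4]) (auto simp: S)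
  have F6: "br (at_index 10 1 \<omega>' \<omega>') (?e 0)
      = at_index 6 (2 + \<omega>) (2 + \<omega>) (2 + \<omega>) + at_index 11 (- 3 * \<omega>) 0 0"
    by (subst br_axis_frames[of 0 3 _ 10]) (auto simp: S)
  have F7: "br (at_index 8 \<omega>' \<omega>' \<omega>') (?e 1)
      = at_index 5 (1 + 2 * \<omega>) (1 - \<omega>) (1 - \<omega>) + at_index 6 (1 + 2 * \<omega>) (1 - \<omega>) (1 - \<omega>)"
    by (subst br_axis_frames[of 3 9 _ 5]) (auto simp: S)
  have F8: "br (at_index 12 \<omega> 1 1) (?e 1)
      = at_index 7 (- 2 - \<omega>) (1 - \<omega>) (1 - \<omega>) + at_index 11 (1 + 2 * \<omega>) (- 2 - \<omega>) (- 2 - \<omega>)"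
    by (subst br_axis_frames[of 1 3 _ 11]) (auto simp: S)
  show ?thesis
    unfolding jacobiator_def value_01 F1 F2 br_simps F3 F4 F5 F6 F7 F8
    by (simp add: V_eq_iff_13 axis_def vector3_zero eisenstein)
qed


definition vanishes :: "complex^3 \<Rightarrow> complex^3 \<Rightarrow> complex^3 \<Rightarrow> bool" where
  "vanishes x y z \<longleftrightarrow> jacobiator (axis 0 x) (axis 1 y) (axis 2 z) = 0"

lemma vanishes_move:
  assumes "symmetry g" "g (axis 0 x) = axis 0 x'" "g (axis 1 y) = axis 1 y'" "g (axis 2 z) = axis 2 z'"
    and "vanishes x y z"
  shows "vanishes x' y' z'"
  using symmetry_jacobiator[OF assms(1), of "axis 0 x" "axis 1 y" "axis 2 z"] assms
  by (simp add: vanishes_def symmetry_linear)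

text \<open>Conjugates of \<open>d\<close> multiply \<open>V\<^sub>1\<close> alone, \<open>V\<^sub>2\<close> alone, and \<open>V\<^sub>0\<close> together with \<open>V\<^sub>2\<close>; these
  generate independent multiplications of the three summands.\<close>
lemma vanishes_unit:
  "vanishes x (\<omega> *s y) z \<longleftrightarrow> vanishes x y z" "vanishes x y (\<omega> *s z) \<longleftrightarrow> vanishes x y z" "vanishes (\<omega> *s x) y z \<longleftrightarrow> vanishes x y z"
  "vanishes x (\<omega>' *s y) z \<longleftrightarrow> vanishes x y z" "vanishes x y (\<omega>' *s z) \<longleftrightarrow> vanishes x y z" "vanishes (\<omega>' *s x) y z \<longleftrightarrow> vanishes x y z"
proof -
  note S = symmetry_generators(4)
  have cube: "\<omega> *s (\<omega> *s (\<omega> *s v)) = v" "\<omega> *s (\<omega> *s v) = \<omega>' *s v" for v :: "complex^3"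
    by (simp_all add: vec_eq_iff eisenstein algebra_simps)
  have y: "vanishes x (\<omega> *s y) z" if "vanishes x y z" for x y z
    by (rule vanishes_move[OF S _ _ _ that]) (simp_all add: gen_d_axis)
  have z: "vanishes x y (\<omega> *s z)" if "vanishes x y z" for x y z
    by (rule vanishes_move[OF symmetry_conj_shift[OF S, of 1] _ _ _ that])
      (simp_all add: gen_d_axis conj_shift_def)
  have xz: "vanishes (\<omega> *s x) y (\<omega> *s z)" if "vanishes x y z" for x y z
    by (rule vanishes_move[OF symmetry_conj_shift[OF S, of 12] _ _ _ that])
      (simp_all add: gen_d_axis conj_shift_def)
  show y': "vanishes x (\<omega> *s y) z \<longleftrightarrow> vanishes x y z" and z': "vanishes x y (\<omega> *s z) \<longleftrightarrow> vanishes x y z" for x y z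
    using y z by (metis cube(1))+
  show x': "vanishes (\<omega> *s x) y z \<longleftrightarrow> vanishes x y z" for x y z
    using xz z' by (metis cube(1))
  show "vanishes x (\<omega>' *s y) z \<longleftrightarrow> vanishes x y z" "vanishes x y (\<omega>' *s z) \<longleftrightarrow> vanishes x y z" "vanishes (\<omega>' *s x) y z \<longleftrightarrow> vanishes x y z"
    unfolding cube(2)[symmetric] x' y' z' by (rule refl)+
qed

text \<open>Conjugates of \<open>e\<close> act on each of \<open>V\<^sub>0, V\<^sub>1, V\<^sub>2\<close> by monomial matrices. Up to cube roots of
  unity the shifts \<open>3\<close>, \<open>1\<close> and \<open>10\<close> cycle the axes of \<open>V\<^sub>1\<close> alone, of \<open>V\<^sub>2\<close> alone, and of \<open>V\<^sub>0\<close>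
  together with \<open>V\<^sub>2\<close>, so all 27 triples of axes are reached from one.\<close>
lemma vanishes_axis: "vanishes (axis i 1) (axis j 1) (axis k 1)"
proof -
  note S = symmetry_generators(5)
  have num: "axis 4 c = (vector [c, 0, 0] :: complex^3)" "axis 5 c = (vector [0, c, 0] :: complex^3)" for c
  proof -
    have "(4 :: 3) = 1" "(5 :: 3) = 2" by simp_all
    then show "axis 4 c = (vector [c, 0, 0] :: complex^3)" "axis 5 c = (vector [0, c, 0] :: complex^3)"
      using axis_vector3(1,2) by metis+
  qed
  define diag where "diag i = (if i = 1 then 1 else if i = 2 then \<omega> else \<omega>')" for i :: 3
  define turn where "turn i = (if i = 1 then \<omega> else if i = 2 then 1 else \<omega>')" for i :: 3
  have diag: "gen_e (axis t (axis i 1)) = axis t (diag i *s axis i 1)" if "t \<in> {4, 10, 12}" for t i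
    using that exhaust_3[of i] by (auto simp: axis_vector3 gen_e_axis diag_def)
  have fixed: "gen_e (axis 0 (axis i 1)) = axis 0 (axis i 1)" for i
    using exhaust_3[of i] by (auto simp: axis_vector3 gen_e_axis)
  have next1: "gen_e (axis t (axis i 1)) = axis t (axis (i + 1) 1)" if "t \<in> {1, 11}" for t i
    using that exhaust_3[of i] by (auto simp: axis_vector3 num gen_e_axis)
  have next2: "gen_e (axis t (axis i 1)) = axis t (turn i *s axis (i + 1) 1)" if "t = 3" for t i
    using that exhaust_3[of i] by (auto simp: axis_vector3 num gen_e_axis turn_def)
  have next3: "gen_e (axis t (axis i 1)) = axis t (axis (i + 2) 1)" if "t = 5" for t i
    using that exhaust_3[of i] by (auto simp: axis_vector3 num gen_e_axis)
  have unit: "vanishes (diag i *s x) y z \<longleftrightarrow> vanishes x y z" "vanishes x (diag i *s y) z \<longleftrightarrow> vanishes x y z"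
    "vanishes x y (diag i *s z) \<longleftrightarrow> vanishes x y z" "vanishes (turn i *s x) y z \<longleftrightarrow> vanishes x y z" for i x y z
    by (auto simp: diag_def turn_def vanishes_unit)
  have step_y: "vanishes (axis i 1) (axis (j + 1) 1) (axis k 1)" if "vanishes (axis i 1) (axis j 1) (axis k 1)" for i j k
    using vanishes_move[OF symmetry_conj_shift[OF S, of 3] _ _ _ that, of "diag i *s axis i 1" "axis (j + 1) 1"
        "diag k *s axis k 1"]
    by (simp add: conj_shift_def diag next1 unit)
  have step_z: "vanishes (axis i 1) (axis j 1) (axis (k + 1) 1)" if "vanishes (axis i 1) (axis j 1) (axis k 1)" for i j k
    using vanishes_move[OF symmetry_conj_shift[OF S, of 1] _ _ _ that, of "diag i *s axis i 1" "axis j 1"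
        "axis (k + 1) 1"]
    by (simp add: conj_shift_def diag fixed next1 unit)
  have step_x: "vanishes (axis (i + 1) 1) (axis j 1) (axis (k + 2) 1)" if "vanishes (axis i 1) (axis j 1) (axis k 1)" for i j k
    using vanishes_move[OF symmetry_conj_shift[OF S, of 10] _ _ _ that, of "turn i *s axis (i + 1) 1"
        "diag j *s axis j 1" "axis (k + 2) 1"]
    by (simp add: conj_shift_def diag next2 next3 unit)
  have start: "vanishes (axis 1 1) (axis 1 1) (axis 1 1)"
    unfolding vanishes_def using jacobiator_triangle_base by (simp add: axis_vector3)
  have all_z: "vanishes (axis i 1) (axis j 1) (axis k 1)" if "vanishes (axis i 1) (axis j 1) (axis l 1)" for i j k l
    using that step_z[of i j l] step_z[of i j "l + 1"] exhaust_3[of k] exhaust_3[of l]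
    by (auto simp: num axis_vector3)
  have all_y: "vanishes (axis i 1) (axis j 1) (axis k 1)" if "vanishes (axis i 1) (axis 1 1) (axis 1 1)" for i j k
  proof -
    have "vanishes (axis i 1) (axis j 1) (axis 1 1)"
      using that step_y[of i 1 1] step_y[of i 2 1] exhaust_3[of j] by (auto simp: num axis_vector3)
    then show ?thesis by (rule all_z)
  qed
  have x2: "vanishes (axis 2 1) (axis 1 1) (axis 1 1)"
    using all_z[OF step_x[OF start]] by simp
  have x3: "vanishes (axis 3 1) (axis 1 1) (axis 1 1)"
    using all_z[OF step_x[OF x2]] by simp
  show ?thesis
    using all_y start x2 x3 exhaust_3[of i] by blast
qed

lemma jacobiator_triangle: "jacobiator (axis 0 x) (axis 1 y) (axis 2 z) = 0"
proof -
  have u: "axis i \<omega> = \<omega> *s (axis i 1 :: complex^3)" for i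
    by (simp add: vec_eq_iff axis_def)
  have lin: "linear (\<lambda>x. jacobiator (axis s x) v w)" "linear (\<lambda>x. jacobiator v (axis s x) w)" "linear (\<lambda>x. jacobiator v w (axis s x))"
    for s v w
    using linear_compose[OF linear_axis linear_jacobiator(1)] linear_compose[OF linear_axis linear_jacobiator(2)]
      linear_compose[OF linear_axis linear_jacobiator(3)] by (simp_all add: o_def)
  define unit where "unit c \<longleftrightarrow> c = 1 \<or> c = \<omega>" for c
  have units: "unit 1" "unit \<omega>" by (simp_all add: unit_def)
  have 0: "jacobiator (axis 0 (axis i a)) (axis 1 (axis j b)) (axis 2 (axis k c)) = 0"
    if "unit a" "unit b" "unit c" for i j k a b c
    using that vanishes_axis vanishes_def vanishes_unit u unfolding unit_def by metis
  have 1: "jacobiator (axis 0 x) (axis 1 (axis j b)) (axis 2 (axis k c)) = 0" if "unit b" "unit c" for x j k b c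
    by (rule linear_eq_vector3[OF lin(1) linear_zero]) (rule 0[OF units(1) that] 0[OF units(2) that])+
  have 2: "jacobiator (axis 0 x) (axis 1 y) (axis 2 (axis k c)) = 0" if "unit c" for x y k c
    by (rule linear_eq_vector3[OF lin(2) linear_zero]) (rule 1[OF units(1) that] 1[OF units(2) that])+
  show ?thesis
    by (rule linear_eq_vector3[OF lin(3) linear_zero]) (rule 2[OF units(1)] 2[OF units(2)])+
qed

end

text \<open>The group generated by the translations, multiplication by 3 and \<open>cperm\<close> is transitive on
  noncollinear triples; collinear and degenerate ones are covered by \<open>line\<close>. After a translation
  the triple contains \<open>0\<close>, so the claim is about a relation \<open>R\<close> between the other two entries.
  The facts \<open>r0\<close> to \<open>r17\<close> and \<open>col\<close> contain a representative of every pair of distinct nonzero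
  entries, up to exchange and multiplication by 3.\<close>
lemma triples_transitive:
  fixes P :: "13 \<Rightarrow> 13 \<Rightarrow> 13 \<Rightarrow> bool"
  assumes line: "\<And>k p q r. p \<in> positions \<Longrightarrow> q \<in> positions \<Longrightarrow> r \<in> positions \<Longrightarrow>
      P (k + p) (k + q) (k + r)"
    and base: "P 0 1 2"
    and swap: "\<And>r s t. P r s t \<Longrightarrow> P r t s" and cycle: "\<And>r s t. P r s t \<Longrightarrow> P s t r"
    and shift: "\<And>k r s t. P r s t \<Longrightarrow> P (k + r) (k + s) (k + t)"
    and triple: "\<And>r s t. P r s t \<Longrightarrow> P (3 * r) (3 * s) (3 * t)"
    and perm: "\<And>r s t. P r s t \<Longrightarrow> P (cperm r) (cperm s) (cperm t)"
  shows "P r s t"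
proof -
  define R where "R s t \<longleftrightarrow> P 0 s t" for s t
  have R_swap: "R t s" if "R s t" for s t
    using swap that unfolding R_def .
  have R_triple: "R (3 * s) (3 * t)" if "R s t" for s t
    using triple[of 0 s t] that by (simp add: R_def)
  have rot: "R s' t'" if "R s t" "s' = - s" "t' = t - s" for s t s' t'
    using swap[OF cycle[OF shift[of 0 s t "- s"]]] that by (simp add: R_def)
  have via_c: "R s' t'" if "R s t" "s' = cperm (k + s) - cperm k" "t' = cperm (k + t) - cperm k"
    for s t k s' t'
    using shift[OF perm[OF shift[of 0 s t k]], of "- cperm k"] that by (simp add: R_def)
  note c = cperm_def
  have r0: "R 1 2" using base by (simp add: R_def)
  have r1: "R 12 1" by (rule rot[OF r0]) simp_all
  have r2: "R 1 8" by (rule via_c[OF r0, of _ 1]) (simp_all add: c)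
  have r3: "R 7 8" by (rule via_c[OF r0, of _ 2]) (simp_all add: c)
  have r4: "R 1 10" by (rule via_c[OF r0, of _ 3]) (simp_all add: c)
  have r5: "R 9 8" by (rule via_c[OF r0, of _ 4]) (simp_all add: c)
  have r6: "R 12 5" by (rule via_c[OF r0, of _ 5]) (simp_all add: c)
  have r7: "R 10 5" by (rule via_c[OF r0, of _ 7]) (simp_all add: c)
  have r8: "R 1 4" by (rule via_c[OF r0, of _ 9]) (simp_all add: c)
  have r9: "R 3 8" by (rule via_c[OF r0, of _ 10]) (simp_all add: c)
  have r10: "R 5 6" by (rule via_c[OF r0, of _ 11]) (simp_all add: c)
  have r11: "R 11 12" by (rule rot[OF R_swap[OF r0]]) simp_all
  have r12: "R 7 12" by (rule via_c[OF R_swap[OF r1], of _ 2]) (simp_all add: c)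
  have r13: "R 1 6" by (rule via_c[OF R_swap[OF r1], of _ 3]) (simp_all add: c)
  have r14: "R 12 4" by (rule via_c[OF R_swap[OF r1], of _ 5]) (simp_all add: c)
  have r15: "R 1 5" by (rule via_c[OF R_swap[OF r1], of _ 9]) (simp_all add: c)
  have r16: "R 7 2" by (rule via_c[OF r2, of _ 2]) (simp_all add: c)
  have r17: "R 6 7" by (rule via_c[OF r3, of _ 5]) (simp_all add: c)
  have on_line: "R s t"
    if "p \<in> positions" "q \<in> positions" "r \<in> positions" "0 = k + p" "s = k + q" "t = k + r"
    for k p q r s t
    using line[OF that(1-3), of k] that(4-6) by (simp add: R_def)
  have col: "R 1 3" "R 12 2" "R 12 8" "R 2 8"
    by (rule on_line[of 0 1 3 0] on_line[of 1 0 3 12] on_line[of 1 0 9 12] on_line[of 1 3 9 12];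
        simp add: positions_def)+
  have degenerate: "R s t" if "s = 0 \<or> t = 0 \<or> s = t" for s t
  proof -
    have "P 0 0 u \<and> P 0 u u" for u
    proof (cases "u = 0")
      case True
      then show ?thesis using line[of 0 0 0 0] by (simp add: positions_def)
    next
      case False
      then obtain k p q where "p \<in> positions" "q \<in> positions" "0 = k + p" "u = k + q"
        using line_through[of 0 u] by metis
      then show ?thesis using line[of p p q k] line[of p q q k] by simp
    qed
    then show ?thesis using that swap unfolding R_def by blast
  qed
  have images: "R s t \<and> R t s \<and> R (3 * s) (3 * t) \<and> R (3 * t) (3 * s)" if "R s t" for s t
    using that R_swap R_triple by blast
  \<comment> \<open>the products must appear as numerals below 13, since facts about \<open>R\<close> are matched syntactically\<close>
  have reduce: "3 * 1 = (3 :: 13)" "3 * 2 = (6 :: 13)" "3 * 3 = (9 :: 13)" "3 * 4 = (12 :: 13)" "3 * 5 = (2 :: 13)" "3 * 6 = (5 :: 13)"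
    "3 * 7 = (8 :: 13)" "3 * 8 = (11 :: 13)" "3 * 9 = (1 :: 13)" "3 * 10 = (4 :: 13)" "3 * 11 = (7 :: 13)" "3 * 12 = (10 :: 13)"
    by simp_all
  note seeds = r0 r1 r2 r3 r4 r5 r6 r7 r8 r9 r10 r11 r12 r13 r14 r15 r16 r17 col
  note once = seeds[THEN images, simplified reduce]
  note twice = once[THEN conjunct2, THEN conjunct2, THEN conjunct1, THEN images, simplified reduce]
  have "R s t" for s t
    using exhaust_13[of s] exhaust_13[of t]
    by (elim insertE emptyE; simp add: once twice degenerate)
  then show ?thesis
    using shift[of 0 "s - r" "t - r" r] by (simp add: R_def)
qed

context e6_product
begin

lemma jacobi: "jacobiator u v w = 0"
proof -
  define P where "P r s t \<longleftrightarrow> (\<forall>x y z. jacobiator (axis r x) (axis s y) (axis t z) = 0)" for r s t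
  have P_symmetry: "P r' s' t'"
    if prem: "symmetry g" "P r s t" "\<And>x. \<exists>y. axis r' x = g (axis r y)" "\<And>x. \<exists>y. axis s' x = g (axis s y)"
      "\<And>x. \<exists>y. axis t' x = g (axis t y)" for g r s t r' s' t'
    unfolding P_def
  proof (intro allI)
    fix x y z
    obtain x' y' z' where "axis r' x = g (axis r x')" "axis s' y = g (axis s y')" "axis t' z = g (axis t z')"
      using prem(3-5) by metis
    then show "jacobiator (axis r' x) (axis s' y) (axis t' z) = 0"
      using prem(1,2) by (simp add: symmetry_jacobiator P_def symmetry_linear)
  qed
  have axes: "P r s t" for r s t
  proof (rule triples_transitive)
    show "P (k + p) (k + q) (k + r)" if "p \<in> positions" "q \<in> positions" "r \<in> positions" for k p q r
      unfolding P_def frame_expand[OF that(1)] frame_expand[OF that(2)] frame_expand[OF that(3)]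
        linear_sum[OF linear_jacobiator(1)] linear_sum[OF linear_jacobiator(2)] linear_sum[OF linear_jacobiator(3)]
        jacobiator_X[OF that]
      by simp
    show "P 0 1 2" by (simp add: P_def jacobiator_triangle)
    show "P r t s" if "P r s t" for r s t
      using that jacobiator_swap jacobiator_cycle unfolding P_def by (metis neg_equal_0_iff_equal)
    show "P s t r" if "P r s t" for r s t
      using that jacobiator_cycle unfolding P_def by metis
    show "P (k + r) (k + s) (k + t)" if "P r s t" for k r s t
      by (rule P_symmetry[OF symmetry_shift[of k] that]) (metis shift_axis)+
    show "P (3 * r) (3 * s) (3 * t)" if "P r s t" for r s t
      by (rule P_symmetry[OF symmetry_generators(2) that]) (rule gen_b_axis_surj)+
    show "P (cperm r) (cperm s) (cperm t)" if "P r s t" for r s t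
      by (rule P_symmetry[OF symmetry_generators(3) that]) (rule gen_c_axis_surj)+
  qed
  have 1: "jacobiator u (axis s y) (axis t z) = 0" for u s y t z
    by (rule linear_eq_V[OF linear_jacobiator(1) linear_zero]) (use axes in \<open>simp add: P_def\<close>)
  have 2: "jacobiator u v (axis t z) = 0" for u v t z
    by (rule linear_eq_V[OF linear_jacobiator(2) linear_zero]) (rule 1)
  show ?thesis
    by (rule linear_eq_V[OF linear_jacobiator(3) linear_zero]) (rule 2)
qed

lemma lie_algebra_V: "lie_algebra scaleR UNIV br"
proof -
  have "br x x = 0" for x
  proof -
    have "2 *\<^sub>R br x x = 0" using br_antisym[of x x] by (metis add.right_inverse scaleR_2)
    then show ?thesis by simp
  qed
  then show ?thesis
    by unfold_locales (use jacobi in \<open>auto simp: br_simps jacobiator_def subspace_raw_def[symmetric] subspace_UNIV\<close>)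
qed

end

section \<open>The invariant inner product\<close>

lemma frame_orthonormal:
  assumes "t \<in> positions"
  shows "(\<Sum>i\<in>UNIV. frame t $ m $ i * cnj (frame t $ m' $ i)) = (if m = m' then 1 else 0)"
  using assms exhaust_3[of m] exhaust_3[of m'] unfolding positions_def
  by (elim insertE emptyE disjE)
    (simp_all add: sum_3 frame_simps scaled_matrix_nth vector_3 eisenstein field_simps)

lemma inner_complex_Re: "inner z w = Re (z * cnj w)" for z w :: complex
  by (simp add: inner_complex_def)

lemma inner_X:
  assumes "p \<in> positions" "q \<in> positions"
  shows "inner (X k p m z) (X k q m' w) = (if p = q \<and> m = m' then Re (z * cnj w) else 0)"
proof (cases "p = q")
  case True
  have "inner (X k p m z) (X k p m' w) = inner (z *s frame p $ m) (w *s frame p $ m')"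
    by (simp add: X_def inner_axis_axis)
  also have "\<dots> = Re (z * cnj w * (\<Sum>i\<in>UNIV. frame p $ m $ i * cnj (frame p $ m' $ i)))"
    by (simp add: inner_vec_def inner_complex_Re sum_distrib_left mult_ac del: times_complex.simps)
  finally have "inner (X k p m z) (X k p m' w)
    = Re (z * cnj w * (\<Sum>i\<in>UNIV. frame p $ m $ i * cnj (frame p $ m' $ i)))" .
  then show ?thesis unfolding frame_orthonormal[OF assms(1)] using True by simp
qed (simp add: X_def inner_axis_axis)

context e6_product
begin

text \<open>Only the frames of the line are involved in the product, so it stays on the line.\<close>
lemma br_support:
  assumes "p \<in> positions" "q \<in> positions" "\<forall>r\<in>positions. t \<noteq> k + r"
  shows "br (axis (k + p) v) (axis (k + q) w) $ t = 0"
proof -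
  have X0: "X k r m z $ t = 0" if "r \<in> positions" for r m z
    using assms(3) that by (auto simp: X_def axis_def)
  have "br (X k p m x) (X k q m y) $ t = 0" for m x y
    using assms(1,2) X0 unfolding positions_def by (auto simp: br_X)
  then show ?thesis
    unfolding br_axis_frames[OF assms(1,2) refl refl] by simp
qed

lemma skew_X:
  assumes "p \<in> positions" "q \<in> positions" "r \<in> positions"
  shows "inner (br (X k p m x) (X k q m' y)) (X k r m'' z)
    = - inner (X k q m' y) (br (X k p m x) (X k r m'' z))"
proof (cases "m = m' \<and> m' = m''")
  case False
  then show ?thesis
    using assms unfolding positions_def
    by (elim insertE emptyE)
      (auto simp: br_X inner_X positions_def inner_diff_left inner_diff_right inner_add_left
        inner_add_right)
next
  case True
  show ?thesis
    using assms unfolding positions_def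
    by (elim insertE emptyE)
      (simp_all add: True br_X inner_X positions_def inner_diff_left inner_diff_right inner_add_left
        inner_add_right algebra_simps)
qed

text \<open>On a line this is the invariance of the standard form of \<open>su(3)\<close>. If the three indices are
  not collinear, both sides are zero.\<close>
lemma skew: "inner (br x y) z = - inner y (br x z)"
proof -
  have line: "inner (br (axis (k + p) x) (axis (k + q) y)) (axis (k + r) z)
      = - inner (axis (k + q) y) (br (axis (k + p) x) (axis (k + r) z))"
    if "p \<in> positions" "q \<in> positions" "r \<in> positions" for k p q r x y z
    unfolding frame_expand[OF that(1)] frame_expand[OF that(2)] frame_expand[OF that(3)]
    by (simp only: linear_sum[OF linear_br(1)] linear_sum[OF linear_br(2)] inner_sum_left
        inner_sum_right skew_X[OF that] sum_negf)
       (simp only: sum_3 ac_simps)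
  have zero: "inner (br (axis r x) (axis s y)) (axis t z) = 0"
    if "\<nexists>k p q u. p \<in> positions \<and> q \<in> positions \<and> u \<in> positions \<and> r = k + p \<and> s = k + q \<and> t = k + u"
      and "r \<noteq> s" for r s t x y z
  proof -
    obtain k p q where *: "p \<in> positions" "q \<in> positions" "r = k + p" "s = k + q"
      using line_through[OF \<open>r \<noteq> s\<close>] by metis
    then have "br (axis r x) (axis s y) $ t = 0"
      using that(1) br_support[OF *(1,2), of t k x y] by auto
    then show ?thesis by (simp add: inner_axis)
  qed
  have axes: "inner (br (axis r x) (axis s y)) (axis t z)
      = - inner (axis s y) (br (axis r x) (axis t z))" for r s t x y z
  proof (cases "\<exists>k p q u. p \<in> positions \<and> q \<in> positions \<and> u \<in> positions \<and> r = k + p \<and> s = k + q \<and> t = k + u")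
    case True
    then show ?thesis using line by blast
  next
    case False
    have "r \<noteq> s" if "r \<noteq> t"
      using line_through[OF that] False by metis
    moreover have "r \<noteq> t" if "r \<noteq> s"
      using line_through[OF that] False by metis
    moreover have "\<exists>k p. p \<in> positions \<and> r = k + p" 
      by (rule exI[of _ r], rule exI[of _ 0]) (simp add: positions_def)
    ultimately have neq: "r \<noteq> s" "r \<noteq> t" using False by blast+
    have "inner (br (axis r x) (axis s y)) (axis t z) = 0"
      by (rule zero[OF False neq(1)])
    moreover have "inner (br (axis r x) (axis t z)) (axis s y) = 0"
      by (rule zero[OF _ neq(2)]) (use False in blast)
    ultimately show ?thesis by (simp add: inner_commute)
  qed
  have 1: "inner (br x (axis s y)) (axis t z) = - inner (axis s y) (br x (axis t z))" for x s y t z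
    by (rule linear_eq_V[where f = "\<lambda>x. inner (br x (axis s y)) (axis t z)"])
      (auto intro!: linearI simp: br_simps inner_add_left inner_add_right axes)
  have 2: "inner (br x y) (axis t z) = - inner y (br x (axis t z))" for x y t z
    by (rule linear_eq_V[where f = "\<lambda>y. inner (br x y) (axis t z)"])
      (auto intro!: linearI simp: br_simps inner_add_left inner_add_right 1)
  show ?thesis
    by (rule linear_eq_V[where f = "\<lambda>z. inner (br x y) z"])
      (auto intro!: linearI simp: br_simps inner_add_left inner_add_right 2)
qed

end

section \<open>The subspace W\<close>

lemma axis_nth_13: "(axis t v :: V) $ s = (if s = t then v else 0)"
  by (simp add: axis_def)

lemma W_iff: "v \<in> W \<longleftrightarrow> (\<forall>t. v $ t $ 2 = v $ t $ 3)"
proof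
  assume "v \<in> W"
  moreover have "subspace {v :: V. \<forall>t. v $ t $ 2 = v $ t $ 3}"
    by (auto simp: subspace_def)
  moreover have "(\<Union>t. W_component t) \<subseteq> {v. \<forall>t. v $ t $ 2 = v $ t $ 3}"
    by (auto simp: W_component_def axis_nth_13 vector_3)
  ultimately show "\<forall>t. v $ t $ 2 = v $ t $ 3"
    unfolding W_def using span_minimal by blast
next
  assume *: "\<forall>t. v $ t $ 2 = v $ t $ 3"
  have "axis t (v $ t) \<in> W" for t
    unfolding W_def W_component_def
    using * vector3_expand[of "v $ t"] by (intro span_base) (metis (mono_tags, lifting) UN_I UNIV_I mem_Collect_eq)
  then have "(\<Sum>t\<in>UNIV. axis t (v $ t)) \<in> W"
    unfolding W_def by (intro span_sum)
  then show "v \<in> W" by (simp only: sum_axis)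
qed

lemma subspace_W: "subspace W"
  unfolding W_def by (rule subspace_span)

lemma W_component_image: "W_component t = range (\<lambda>p :: complex^2. at_index t (p $ 1) (p $ 2) (p $ 2))"
proof -
  have "at_index t x y y \<in> range (\<lambda>p :: complex^2. at_index t (p $ 1) (p $ 2) (p $ 2))" for x y
    by (rule range_eqI[of _ _ "vector [x, y]"]) (simp add: vector_2)
  then show ?thesis by (auto simp: W_component_def)
qed

lemma dim_W_component: "dim (W_component t) = 4"
proof -
  let ?f = "\<lambda>p :: complex^2. at_index t (p $ 1) (p $ 2) (p $ 2)"
  have nth: "linear (\<lambda>p :: complex^2. p $ i)" for i
    by (rule linearI) simp_all
  have lin: "linear ?f"
    by (intro linear_axis_comp linearI) simp_all
  have "inj ?f"
    by (auto simp: inj_def axis_eq_axis vector3_zero vec_eq_iff[of "_ :: complex^2"] forall_2)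
  then have "dim (range ?f) = dim (UNIV :: (complex^2) set)"
    by (intro dim_image_eq[OF lin]) (simp add: inj_on_subset)
  then show ?thesis by (simp add: W_component_image dim_UNIV)
qed

lemma dim_W: "dim W = 52"
proof -
  let ?f = "\<lambda>p :: (complex^2)^13. (\<chi> t. vector [p $ t $ 1, p $ t $ 2, p $ t $ 2]) :: V"
  have lin: "linear ?f"
    by (rule linearI) (simp_all add: vec_eq_iff[of "_ :: V"])
  have "inj ?f"
    by (auto simp: inj_def vec_eq_iff forall_2 forall_3 vector_3)
  then have "dim (range ?f) = dim (UNIV :: ((complex^2)^13) set)"
    by (intro dim_image_eq[OF lin]) (simp add: inj_on_subset)
  moreover have "range ?f = W"
  proof -
    have "\<exists>p. v = ?f p" if "v \<in> W" for v
      using that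
      by (intro exI[of _ "\<chi> t. vector [v $ t $ 1, v $ t $ 2]"])
        (simp add: W_iff vec_eq_iff forall_3 vector_3 vector_2)
    moreover have "?f p \<in> W" for p by (simp add: W_iff vector_3)
    ultimately show ?thesis by blast
  qed
  ultimately show ?thesis by (simp add: dim_UNIV)
qed

lemma at_index_in_W: "at_index t x y y \<in> W"
  by (simp add: W_iff axis_nth_13 vector_3)

lemma generators_preserve_W:
  assumes "g \<in> {gen_a, gen_b, gen_c, gen_d}"
  shows "g ` W \<subseteq> W"
proof -
  have lin: "linear g"
    using assms linear_gen_a linear_gen_b linear_gen_c linear_gen_d by auto
  have "gen_c (at_index t x y y) \<in> W" for t x y
    using exhaust_13[of t]
    by (auto simp: gen_c_axis vector3_mult_matrix transpose_def M1_def M2_def M3_def M4_def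
        scaled_matrix_nth axis_minus[symmetric] at_index_in_W W_iff axis_nth_13 vector_3 field_simps)
  moreover have "gen_a (at_index t x y y) \<in> W" "gen_b (at_index t x y y) \<in> W"
    "gen_d (at_index t x y y) \<in> W" for t x y
    by (simp_all add: gen_a_axis gen_b_axis gen_d_axis at_index_in_W)
  ultimately have "g ` (\<Union>t. W_component t) \<subseteq> W"
    using assms by (auto simp: W_component_def)
  then have "g ` span (\<Union>t. W_component t) \<subseteq> W"
    using linear_span_image[OF lin] span_minimal[OF _ subspace_W] by metis
  then show ?thesis by (simp add: W_def)
qed

text \<open>The intersection of \<open>W\<close> with a line: \<open>l\<close> is true for the first copy of \<open>su(3)\<close>, the long
  part, and false for the diagonal of the second and third copies, the short part. Both have the
  structure constants of a single copy.\<close>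
definition Y :: "13 \<Rightarrow> 13 \<Rightarrow> bool \<Rightarrow> complex \<Rightarrow> V" where
  "Y k t l z = (if l then X k t 1 z else X k t 2 z + X k t 3 z)"

lemma linear_Y: "linear (Y k t l)"
  unfolding Y_def by (rule linearI) (simp_all add: X_ops algebra_simps)

lemmas Y_ops =
  linear_add[OF linear_Y] linear_diff[OF linear_Y] linear_neg[OF linear_Y]
  linear_scale[OF linear_Y] linear_0[OF linear_Y]

lemma Y_in_W:
  assumes "t \<in> positions"
  shows "Y k t l z \<in> W"
proof -
  have "X k t 1 z \<in> W" "X k t 2 z + X k t 3 z \<in> W"
    using assms unfolding positions_def
    by (auto simp: X_explicit axis_add[symmetric] W_iff axis_nth_13 vector_3 algebra_simps)
  then show ?thesis by (simp add: Y_def)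
qed

text \<open>For a vector \<open>(x, y, y)\<close> the second and third frame coordinates agree, so the second one
  serves for the short part.\<close>
definition coord :: "13 \<Rightarrow> bool \<Rightarrow> complex \<Rightarrow> complex \<Rightarrow> complex" where
  "coord t l x y = (let m = if l then 1 else 2 in
     x * cnj (frame t $ m $ 1) + y * cnj (frame t $ m $ 2) + y * cnj (frame t $ m $ 3))"

lemma W_component_expand:
  assumes "t \<in> positions"
  shows "at_index (k + t) x y y = Y k t True (coord t True x y) + Y k t False (coord t False x y)"
proof -
  have "(\<Sum>j\<in>UNIV. (vector [x, y, y] :: complex^3) $ j * cnj (frame t $ 3 $ j))
    = (\<Sum>j\<in>UNIV. (vector [x, y, y] :: complex^3) $ j * cnj (frame t $ 2 $ j))"
    using assms unfolding positions_def by (auto simp: sum_3 frame_simps scaled_matrix_nth vector_3)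
  then show ?thesis
    unfolding frame_expand[OF assms] by (simp add: sum_3 Y_def coord_def vector_3 add.assoc)
qed

context e6_product
begin

lemma br_Y:
  "br (Y k 0 m z) (Y k 1 m' w)
    = (if m = m' then Y k 3 m (3 * z * w) - Y k 9 m (3 * cnj z * w) else 0)"
  "br (Y k 1 m z) (Y k 0 m' w)
    = (if m = m' then Y k 9 m (3 * z * cnj w) - Y k 3 m (3 * z * w) else 0)"
  "br (Y k 1 m z) (Y k 9 m' w)
    = (if m = m' then - Y k 0 m (3 * z * cnj w) - Y k 3 m (3 * cnj z * cnj w) else 0)"
  "br (Y k 9 m z) (Y k 1 m' w)
    = (if m = m' then Y k 0 m (3 * cnj z * w) + Y k 3 m (3 * cnj z * cnj w) else 0)"
  "br (Y k 0 m z) (Y k 3 m' w)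
    = (if m = m' then Y k 9 m (3 * z * w) - Y k 1 m (3 * cnj z * w) else 0)"
  "br (Y k 3 m z) (Y k 0 m' w)
    = (if m = m' then Y k 1 m (3 * z * cnj w) - Y k 9 m (3 * z * w) else 0)"
  "br (Y k 3 m z) (Y k 1 m' w)
    = (if m = m' then - Y k 0 m (3 * z * cnj w) - Y k 9 m (3 * cnj z * cnj w) else 0)"
  "br (Y k 1 m z) (Y k 3 m' w)
    = (if m = m' then Y k 0 m (3 * cnj z * w) + Y k 9 m (3 * cnj z * cnj w) else 0)"
  "br (Y k 0 m z) (Y k 9 m' w)
    = (if m = m' then Y k 1 m (3 * z * w) - Y k 3 m (3 * cnj z * w) else 0)"
  "br (Y k 9 m z) (Y k 0 m' w)
    = (if m = m' then Y k 3 m (3 * z * cnj w) - Y k 1 m (3 * z * w) else 0)"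
  "br (Y k 9 m z) (Y k 3 m' w)
    = (if m = m' then - Y k 0 m (3 * z * cnj w) - Y k 1 m (3 * cnj z * cnj w) else 0)"
  "br (Y k 3 m z) (Y k 9 m' w)
    = (if m = m' then Y k 0 m (3 * cnj z * w) + Y k 1 m (3 * cnj z * cnj w) else 0)"
  "br (Y k t m z) (Y k t m' w) = 0"
  by (simp_all add: Y_def br_X br_simps)

lemma br_W_closed:
  assumes "u \<in> W" "v \<in> W"
  shows "br u v \<in> W"
proof -
  note W_ops = subspace_add[OF subspace_W] subspace_diff[OF subspace_W] subspace_neg[OF subspace_W]
    subspace_0[OF subspace_W]
  have Y: "br (Y k p m z) (Y k q m' w) \<in> W" if "p \<in> positions" "q \<in> positions" for k p q m m' z w
    using that Y_in_W unfolding positions_def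
    by (elim insertE emptyE; simp add: br_Y) (auto intro!: W_ops)
  have comp: "br (at_index s x y y) (at_index t x' y' y') \<in> W" for s t x y x' y'
  proof (cases "s = t")
    case True then show ?thesis using W_ops(4) by (simp add: br_same)
  next
    case False
    then obtain k p q where pq: "p \<in> positions" "q \<in> positions" "s = k + p" "t = k + q"
      using line_through by metis
    show ?thesis
      unfolding pq(3,4) W_component_expand[OF pq(1)] W_component_expand[OF pq(2)] br_simps
      by (intro W_ops(1) Y pq)
  qed
  have "axis t (v $ t) = at_index t (v $ t $ 1) (v $ t $ 2) (v $ t $ 2)" if "v \<in> W" for v t
    using that vector3_expand[of "v $ t"] by (simp add: W_iff)
  then have "br (\<Sum>s\<in>UNIV. axis s (u $ s)) (\<Sum>t\<in>UNIV. axis t (v $ t)) \<in> W"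
    using assms comp
    by (simp add: linear_sum[OF linear_br(1)] linear_sum[OF linear_br(2)] subspace_sum[OF subspace_W])
  then show ?thesis by (simp only: sum_axis)
qed

lemma lie_algebra_W: "lie_algebra scaleR W br"
proof -
  interpret lie_algebra scaleR UNIV br by (rule lie_algebra_V)
  show ?thesis
    by unfold_locales
      (auto simp: br_W_closed subspace_W subspace_raw_def[symmetric] br_add_left br_add_right
        br_scale_left br_scale_right br_alternating jacobi)
qed

end

section \<open>Weight decompositions\<close>

context lie_algebra
begin

lemma br_zero_right: "x \<in> L \<Longrightarrow> br x 0 = 0"
  using br_scale_right[of x 0 0] subspace_0[OF subspace_carrier] by simp

lemma br_sum_right:
  assumes "x \<in> L" "finite A" "\<And>a. a \<in> A \<Longrightarrow> f a \<in> L"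
  shows "br x (sum f A) = (\<Sum>a\<in>A. br x (f a))"
  using assms(2,3)
proof (induction A rule: finite_induct)
  case empty
  then show ?case by (simp add: br_zero_right assms(1))
next
  case (insert a A)
  then have "sum f A \<in> L" by (intro subspace_sum[OF subspace_carrier]) auto
  with insert show ?case by (simp add: br_add_right assms(1))
qed

lemma br_anticommute:
  assumes "x \<in> L" "y \<in> L"
  shows "br x y = - br y x"
proof -
  have "br (x + y) (x + y) = br x x + br x y + (br y x + br y y)"
    using assms by (simp add: br_add_left br_add_right subspace_add[OF subspace_carrier])
  then have "br x y + br y x = 0"
    using assms by (simp add: br_alternating subspace_add[OF subspace_carrier])
  then show ?thesis by (simp add: eq_neg_iff_add_eq_0)
qed

lemma weight_space_scale:
  assumes "H \<subseteq> L" "x \<in> weight_space H f"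
  shows "scale r x \<in> weight_space H f"
  using assms subspace_scale[OF subspace_carrier]
  by (auto simp: weight_space_def br_scale_right subset_iff scale_left_commute)

lemma weight_space_add:
  assumes "H \<subseteq> L" "x \<in> weight_space H f" "y \<in> weight_space H f"
  shows "x + y \<in> weight_space H f"
  using assms subspace_add[OF subspace_carrier]
  by (auto simp: weight_space_def br_add_right subset_iff scale_right_distrib)

lemma weight_space_zero: "H \<subseteq> L \<Longrightarrow> 0 \<in> weight_space H f"
  using subspace_0[OF subspace_carrier] by (auto simp: weight_space_def br_zero_right subset_iff)

text \<open>The usual argument: if \<open>j\<close> is one of the weights in the sum and \<open>h\<close> separates it from \<open>g\<close>,
  then applying \<open>h - j(h)\<close> removes one summand and multiplies \<open>x\<close> by a nonzero scalar.\<close>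
lemma weights_independent:
  assumes "H \<subseteq> L" "finite F" "\<And>f. f \<in> F \<Longrightarrow> y f \<in> weight_space H f"
    and "x \<in> weight_space H g" "x = sum y F" "\<And>f. f \<in> F \<Longrightarrow> \<exists>h\<in>H. f h \<noteq> g h"
  shows "x = 0"
  using assms(2-6)
proof (induction F arbitrary: x y rule: finite_induct)
  case empty
  then show ?case by simp
next
  case (insert j F)
  obtain h where h: "h \<in> H" "j h \<noteq> g h" using insert.prems(4)[of j] by auto
  have L: "h \<in> L" "\<And>f. f \<in> insert j F \<Longrightarrow> y f \<in> L"
    using h(1) assms(1) insert.prems(1) by (auto simp: weight_space_def)
  have "scale (g h) x = br h x"
    using h(1) insert.prems(2) by (simp add: weight_space_def)
  also have "\<dots> = (\<Sum>f\<in>insert j F. br h (y f))"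
    unfolding insert.prems(3) using insert.hyps(1) L by (intro br_sum_right) auto
  also have "\<dots> = (\<Sum>f\<in>insert j F. scale (f h) (y f))"
    using insert.prems(1) h(1) by (intro sum.cong) (auto simp: weight_space_def)
  finally have "scale (g h - j h) x
      = (\<Sum>f\<in>insert j F. scale (f h) (y f)) - scale (j h) (sum y (insert j F))"
    by (simp add: scale_left_diff_distrib flip: insert.prems(3))
  also have "\<dots> = (\<Sum>f\<in>F. scale (f h - j h) (y f))"
    using insert.hyps
    by (simp add: scale_sum_right scale_right_distrib scale_left_diff_distrib sum_subtractf)
  finally have "scale (g h - j h) x = (\<Sum>f\<in>F. scale (f h - j h) (y f))" .
  moreover have "scale (f h - j h) (y f) \<in> weight_space H f" if "f \<in> F" for f
    using weight_space_scale[OF assms(1)] insert.prems(1) that by blast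
  moreover have "scale (g h - j h) x \<in> weight_space H g"
    by (rule weight_space_scale[OF assms(1) insert.prems(2)])
  ultimately have "scale (g h - j h) x = 0"
    using insert.prems(4) by (intro insert.IH[where y = "\<lambda>f. scale (f h - j h) (y f)"]) blast+
  then show ?case using h(2) by simp
qed

text \<open>The centre is an ideal, and it is not everything because the product is nonzero.\<close>
lemma simple_imp_centerless:
  assumes "lie_simple" "x \<in> L" "x \<noteq> 0"
  shows "\<exists>y\<in>L. br x y \<noteq> 0"
proof (rule ccontr)
  assume central: "\<not> ?thesis"
  let ?Z = "{z \<in> L. \<forall>y\<in>L. br z y = 0}"
  note L = subspace_0[OF subspace_carrier] subspace_add[OF subspace_carrier] subspace_scale[OF subspace_carrier]
  have zero_left: "br 0 y = 0" if "y \<in> L" for y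
    using br_scale_left[OF L(1) that, of 0] by simp
  have "br x z \<in> ?Z" if "x \<in> L" "z \<in> ?Z" for x z
  proof -
    have "br x z = - br z x" using that by (intro br_anticommute) auto
    then have "br x z = 0" using that by simp
    then show ?thesis using L(1) zero_left by simp
  qed
  moreover have "subspace ?Z"
    unfolding subspace_def using L zero_left by (auto simp: br_add_left br_scale_left)
  ultimately have "lie_ideal ?Z" unfolding lie_ideal_def by blast
  moreover have "?Z \<noteq> {0}" using central assms(2,3) by auto
  ultimately have "?Z = L" using assms(1) unfolding lie_simple_def by blast
  then show False using assms(1) unfolding lie_simple_def by blast
qed

end

text \<open>An abelian subalgebra \<open>H\<close> that spans \<open>L\<close> together with its weight spaces for a finite set
  \<open>R\<close> of nonzero weights. Independence of weights then shows that \<open>R\<close> exhausts the roots on \<open>H\<close>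
  and that \<open>H\<close> is its own normalizer.\<close>
locale weight_decomposition = lie_algebra +
  fixes H :: "'b set" and R :: "('b \<Rightarrow> 'a) set"
  assumes H: "subspace H" "H \<subseteq> L" and abelian: "\<And>x y. x \<in> H \<Longrightarrow> y \<in> H \<Longrightarrow> br x y = 0"
    and finite_R: "finite R" and R_nonzero: "\<And>f. f \<in> R \<Longrightarrow> \<exists>h\<in>H. f h \<noteq> 0"
    and decomposition: "\<And>x. x \<in> L \<Longrightarrow>
      \<exists>h\<in>H. \<exists>y. (\<forall>f\<in>R. y f \<in> weight_space H f) \<and> x = h + sum y R"
begin

lemma root_in_R:
  assumes "g \<in> roots H"
  shows "\<exists>f\<in>R. \<forall>h\<in>H. f h = g h"
proof (rule ccontr)
  assume *: "\<not> ?thesis"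
  from assms have g: "g \<in> dual_on H" "g \<noteq> (\<lambda>_. 0)" "weight_space H g \<noteq> {0}"
    by (auto simp: roots_def)
  obtain x where x: "x \<in> weight_space H g" "x \<noteq> 0"
    using g(3) weight_space_zero[OF H(2), of g] by blast
  obtain h1 where "g h1 \<noteq> 0" using g(2) by auto
  then have h1: "h1 \<in> H" "g h1 \<noteq> 0" using g(1) by (auto simp: dual_on_def)
  have "x \<in> L" using x(1) by (simp add: weight_space_def)
  then obtain h y where hy: "h \<in> H" "\<And>f. f \<in> R \<Longrightarrow> y f \<in> weight_space H f" "x = h + sum y R"
    using decomposition by blast
  have zero: "(\<lambda>_. 0) \<notin> R" using R_nonzero by force
  let ?y = "\<lambda>f. if f = (\<lambda>_. 0) then h else y f"
  have "sum ?y (insert (\<lambda>_. 0) R) = h + sum y R"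
  proof -
    have "sum ?y R = sum y R" using zero by (intro sum.cong) auto
    then show ?thesis using zero finite_R by simp
  qed
  moreover have "h \<in> weight_space H (\<lambda>_. 0)"
    using hy(1) H(2) abelian by (auto simp: weight_space_def)
  ultimately have "x = 0"
    using hy * h1 x(1) finite_R zero
    by (intro weights_independent[OF H(2), of "insert (\<lambda>_. 0) R" ?y x g]) auto
  with x(2) show False by simp
qed

text \<open>For \<open>h\<close> in \<open>H\<close> the product of \<open>h\<close> and \<open>x\<close> lies in \<open>H\<close>, of weight zero, and is a sum of
  vectors of nonzero weight; hence it vanishes. So the part of \<open>x\<close> outside \<open>H\<close> commutes with
  \<open>H\<close>, and is zero for the same reason.\<close>
lemma normalizer_H:
  assumes x: "x \<in> L" "\<And>h. h \<in> H \<Longrightarrow> br x h \<in> H"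
  shows "x \<in> H"
proof -
  obtain h0 y where y: "h0 \<in> H" "\<And>f. f \<in> R \<Longrightarrow> y f \<in> weight_space H f" "x = h0 + sum y R"
    using decomposition[OF x(1)] by auto
  have yL: "y f \<in> L" if "f \<in> R" for f using y(2)[OF that] by (simp add: weight_space_def)
  have sumL: "sum y R \<in> L" using yL by (intro subspace_sum[OF subspace_carrier])
  have in_zero: "z \<in> weight_space H (\<lambda>_. 0)" if "z \<in> H" for z
    using that H(2) abelian by (auto simp: weight_space_def)
  have br_sum: "br h (sum y R) = (\<Sum>f\<in>R. scale (f h) (y f))" if "h \<in> H" for h
  proof -
    have "br h (sum y R) = (\<Sum>f\<in>R. br h (y f))"
      using that H(2) yL finite_R by (intro br_sum_right) auto
    then show ?thesis using y(2) that by (simp add: weight_space_def)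
  qed
  have br0: "br h (sum y R) = 0" if "h \<in> H" for h
  proof -
    have "br h x = br h (sum y R)"
      unfolding y(3) using that y(1) H(2) sumL by (subst br_add_right) (auto simp: abelian)
    moreover have "br h x \<in> H"
      using br_anticommute[of h x] x that subsetD[OF H(2) that] subspace_neg[OF H(1)] by simp
    ultimately show ?thesis
      using R_nonzero y(2) finite_R weight_space_scale[OF H(2)]
      by (intro weights_independent[OF H(2), of R "\<lambda>f. scale (f h) (y f)" _ "\<lambda>_. 0"])
        (auto simp: br_sum[OF that] intro: in_zero)
  qed
  have "sum y R = 0"
    using br0 sumL R_nonzero y(2) finite_R
    by (intro weights_independent[OF H(2), of R y _ "\<lambda>_. 0"]) (auto simp: weight_space_def)
  then show ?thesis using y by simp
qed

lemma cartan_H: "cartan_subalgebra H"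
proof -
  have 0: "0 \<in> H" using H(1) by (rule subspace_0)
  have "lie_subalgebra H"
    using H abelian 0 by (auto simp: lie_subalgebra_def)
  moreover have "lower_central H (Suc 0) = {0}"
  proof -
    have "{br x y |x y. x \<in> H \<and> y \<in> H} = {0}" using abelian 0 by force
    then show ?thesis by simp
  qed
  moreover have "normalizer_of H = H"
  proof
    show "normalizer_of H \<subseteq> H" unfolding normalizer_of_def using normalizer_H by blast
    show "H \<subseteq> normalizer_of H"
      using abelian H(2) 0 by (simp add: normalizer_of_def subset_iff)
  qed
  ultimately show ?thesis
    unfolding cartan_subalgebra_def nilpotent_subalgebra_def by blast
qed

end


section \<open>Complexification\<close>

lemma vector_space_complexified:
  "vector_space (complexified_scale :: complex \<Rightarrow> 'a \<times> 'a \<Rightarrow> 'a \<times> ('a::real_vector))"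
  by unfold_locales (simp_all add: complexified_scale_def prod_eq_iff algebra_simps)

lemma lie_algebra_restrict:
  assumes "lie_algebra sc UNIV br" "module.subspace sc S" "\<And>x y. x \<in> S \<Longrightarrow> y \<in> S \<Longrightarrow> br x y \<in> S"
  shows "lie_algebra sc S br"
proof -
  interpret lie_algebra sc UNIV br by fact
  show ?thesis
    by unfold_locales
      (use assms(2,3) jacobi in \<open>auto simp: br_add_left br_add_right br_scale_left br_scale_right br_alternating\<close>)
qed

lemma lie_algebra_complexified:
  assumes "lie_algebra scaleR UNIV br"
  shows "lie_algebra complexified_scale UNIV (complexified_bracket br)"
proof -
  interpret R: lie_algebra scaleR UNIV br by fact
  interpret C: vector_space "complexified_scale :: complex \<Rightarrow> 'a \<times> 'a \<Rightarrow> 'a \<times> 'a"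
    by (rule vector_space_complexified)
  have add: "br (x + y) z = br x z + br y z" "br x (y + z) = br x y + br x z" for x y z
    by (simp_all add: R.br_add_left R.br_add_right)
  have scal: "br (r *\<^sub>R x) y = r *\<^sub>R br x y" "br x (r *\<^sub>R y) = r *\<^sub>R br x y" for r x y
    by (simp_all add: R.br_scale_left R.br_scale_right)
  have neg: "br (- x) y = - br x y" "br x (- y) = - br x y" for x y
    using scal(1)[of "-1" x y] scal(2)[of x "-1" y] by simp_all
  have diff: "br (x - y) z = br x z - br y z" "br x (y - z) = br x y - br x z" for x y z
    using add[of x "- y" z] add[of x y "- z"] by (simp_all add: neg)
  have anti: "br y x = - br x y" for x y by (rule R.br_anticommute) simp_all
  have jac: "br (br x y) z = - br (br y z) x - br (br z x) y" for x y z
    using R.jacobi[of x y z] by (simp add: algebra_simps eq_neg_iff_add_eq_0)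
  show ?thesis
  proof unfold_locales
    show "C.subspace UNIV" by (rule C.subspace_UNIV)
    fix p q r :: "'a \<times> 'a"
    show "complexified_bracket br p p = 0"
      by (simp add: complexified_bracket_def R.br_alternating anti[of "fst p" "snd p"] zero_prod_def)
    show "complexified_bracket br (complexified_bracket br p q) r
        + complexified_bracket br (complexified_bracket br q r) p
        + complexified_bracket br (complexified_bracket br r p) q = 0"
      unfolding complexified_bracket_def prod_eq_iff
      by (simp add: add diff jac[of "fst p" "fst q"] jac[of "fst p" "snd q"] jac[of "snd p" "fst q"]
          jac[of "snd p" "snd q"])
  qed (auto simp: complexified_bracket_def complexified_scale_def prod_eq_iff add diff scal
      algebra_simps)
qed

lemma subspace_complexified:
  assumes "subspace S"
  shows "module.subspace complexified_scale (S \<times> S)"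
proof -
  interpret C: vector_space "complexified_scale :: complex \<Rightarrow> 'a \<times> 'a \<Rightarrow> 'a \<times> 'a"
    by (rule vector_space_complexified)
  show ?thesis
    unfolding C.subspace_def
    using assms
    by (auto simp: complexified_scale_def zero_prod_def subspace_0 intro!: subspace_add subspace_diff subspace_scale)
qed

lemma finite_dim_complexified:
  fixes S :: "'a::euclidean_space set"
  assumes "subspace S"
  shows "\<exists>Bs. finite Bs \<and> module.span complexified_scale Bs = S \<times> S"
proof -
  interpret C: vector_space "complexified_scale :: complex \<Rightarrow> 'a \<times> 'a \<Rightarrow> 'a \<times> 'a"
    by (rule vector_space_complexified)
  obtain B where B: "B \<subseteq> S" "independent B" "S \<subseteq> span B" using basis_exists[of S] by metis
  have "finite B" using B(2) by (rule independent_imp_finite)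
  let ?Bs = "(\<lambda>b. (b, 0)) ` B"
  have "C.span ?Bs \<subseteq> S \<times> S"
    using B(1) assms by (intro C.span_minimal subspace_complexified) (auto simp: subspace_0)
  moreover have fst: "(u, 0) \<in> C.span ?Bs" if "u \<in> S" for u
  proof -
    have "subspace {u. (u, 0) \<in> C.span ?Bs}"
      unfolding subspace_def
    proof (intro conjI ballI allI; simp)
      show "(0, 0) \<in> C.span ?Bs" using C.span_zero[of ?Bs] by (simp add: zero_prod_def)
      fix x assume x: "(x, 0) \<in> C.span ?Bs"
      show "(r *\<^sub>R x, 0) \<in> C.span ?Bs" for r
        using C.span_scale[OF x, of "of_real r"] by (simp add: complexified_scale_def)
      show "(x + y, 0) \<in> C.span ?Bs" if "(y, 0) \<in> C.span ?Bs" for y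
        using C.span_add[OF x that] by simp
    qed
    moreover have "B \<subseteq> {u. (u, 0) \<in> C.span ?Bs}" by (auto intro: C.span_base)
    ultimately show ?thesis using span_minimal B(3) that by blast
  qed
  moreover have "(u, v) \<in> C.span ?Bs" if "u \<in> S" "v \<in> S" for u v
    using C.span_add[OF fst[OF that(1)] C.span_scale[OF fst[OF that(2)], of \<i>]]
    by (simp add: complexified_scale_def)
  ultimately have "C.span ?Bs = S \<times> S" by auto
  then show ?thesis using \<open>finite B\<close> by blast
qed

section \<open>Compact algebras: the Killing form and the centroid\<close>

text \<open>The defining trace refers to an arbitrary basis; an orthonormal one makes the Killing form
  a sum of squares.\<close>
lemma trace_on_orthonormal:
  fixes L :: "'a::euclidean_space set" and f :: "'a \<Rightarrow> 'a"
  assumes lie: "lie_algebra scaleR L br" and f: "linear f" "\<And>x. x \<in> L \<Longrightarrow> f x \<in> L"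
    and B: "pairwise orthogonal B" "\<And>b. b \<in> B \<Longrightarrow> norm b = 1" "finite B" "span B = L"
  shows "lie_algebra.trace_on scaleR L f = (\<Sum>b\<in>B. inner (f b) b)"
proof -
  interpret lie_algebra scaleR L br by fact
  define Bs where "Bs = (SOME Bs. independent Bs \<and> span Bs = L)"
  have "independent Bs \<and> span Bs = L"
    unfolding Bs_def
  proof (rule someI_ex)
    obtain C where "C \<subseteq> L" "independent C" "L \<subseteq> span C" using basis_exists[of L] by metis
    moreover have "subspace L" using subspace_carrier by (simp add: subspace_raw_def)
    ultimately show "\<exists>Bs. independent Bs \<and> span Bs = L"
      using span_minimal by (metis subset_antisym)
  qed
  then have Bs: "independent Bs" "span Bs = L" by auto
  have fin: "finite Bs" using Bs(1) by (rule independent_imp_finite)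
  let ?r = "representation Bs"
  have in_L: "b \<in> L" if "b \<in> B" for b using that B(4) span_base by blast
  have bs_L: "b \<in> L" if "b \<in> Bs" for b using that Bs(2) span_base by blast
  have "?r (f b) b = (\<Sum>i\<in>B. inner (f b) i * ?r i b)" if "b \<in> Bs" for b
  proof -
    have "f b = (\<Sum>i\<in>B. inner (f b) i *\<^sub>R i)"
      using orthonormal_basis_expand[OF B(1,2) _ B(3), of "f b"] f(2)[OF bs_L[OF that]] B(4) by simp
    then have "?r (f b) b = ?r (\<Sum>i\<in>B. inner (f b) i *\<^sub>R i) b" by simp
    also have "\<dots> = (\<Sum>i\<in>B. ?r (inner (f b) i *\<^sub>R i) b)"
      using Bs in_L by (subst real_vector.representation_sum[folded representation_raw_def dependent_raw_def span_raw_def])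
        (auto intro: span_scale)
    also have "\<dots> = (\<Sum>i\<in>B. inner (f b) i * ?r i b)"
      using Bs in_L by (intro sum.cong refl)
        (subst real_vector.representation_scale[folded representation_raw_def dependent_raw_def span_raw_def], auto)
    finally show ?thesis .
  qed
  then have "(\<Sum>b\<in>Bs. ?r (f b) b) = (\<Sum>b\<in>Bs. \<Sum>i\<in>B. inner (f b) i * ?r i b)"
    by simp
  also have "\<dots> = (\<Sum>i\<in>B. \<Sum>b\<in>Bs. inner (f b) i * ?r i b)"
    by (rule sum.swap)
  also have "\<dots> = (\<Sum>i\<in>B. inner (f (\<Sum>b\<in>Bs. ?r i b *\<^sub>R b)) i)"
    by (simp add: linear_sum[OF f(1)] linear_scale[OF f(1)] inner_sum_left mult.commute)
  also have "\<dots> = (\<Sum>i\<in>B. inner (f i) i)"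
    using Bs in_L fin
    by (intro sum.cong refl)
      (subst real_vector.sum_representation_eq[folded representation_raw_def dependent_raw_def span_raw_def], auto)
  finally show ?thesis
    unfolding trace_on_def Let_def Bs_def
    by (simp add: representation_raw_def dependent_raw_def span_raw_def)
qed

text \<open>In an orthonormal basis the trace of \<open>ad x\<close> squared is \<open>- \<Sum>\<bar>[x, b]\<bar>\<^sup>2\<close>, as \<open>ad x\<close> is
  skew.\<close>
lemma killing_negative:
  fixes L :: "'a::euclidean_space set"
  assumes lie: "lie_algebra scaleR L br" and bil: "bilinear br"
    and skew: "\<And>x y z. inner (br x y) z = - inner y (br x z)"
    and x: "x \<in> L" "y \<in> L" "br x y \<noteq> 0"
  shows "lie_algebra.killing scaleR L br x x < 0"
proof -
  interpret lie_algebra scaleR L br by fact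
  have "subspace L" using subspace_carrier by (simp add: subspace_raw_def)
  then obtain B where B: "B \<subseteq> L" "pairwise orthogonal B" "\<And>b. b \<in> B \<Longrightarrow> norm b = 1"
      "independent B" "card B = dim L" "span B = L"
    using orthonormal_basis_subspace by metis
  have fin: "finite B" using B(4) by (rule independent_imp_finite)
  have lin: "linear (br x)" for x using bil by (simp add: bilinear_def)
  have "killing x x = (\<Sum>b\<in>B. inner (br x (br x b)) b)"
    unfolding killing_def
    using B fin x(1) linear_compose[OF lin lin, of x x]
    by (intro trace_on_orthonormal[OF lie]) (auto simp: o_def br_closed)
  also have "\<dots> = - (\<Sum>b\<in>B. (norm (br x b))\<^sup>2)"
    by (simp add: skew sum_negf power2_norm_eq_inner)
  finally have eq: "killing x x = - (\<Sum>b\<in>B. (norm (br x b))\<^sup>2)" .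
  have "\<exists>b\<in>B. br x b \<noteq> 0"
  proof (rule ccontr)
    assume *: "\<not> ?thesis"
    have "br x y = 0"
      by (rule linear_eq_0_on_span[OF lin, of B]) (use * x(2) B(6) in auto)
    with x(3) show False by simp
  qed
  then obtain b where "b \<in> B" "br x b \<noteq> 0" by blast
  then have "(\<Sum>b\<in>B. (norm (br x b))\<^sup>2) > 0"
    using fin by (intro sum_pos2[of _ b]) auto
  then show ?thesis using eq by simp
qed

text \<open>With respect to the invariant inner product on the complexification, the adjoint of \<open>ad p\<close>
  is minus \<open>ad\<close> of the conjugate of \<open>p\<close>. The orthogonal projection \<open>P\<close> onto an ideal is
  therefore complex linear and commutes with the adjoint action. Its real and imaginary parts
  restrict to maps of the real form that commute with the adjoint action, hence are real
  scalars; so \<open>P\<close> is a complex scalar, and being idempotent it is \<open>0\<close> or \<open>1\<close>.\<close>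
lemma complex_simple_if_central:
  fixes L :: "'a::euclidean_space set"
  assumes lie: "lie_algebra scaleR UNIV br" and bil: "bilinear br"
    and skew: "\<And>x y z. inner (br x y) z = - inner y (br x z)"
    and L: "subspace L" "\<And>x y. x \<in> L \<Longrightarrow> y \<in> L \<Longrightarrow> br x y \<in> L"
    and nonabelian: "x0 \<in> L" "y0 \<in> L" "br x0 y0 \<noteq> 0"
    and central: "\<And>A. (\<And>x. x \<in> L \<Longrightarrow> A x \<in> L) \<Longrightarrow> (\<And>x y. x \<in> L \<Longrightarrow> y \<in> L \<Longrightarrow> A (x + y) = A x + A y) \<Longrightarrow>
      (\<And>x y. x \<in> L \<Longrightarrow> y \<in> L \<Longrightarrow> A (br x y) = br x (A y)) \<Longrightarrow> \<exists>c. \<forall>x\<in>L. A x = c *\<^sub>R x"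
  shows "lie_algebra.lie_simple complexified_scale (L \<times> L) (complexified_bracket br)"
proof -
  let ?sc = "complexified_scale :: complex \<Rightarrow> 'a \<times> 'a \<Rightarrow> 'a \<times> 'a" and ?br = "complexified_bracket br"
  note br_ops = bilinear_ladd[OF bil] bilinear_radd[OF bil] bilinear_lsub[OF bil] bilinear_rsub[OF bil]
    bilinear_lzero[OF bil] bilinear_rzero[OF bil] bilinear_rneg[OF bil] bilinear_lneg[OF bil]
  note L_ops = subspace_add[OF L(1)] subspace_diff[OF L(1)] subspace_neg[OF L(1)] subspace_scale[OF L(1)]
    subspace_0[OF L(1)] L(2)
  have closed: "?br p q \<in> L \<times> L" if "p \<in> L \<times> L" "q \<in> L \<times> L" for p q
    using that by (auto simp: complexified_bracket_def intro!: L_ops)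
  interpret lie_algebra ?sc "L \<times> L" ?br
    by (rule lie_algebra_restrict[OF lie_algebra_complexified[OF lie] subspace_complexified[OF L(1)] closed])
  \<comment> \<open>\<open>(u, v)\<close> stands for \<open>u + \<i> v\<close>, so \<open>(u, - v)\<close> is its conjugate\<close>
  have adjoint: "inner (?br p q) r = - inner q (?br (fst p, - snd p) r)" for p q r
    by (simp add: complexified_bracket_def inner_prod_def br_ops inner_add_left inner_diff_left
        inner_add_right inner_diff_right skew)
  have mult_i: "inner (?sc \<i> p) q = - inner p (?sc \<i> q)" for p q
    by (simp add: complexified_scale_def inner_prod_def)
  have "I = {0} \<or> I = L \<times> L" if I: "lie_ideal I" for I
  proof -
    have sub: "subspace I" "I \<subseteq> L \<times> L" "\<And>p q. p \<in> L \<times> L \<Longrightarrow> q \<in> I \<Longrightarrow> ?br p q \<in> I"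
      using I by (auto simp: lie_ideal_def)
    have real_scale: "?sc (of_real r) p = r *\<^sub>R p" for r p
      by (simp add: complexified_scale_def prod_eq_iff)
    have sc_I: "?sc c p \<in> I" if "p \<in> I" for c p using subspace_scale[OF sub(1) that] .
    have real_sub: "Real_Vector_Spaces.subspace I"
      unfolding Real_Vector_Spaces.subspace_def
      using subspace_0[OF sub(1)] subspace_add[OF sub(1)] sc_I real_scale by metis
    have "\<exists>y. y \<in> I \<and> (\<forall>i\<in>I. inner (p - y) i = 0)" for p
    proof -
      obtain y z where "y \<in> Real_Vector_Spaces.span I" "\<And>w. w \<in> Real_Vector_Spaces.span I \<Longrightarrow> orthogonal z w" "p = y + z"
        using orthogonal_subspace_decomp_exists[of I p] by metis
      moreover have "Real_Vector_Spaces.span I = I" using real_sub by (simp add: span_eq_iff)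
      ultimately show ?thesis by (intro exI[of _ y]) (simp add: orthogonal_def)
    qed
    then obtain P where P: "\<And>p. P p \<in> I" "\<And>p i. i \<in> I \<Longrightarrow> inner (p - P p) i = 0" by metis
    have P_unique: "P p = y" if "y \<in> I" "\<And>i. i \<in> I \<Longrightarrow> inner (p - y) i = 0" for p y
    proof -
      have "y - P p \<in> I" using that(1) P(1) subspace_diff[OF sub(1)] by blast
      then have "inner (p - P p) (y - P p) - inner (p - y) (y - P p) = 0"
        using P(2) that(2) by simp
      then have "inner (y - P p) (y - P p) = 0" by (simp add: inner_diff_left)
      then show ?thesis by simp
    qed
    have P_add: "P (p + q) = P p + P q" for p q
    proof (rule P_unique)
      show "P p + P q \<in> I" by (rule subspace_add[OF sub(1) P(1) P(1)])
      fix i assume "i \<in> I"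
      have "p + q - (P p + P q) = (p - P p) + (q - P q)" by simp
      then show "inner (p + q - (P p + P q)) i = 0"
        using P(2)[OF \<open>i \<in> I\<close>] by (simp only: inner_add_left add_0_left)
    qed
    have P_br: "P (?br q p) = ?br q (P p)" if "q \<in> L \<times> L" for p q
    proof (rule P_unique)
      show "?br q (P p) \<in> I" using sub(3) that P(1) by blast
      fix i assume "i \<in> I"
      have "(fst q, - snd q) \<in> L \<times> L" using that L_ops by auto
      then have "?br (fst q, - snd q) i \<in> I" using sub(3) \<open>i \<in> I\<close> by blast
      then have "inner (p - P p) (?br (fst q, - snd q) i) = 0" by (rule P(2))
      moreover have "?br q p - ?br q (P p) = ?br q (p - P p)"
        by (simp add: complexified_bracket_def br_ops)
      ultimately show "inner (?br q p - ?br q (P p)) i = 0" by (simp only: adjoint)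
    qed
    have P_i: "P (?sc \<i> p) = ?sc \<i> (P p)" for p
    proof (rule P_unique)
      show "?sc \<i> (P p) \<in> I" using sc_I P(1) by blast
      fix i assume "i \<in> I"
      have "inner (?sc \<i> (p - P p)) i = 0"
        unfolding mult_i using P(2) sc_I[OF \<open>i \<in> I\<close>] by simp
      then show "inner (?sc \<i> p - ?sc \<i> (P p)) i = 0" by (simp add: scale_right_diff_distrib)
    qed
    have P_L: "P p \<in> L \<times> L" for p using P(1) sub(2) by blast
    have fst_L: "fst (P p) \<in> L" "snd (P p) \<in> L" for p using P_L[of p] by (simp_all add: mem_Times_iff)
    have P0: "P (x + y, 0) = P (x, 0) + P (y, 0)" for x y
      using P_add[of "(x, 0)" "(y, 0)"] by simp
    have Pbr0: "P (br x y, 0) = ?br (x, 0) (P (y, 0))" if "x \<in> L" for x y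
      using P_br[of "(x, 0)" "(y, 0)"] that L_ops(5) by (simp add: complexified_bracket_def br_ops)
    obtain \<alpha> where \<alpha>: "\<And>x. x \<in> L \<Longrightarrow> fst (P (x, 0)) = \<alpha> *\<^sub>R x"
      using central[of "\<lambda>x. fst (P (x, 0))"] by (auto simp: fst_L P0 Pbr0 complexified_bracket_def br_ops)
    obtain \<beta> where \<beta>: "\<And>x. x \<in> L \<Longrightarrow> snd (P (x, 0)) = \<beta> *\<^sub>R x"
      using central[of "\<lambda>x. snd (P (x, 0))"] by (auto simp: fst_L P0 Pbr0 complexified_bracket_def br_ops)
    define c where "c = Complex \<alpha> \<beta>"
    have P_real: "P (x, 0) = ?sc c (x, 0)" if "x \<in> L" for x
      using \<alpha>[OF that] \<beta>[OF that] by (simp add: c_def complexified_scale_def prod_eq_iff)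
    have P_c: "P p = ?sc c p" if "p \<in> L \<times> L" for p
    proof -
      have p: "p = (fst p, 0) + ?sc \<i> (snd p, 0)" by (simp add: complexified_scale_def prod_eq_iff)
      have "P p = P (fst p, 0) + ?sc \<i> (P (snd p, 0))"
        by (subst p) (simp only: P_add P_i)
      also have "\<dots> = ?sc c ((fst p, 0) + ?sc \<i> (snd p, 0))"
        using that by (simp add: P_real mem_Times_iff scale_right_distrib mult.commute)
      finally show ?thesis using p by simp
    qed
    have x0: "(x0, 0) \<in> L \<times> L" "(x0, 0) \<noteq> 0"
      using nonabelian L_ops(5) by (auto simp: zero_prod_def br_ops)
    have "P (P (x0, 0)) = P (x0, 0)"
      by (rule P_unique) (simp_all add: P(1))
    moreover have "?sc (c * c) (x0, 0) = ?sc c (P (x0, 0))"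
      unfolding P_c[OF x0(1)] by simp
    ultimately have "?sc (c * c) (x0, 0) = ?sc c (x0, 0)"
      by (simp only: P_c[OF P_L, symmetric]) (simp only: P_c[OF x0(1)])
    then have "c * c = c" using x0(2) by auto
    then consider "c = 0" | "c = 1" by auto
    then show ?thesis
    proof cases
      case 1
      have "i = 0" if "i \<in> I" for i
      proof -
        have "P i = i" using that by (intro P_unique) simp_all
        then show ?thesis using P_c[of i] sub(2) that 1 by auto
      qed
      then show ?thesis using subspace_0[OF sub(1)] by auto
    next
      case 2
      have "p \<in> I" if "p \<in> L \<times> L" for p using P(1)[of p] P_c[OF that] 2 by simp
      then show ?thesis using sub(2) by blast
    qed
  qed
  moreover have "\<exists>p\<in>L \<times> L. \<exists>q\<in>L \<times> L. ?br p q \<noteq> 0"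
    using nonabelian L_ops(5)
    by (intro bexI[of _ "(x0, 0)"] bexI[of _ "(y0, 0)"]) (auto simp: complexified_bracket_def br_ops zero_prod_def)
  ultimately show ?thesis unfolding lie_simple_def by blast
qed

lemma real_simple_if_complex_simple:
  fixes L :: "'a::real_vector set"
  assumes lie: "lie_algebra scaleR UNIV br" and L: "subspace L" "\<And>x y. x \<in> L \<Longrightarrow> y \<in> L \<Longrightarrow> br x y \<in> L"
    and simple: "lie_algebra.lie_simple complexified_scale (L \<times> L) (complexified_bracket br)"
  shows "lie_algebra.lie_simple scaleR L br"
proof -
  let ?br = "complexified_bracket br"
  interpret R: lie_algebra scaleR L br
    by (rule lie_algebra_restrict[OF lie]) (use L in \<open>auto simp: subspace_raw_def\<close>)
  have closed: "?br p q \<in> L \<times> L" if "p \<in> L \<times> L" "q \<in> L \<times> L" for p q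
    using that by (auto simp: complexified_bracket_def intro!: subspace_add[OF L(1)] subspace_diff[OF L(1)] L(2))
  interpret C: lie_algebra complexified_scale "L \<times> L" ?br
    by (rule lie_algebra_restrict[OF lie_algebra_complexified[OF lie] subspace_complexified[OF L(1)] closed])
  have "\<exists>x\<in>L. \<exists>y\<in>L. br x y \<noteq> 0"
  proof (rule ccontr)
    assume "\<not> ?thesis"
    then have "?br p q = 0" if "p \<in> L \<times> L" "q \<in> L \<times> L" for p q
      using that by (auto simp: complexified_bracket_def zero_prod_def)
    then show False using simple unfolding C.lie_simple_def by blast
  qed
  moreover have "I = {0} \<or> I = L" if I: "R.lie_ideal I" for I
  proof -
    have sub: "subspace I" "I \<subseteq> L" "\<And>x y. x \<in> L \<Longrightarrow> y \<in> I \<Longrightarrow> br x y \<in> I"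
      using I by (auto simp: R.lie_ideal_def subspace_raw_def)
    have "C.lie_ideal (I \<times> I)"
      unfolding C.lie_ideal_def
      using sub subspace_complexified[OF sub(1)]
      by (auto simp: complexified_bracket_def intro!: subspace_add[OF sub(1)] subspace_diff[OF sub(1)])
    then have "I \<times> I = {0} \<or> I \<times> I = L \<times> L"
      using simple unfolding C.lie_simple_def by blast
    then show ?thesis
    proof
      assume *: "I \<times> I = {0}"
      have "x = 0" if "x \<in> I" for x
      proof -
        have "(x, x) \<in> I \<times> I" using that by simp
        then show ?thesis unfolding * by (simp add: zero_prod_def)
      qed
      then show ?thesis using subspace_0[OF sub(1)] by auto
    next
      assume "I \<times> I = L \<times> L"
      then show ?thesis using subspace_0[OF sub(1)] subspace_0[OF L(1)] by (auto simp: times_eq_iff)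
    qed
  qed
  ultimately show ?thesis unfolding R.lie_simple_def by blast
qed

section \<open>Root planes\<close>

definition units :: "complex set" where "units = {1, \<omega>, \<omega>'}"

lemma units_norm:
  assumes "\<zeta> \<in> units"
  shows "\<zeta> * cnj \<zeta> = 1"
  using assms unfolding units_def
  by (elim insertE emptyE; hypsubst; simp add: eisenstein algebra_simps)

text \<open>The point \<open>0\<close> has position \<open>0, 1, 3, 9\<close> on the lines \<open>0, 12, 10, 4\<close> respectively. On the
  line where it has position \<open>0\<close>, the matrix of \<open>ad\<close> of a vector of \<open>V\<^sub>0\<close> on the other three
  summands is circulant, with eigenvectors \<open>(1, \<zeta>, \<zeta>\<^sup>-\<^sup>1)\<close> for the cube roots of unity \<open>\<zeta>\<close>. On
  the other lines the same holds up to signs after conjugating one coordinate. The eigenvalues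
  are imaginary and depend real-linearly on the vector of \<open>V\<^sub>0\<close>, so each \<open>root_plane p l \<zeta>\<close> is a
  real plane on which \<open>V\<^sub>0 \<inter> W\<close> acts by rotations.\<close>
definition root_plane :: "13 \<Rightarrow> bool \<Rightarrow> complex \<Rightarrow> complex \<Rightarrow> V" where
  "root_plane p l \<zeta> w =
    (if p = 0 then Y 0 1 l w + Y 0 3 l (\<zeta> * w) + Y 0 9 l (cnj \<zeta> * w)
     else if p = 1 then Y 12 0 l w - Y 12 3 l (\<zeta> * w) - Y 12 9 l (\<zeta> * cnj w)
     else if p = 3 then Y 10 0 l w - Y 10 9 l (\<zeta> * w) - Y 10 1 l (\<zeta> * cnj w)
     else Y 4 0 l w - Y 4 1 l (\<zeta> * w) - Y 4 3 l (\<zeta> * cnj w))"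

lemma linear_root_plane: "linear (root_plane p l \<zeta>)"
  unfolding root_plane_def
  by (rule linearI) (simp_all add: linear_add[OF linear_Y] algebra_simps linear_scale[OF linear_Y])

lemmas root_plane_ops = linear_add[OF linear_root_plane] linear_diff[OF linear_root_plane]
  linear_neg[OF linear_root_plane] linear_scale[OF linear_root_plane] linear_0[OF linear_root_plane]

lemma root_plane_in_W:
  assumes "p \<in> positions"
  shows "root_plane p l \<zeta> w \<in> W"
proof -
  have "Y k t l z \<in> W" if "t \<in> {0, 1, 3, 9}" for k t z
    using Y_in_W that unfolding positions_def by blast
  then show ?thesis
    using assms unfolding positions_def root_plane_def
    by (auto intro!: subspace_add[OF subspace_W] subspace_diff[OF subspace_W])
qed

text \<open>The parametrisation of the long and short parts of \<open>V\<^sub>0 \<inter> W\<close> by the frame of the line on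
  which \<open>0\<close> has position \<open>p\<close>.\<close>
definition toral :: "13 \<Rightarrow> bool \<Rightarrow> complex \<Rightarrow> V" where
  "toral p l h = (if p = 0 then Y 0 0 l h else if p = 1 then Y 12 1 l h else if p = 3 then Y 10 3 l h
     else Y 4 9 l h)"

lemma linear_toral: "linear (toral p l)"
  unfolding toral_def by (intro linear_if linear_Y)

lemma W_component_expand':
  assumes "t \<in> positions" "s = k + t"
  shows "at_index s x y y = Y k t True (coord t True x y) + Y k t False (coord t False x y)"
  using W_component_expand[OF assms(1)] assms(2) by simp

lemma toral_expand:
  assumes "p \<in> positions"
  shows "at_index 0 x y y = toral p True (coord p True x y) + toral p False (coord p False x y)"
  using assms W_component_expand'[of 0 0 0 x y] W_component_expand'[of 1 0 12 x y]
    W_component_expand'[of 3 0 10 x y] W_component_expand'[of 9 0 4 x y]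
  unfolding positions_def toral_def by (elim insertE emptyE) simp_all

lemma W_component_iff: "v \<in> W_component s \<longleftrightarrow> v \<in> W \<and> (\<forall>t. t \<noteq> s \<longrightarrow> v $ t = 0)"
proof
  assume "v \<in> W_component s"
  then show "v \<in> W \<and> (\<forall>t. t \<noteq> s \<longrightarrow> v $ t = 0)"
    by (auto simp: W_component_def at_index_in_W axis_nth_13)
next
  assume v: "v \<in> W \<and> (\<forall>t. t \<noteq> s \<longrightarrow> v $ t = 0)"
  then have "v = axis s (v $ s)" by (auto simp: V_eq_iff axis_nth_13)
  also have "v $ s = vector [v $ s $ 1, v $ s $ 2, v $ s $ 2]"
    using v vector3_expand[of "v $ s"] by (simp add: W_iff)
  finally show "v \<in> W_component s" unfolding W_component_def by blast
qed

lemma toral_in_W_component: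
  assumes "p \<in> positions"
  shows "toral p l h \<in> W_component 0"
proof -
  have "toral p l h \<in> W"
    using assms Y_in_W unfolding positions_def toral_def by auto
  moreover have "toral p l h $ t = 0" if "t \<noteq> 0" for t
    using assms that unfolding positions_def toral_def Y_def X_def
    by (elim insertE emptyE; cases l) (auto simp: axis_nth_13)
  ultimately show ?thesis by (simp add: W_component_iff)
qed

text \<open>The angular velocity with which a vector of \<open>V\<^sub>0 \<inter> W\<close> rotates a root plane.\<close>
definition root_form :: "13 \<Rightarrow> bool \<Rightarrow> complex \<Rightarrow> V \<Rightarrow> real" where
  "root_form p l \<zeta> v = 6 * Im (coord p l (v $ 0 $ 1) (v $ 0 $ 2) * cnj \<zeta>)"

lemma linear_root_form: "linear (root_form p l \<zeta>)"
  unfolding root_form_def coord_def Let_def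
  by (rule linearI) (simp_all add: algebra_simps)

lemma coord_toral:
  assumes "p \<in> positions"
  shows "coord p l (toral p l' h $ 0 $ 1) (toral p l' h $ 0 $ 2) = (if l = l' then h else 0)"
  using assms unfolding positions_def toral_def coord_def Let_def Y_def
  by (elim insertE emptyE; cases l; cases l')
    (simp_all add: X_explicit axis_nth_13 vector_3 frame_simps scaled_matrix_nth eisenstein field_simps)

lemma root_form_toral:
  assumes "p \<in> positions"
  shows "root_form p l \<zeta> (toral p l h) = 6 * Im (h * cnj \<zeta>)"
  using coord_toral[OF assms, of l l h] by (simp add: root_form_def)

context e6_product
begin

lemma br_toral_root_plane:
  assumes "p \<in> positions" "\<zeta> \<in> units"
  shows "br (toral p l h) (root_plane p l' \<zeta> w)
    = (if l = l' then root_plane p l \<zeta> (3 * (h * cnj \<zeta> - cnj h * \<zeta>) * w) else 0)"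
  using assms unfolding positions_def units_def
  by (elim insertE emptyE; hypsubst)
    (auto simp: toral_def root_plane_def br_Y br_simps Y_ops eisenstein algebra_simps)

lemma br_root_plane:
  assumes "a \<in> W_component 0" "p \<in> positions" "\<zeta> \<in> units"
  shows "br a (root_plane p l \<zeta> w) = root_plane p l \<zeta> (\<i> * of_real (root_form p l \<zeta> a) * w)"
proof -
  obtain x y where a: "a = at_index 0 x y y" using assms(1) by (auto simp: W_component_def)
  have "br a (root_plane p l \<zeta> w) = root_plane p l \<zeta> (3 * (coord p l x y * cnj \<zeta> - cnj (coord p l x y) * \<zeta>) * w)"
    unfolding a toral_expand[OF assms(2)] by (cases l) (simp_all add: br_simps br_toral_root_plane[OF assms(2,3)])
  also have "3 * (z * cnj \<zeta> - cnj z * \<zeta>) = \<i> * of_real (6 * Im (z * cnj \<zeta>))" for z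
    by (simp add: complex_eq_iff)
  finally show ?thesis by (simp add: root_form_def a axis_nth_13 vector_3)
qed

text \<open>Collecting the products on a line first keeps the verification for root planes small.\<close>
lemma br_line:
  "br (Y k 0 l z0 + Y k 1 l z1 + Y k 3 l z3 + Y k 9 l z9) (Y k 0 l w0 + Y k 1 l w1 + Y k 3 l w3 + Y k 9 l w9)
    = Y k 0 l (3 * (cnj z1 * w3 - z3 * cnj w1 + cnj z3 * w9 - z9 * cnj w3 + cnj z9 * w1 - z1 * cnj w9))
    + Y k 1 l (3 * (z0 * w9 - z9 * w0 + z3 * cnj w0 - cnj z0 * w3 + cnj z3 * cnj w9 - cnj z9 * cnj w3))
    + Y k 3 l (3 * (z0 * w1 - z1 * w0 + z9 * cnj w0 - cnj z0 * w9 + cnj z9 * cnj w1 - cnj z1 * cnj w9))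
    + Y k 9 l (3 * (z0 * w3 - z3 * w0 + z1 * cnj w0 - cnj z0 * w1 + cnj z1 * cnj w3 - cnj z3 * cnj w1))"
  by (simp add: br_Y br_simps Y_ops algebra_simps)

lemma br_root_plane_root_plane:
  assumes "p \<in> positions" "\<zeta> \<in> units"
  shows "br (root_plane p l \<zeta> z) (root_plane p l \<zeta> w) = toral p l (9 * \<zeta> * (cnj z * w - z * cnj w))"
proof -
  have root_plane_line:
    "root_plane 0 l \<zeta> w = Y 0 0 l 0 + Y 0 1 l w + Y 0 3 l (\<zeta> * w) + Y 0 9 l (cnj \<zeta> * w)"
    "root_plane 1 l \<zeta> w = Y 12 0 l w + Y 12 1 l 0 + Y 12 3 l (- (\<zeta> * w)) + Y 12 9 l (- (\<zeta> * cnj w))"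
    "root_plane 3 l \<zeta> w = Y 10 0 l w + Y 10 1 l (- (\<zeta> * cnj w)) + Y 10 3 l 0 + Y 10 9 l (- (\<zeta> * w))"
    "root_plane 9 l \<zeta> w = Y 4 0 l w + Y 4 1 l (- (\<zeta> * w)) + Y 4 3 l (- (\<zeta> * cnj w)) + Y 4 9 l 0" for \<zeta> w
    by (simp_all add: root_plane_def linear_0[OF linear_Y] linear_neg[OF linear_Y])
  show ?thesis
    using assms unfolding positions_def units_def
    by (elim insertE emptyE; hypsubst; simp only: root_plane_line br_line toral_def)
      (simp_all add: eisenstein algebra_simps linear_0[OF linear_Y])
qed

lemma br_W_component_0:
  assumes "a \<in> W_component 0" "b \<in> W_component 0"
  shows "br a b = 0"
  using assms by (auto simp: W_component_def br_same)

end

lemma Y_triple: "Y k t l (w * 3) = 3 * Y k t l w"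
proof -
  have "Y k t l (w * 3) = Y k t l (w + w + w)" by (simp add: mult.commute)
  then show ?thesis by (simp only: Y_ops) simp
qed

text \<open>Discrete Fourier transform on the cube roots of unity.\<close>
lemma Y_in_planes:
  "Y 0 1 l (w + w + w) = root_plane 0 l 1 w + root_plane 0 l \<omega> w + root_plane 0 l \<omega>' w"
  "Y 0 3 l (w + w + w) = root_plane 0 l 1 w + root_plane 0 l \<omega> (\<omega>' * w) + root_plane 0 l \<omega>' (\<omega> * w)"
  "Y 0 9 l (w + w + w) = root_plane 0 l 1 w + root_plane 0 l \<omega> (\<omega> * w) + root_plane 0 l \<omega>' (\<omega>' * w)"
  "Y 12 0 l (w + w + w) = root_plane 1 l 1 w + root_plane 1 l \<omega> w + root_plane 1 l \<omega>' w"
  "Y 12 3 l (w + w + w) = - root_plane 1 l 1 w - root_plane 1 l \<omega> (\<omega>' * w) - root_plane 1 l \<omega>' (\<omega> * w)"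
  "Y 12 9 l (cnj w + cnj w + cnj w) = - root_plane 1 l 1 w - root_plane 1 l \<omega> (\<omega> * w) - root_plane 1 l \<omega>' (\<omega>' * w)"
  "Y 10 0 l (w + w + w) = root_plane 3 l 1 w + root_plane 3 l \<omega> w + root_plane 3 l \<omega>' w"
  "Y 10 9 l (w + w + w) = - root_plane 3 l 1 w - root_plane 3 l \<omega> (\<omega>' * w) - root_plane 3 l \<omega>' (\<omega> * w)"
  "Y 10 1 l (cnj w + cnj w + cnj w) = - root_plane 3 l 1 w - root_plane 3 l \<omega> (\<omega> * w) - root_plane 3 l \<omega>' (\<omega>' * w)"
  "Y 4 0 l (w + w + w) = root_plane 9 l 1 w + root_plane 9 l \<omega> w + root_plane 9 l \<omega>' w"
  "Y 4 1 l (w + w + w) = - root_plane 9 l 1 w - root_plane 9 l \<omega> (\<omega>' * w) - root_plane 9 l \<omega>' (\<omega> * w)"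
  "Y 4 3 l (cnj w + cnj w + cnj w) = - root_plane 9 l 1 w - root_plane 9 l \<omega> (\<omega> * w) - root_plane 9 l \<omega>' (\<omega>' * w)"
  by (simp_all add: root_plane_def eisenstein Y_ops Y_triple algebra_simps)

text \<open>Every point other than \<open>0\<close> lies on a line through \<open>0\<close>, and the root planes of that line
  span its remaining summands.\<close>
lemma W_spanned:
  assumes u: "u \<in> W" and S: "subspace S" "W_component 0 \<subseteq> S"
    and planes: "\<And>p l \<zeta> w. p \<in> positions \<Longrightarrow> \<zeta> \<in> units \<Longrightarrow> root_plane p l \<zeta> w \<in> S"
  shows "u \<in> S"
proof -
  note S_ops = subspace_add[OF S(1)] subspace_diff[OF S(1)] subspace_neg[OF S(1)]
  have pl: "root_plane 0 l \<zeta> w \<in> S" "root_plane 1 l \<zeta> w \<in> S" "root_plane 3 l \<zeta> w \<in> S" "root_plane 9 l \<zeta> w \<in> S"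
    if "\<zeta> = 1 \<or> \<zeta> = \<omega> \<or> \<zeta> = \<omega>'" for l \<zeta> w
    using planes that unfolding positions_def units_def by auto
  have third: "w = w / 3 + w / 3 + w / 3" "w = cnj (cnj w / 3) + cnj (cnj w / 3) + cnj (cnj w / 3)"
    for w :: complex by simp_all
  have Y: "Y 0 1 l w \<in> S" "Y 0 3 l w \<in> S" "Y 0 9 l w \<in> S" "Y 12 0 l w \<in> S" "Y 12 3 l w \<in> S"
    "Y 10 0 l w \<in> S" "Y 10 9 l w \<in> S" "Y 4 0 l w \<in> S" "Y 4 1 l w \<in> S" for l w
    by ((subst third(1)[of w], simp only: Y_in_planes, intro S_ops pl; simp)+)
  have Y': "Y 12 9 l w \<in> S" "Y 10 1 l w \<in> S" "Y 4 3 l w \<in> S" for l w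
    by ((subst third(2)[of w], simp only: Y_in_planes, intro S_ops pl; simp)+)
  have comp: "at_index t x y y \<in> S" for t x y
    using exhaust_13[of t] S(2) S_ops(1) Y Y'
      W_component_expand'[of 1 1 0 x y] W_component_expand'[of 3 3 0 x y] W_component_expand'[of 9 9 0 x y]
      W_component_expand'[of 0 12 12 x y] W_component_expand'[of 3 2 12 x y] W_component_expand'[of 9 8 12 x y]
      W_component_expand'[of 0 10 10 x y] W_component_expand'[of 9 6 10 x y] W_component_expand'[of 1 11 10 x y]
      W_component_expand'[of 0 4 4 x y] W_component_expand'[of 1 5 4 x y] W_component_expand'[of 3 7 4 x y]
    unfolding positions_def by (elim insertE emptyE) (auto simp: W_component_def)
  have "axis t (u $ t) = at_index t (u $ t $ 1) (u $ t $ 2) (u $ t $ 2)" for t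
    using u vector3_expand[of "u $ t"] by (simp add: W_iff)
  then have "(\<Sum>t\<in>UNIV. axis t (u $ t)) \<in> S"
    by (intro subspace_sum[OF S(1)]) (simp add: comp)
  then show ?thesis by (simp only: sum_axis)
qed

section \<open>Roots of the complexified algebra\<close>

lemma W_component_0_ops: "x \<in> W_component 0 \<Longrightarrow> y \<in> W_component 0 \<Longrightarrow> x + y \<in> W_component 0"
  "x \<in> W_component 0 \<Longrightarrow> y \<in> W_component 0 \<Longrightarrow> x - y \<in> W_component 0"
  "x \<in> W_component 0 \<Longrightarrow> r *\<^sub>R x \<in> W_component 0" "0 \<in> W_component 0"
  by (auto simp: W_component_iff subspace_add[OF subspace_W] subspace_diff[OF subspace_W]
      subspace_scale[OF subspace_W] subspace_0[OF subspace_W])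

lemma subspace_W_component: "subspace (W_component 0)"
  using W_component_0_ops by (auto simp: subspace_def)

definition cartan :: "(V \<times> V) set" where
  "cartan = W_component 0 \<times> W_component 0"

text \<open>The pair \<open>h\<close> stands for \<open>u + \<i> v\<close>, and the value is the complex-linear extension of \<open>- \<i> s
  \<lambda>\<close> at \<open>h\<close>, where \<open>\<lambda>\<close> is the root form.\<close>
definition root :: "13 \<Rightarrow> bool \<Rightarrow> complex \<Rightarrow> real \<Rightarrow> V \<times> V \<Rightarrow> complex" where
  "root p l \<zeta> s h = (if h \<in> cartan then Complex (s * root_form p l \<zeta> (snd h)) (- s * root_form p l \<zeta> (fst h)) else 0)"

text \<open>A rotation of a real plane has the complex eigenvectors \<open>x \<plusminus> \<i> x'\<close>, where \<open>x'\<close> is \<open>x\<close>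
  turned by a right angle. The outer imaginary unit is that of the complexification; the factor
  \<open>\<i>\<close> inside the root plane is the complex structure of the summands.\<close>
definition root_vector :: "13 \<Rightarrow> bool \<Rightarrow> complex \<Rightarrow> real \<Rightarrow> complex \<Rightarrow> V \<times> V" where
  "root_vector p l \<zeta> s w = (root_plane p l \<zeta> w, s *\<^sub>R root_plane p l \<zeta> (\<i> * w))"

definition all_roots :: "(V \<times> V \<Rightarrow> complex) set" where
  "all_roots = (\<lambda>(p, l, \<zeta>, s). root p l \<zeta> s) ` (positions \<times> UNIV \<times> units \<times> {1, -1})"

lemma all_rootsE:
  assumes "f \<in> all_roots"
  obtains p l \<zeta> s where "p \<in> positions" "\<zeta> \<in> units" "s = 1 \<or> s = -1" "f = root p l \<zeta> s"
  using assms unfolding all_roots_def by auto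

lemma root_in_all_roots:
  "p \<in> positions \<Longrightarrow> \<zeta> \<in> units \<Longrightarrow> s = 1 \<or> s = -1 \<Longrightarrow> root p l \<zeta> s \<in> all_roots"
  unfolding all_roots_def by (intro image_eqI[of _ _ "(p, l, \<zeta>, s)"]) auto

lemma root_form_toral_i:
  assumes "p \<in> positions" "\<zeta> \<in> units"
  shows "root_form p l \<zeta> (toral p l (of_real r * \<i> * \<zeta>)) = 6 * r"
proof -
  have "\<i> * \<zeta> * cnj \<zeta> = \<i>" using units_norm[OF assms(2)] by (simp add: mult.assoc)
  then have "of_real r * \<i> * \<zeta> * cnj \<zeta> = of_real r * \<i>" by (simp add: mult.assoc)
  then show ?thesis by (simp only: root_form_toral[OF assms(1)]) simp
qed

lemma cartan_subset: "cartan \<subseteq> W \<times> W"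
  by (auto simp: cartan_def W_component_iff)

context e6_product
begin

abbreviation "cbr \<equiv> complexified_bracket br"

lemma lie_algebra_complex_W: "lie_algebra complexified_scale (W \<times> W) cbr"
  by (rule lie_algebra_restrict[OF lie_algebra_complexified[OF lie_algebra_V]
        subspace_complexified[OF subspace_W]])
    (auto simp: complexified_bracket_def br_W_closed subspace_add[OF subspace_W]
      subspace_diff[OF subspace_W])

interpretation C: lie_algebra complexified_scale "W \<times> W" cbr
  by (rule lie_algebra_complex_W)

lemma root_vector_weight:
  assumes "p \<in> positions" "\<zeta> \<in> units" "s = 1 \<or> s = -1"
  shows "root_vector p l \<zeta> s w \<in> C.weight_space cartan (root p l \<zeta> s)"
proof -
  have "root_vector p l \<zeta> s w \<in> W \<times> W"
    using root_plane_in_W[OF assms(1)] by (simp add: root_vector_def subspace_scale[OF subspace_W])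
  moreover have "cbr h (root_vector p l \<zeta> s w)
      = complexified_scale (root p l \<zeta> s h) (root_vector p l \<zeta> s w)" if "h \<in> cartan" for h
  proof -
    have h: "fst h \<in> W_component 0" "snd h \<in> W_component 0" using that by (auto simp: cartan_def)
    have "\<i> * of_real r * w = r *\<^sub>R (\<i> * w)" "\<i> * of_real r * (\<i> * w) = - (r *\<^sub>R w)" for r w
      by (simp_all add: complex_eq_iff algebra_simps)
    then have scale: "root_plane p l \<zeta> (\<i> * of_real r * w) = r *\<^sub>R root_plane p l \<zeta> (\<i> * w)"
      "root_plane p l \<zeta> (\<i> * of_real r * (\<i> * w)) = - (r *\<^sub>R root_plane p l \<zeta> w)" for r w
      by (simp_all only: root_plane_ops)
    have act: "br a (root_plane p l \<zeta> w) = root_form p l \<zeta> a *\<^sub>R root_plane p l \<zeta> (\<i> * w)"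
      "br a (root_plane p l \<zeta> (\<i> * w)) = - (root_form p l \<zeta> a *\<^sub>R root_plane p l \<zeta> w)" if "a \<in> W_component 0" for a w
      by (simp_all only: br_root_plane[OF that assms(1,2)] scale(2)) (simp only: scale(1))
    show ?thesis
      using assms(3)
      by (auto simp: complexified_bracket_def complexified_scale_def root_vector_def root_def that br_simps
          act[OF h(1)] act[OF h(2)] root_plane_ops(3))
  qed
  ultimately show ?thesis by (simp add: C.weight_space_def)
qed

text \<open>A vector of a root plane is half the sum of its two root vectors, and the root planes
  together with the component at \<open>0\<close> span.\<close>
lemma W_decomposition:
  assumes "x \<in> W \<times> W"
  shows "\<exists>h\<in>cartan. \<exists>y. (\<forall>f\<in>all_roots. y f \<in> C.weight_space cartan f) \<and> x = h + sum y all_roots"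
proof -
  have fin: "finite all_roots" by (simp add: all_roots_def positions_def units_def)
  define S where "S = {x. \<exists>h\<in>cartan. \<exists>y. (\<forall>f\<in>all_roots. y f \<in> C.weight_space cartan f) \<and> x = h + sum y all_roots}"
  note wt = C.weight_space_add[OF cartan_subset] C.weight_space_scale[OF cartan_subset]
    C.weight_space_zero[OF cartan_subset]
  have sub_cartan: "C.subspace cartan"
    unfolding cartan_def by (rule subspace_complexified[OF subspace_W_component])
  have add: "a + b \<in> S" if prem: "a \<in> S" "b \<in> S" for a b
  proof -
    obtain h y h' y' where *: "h \<in> cartan" "\<forall>f\<in>all_roots. y f \<in> C.weight_space cartan f" "a = h + sum y all_roots"
      "h' \<in> cartan" "\<forall>f\<in>all_roots. y' f \<in> C.weight_space cartan f" "b = h' + sum y' all_roots"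
      using prem unfolding S_def by blast
    then show ?thesis
      unfolding S_def
      by (intro CollectI bexI[of _ "h + h'"] exI[of _ "\<lambda>f. y f + y' f"])
        (auto simp: sum.distrib algebra_simps intro: wt C.subspace_add[OF sub_cartan])
  qed
  have scale: "complexified_scale c a \<in> S" if prem: "a \<in> S" for c a
  proof -
    obtain h y where *: "h \<in> cartan" "\<forall>f\<in>all_roots. y f \<in> C.weight_space cartan f" "a = h + sum y all_roots"
      using prem unfolding S_def by blast
    then show ?thesis
      unfolding S_def
      by (intro CollectI bexI[of _ "complexified_scale c h"] exI[of _ "\<lambda>f. complexified_scale c (y f)"])
        (auto simp: C.scale_right_distrib C.scale_sum_right intro: wt C.subspace_scale[OF sub_cartan])
  qed
  have cartan: "h \<in> S" if "h \<in> cartan" for h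
    unfolding S_def using that wt(3) by (intro CollectI bexI[of _ h] exI[of _ "\<lambda>_. 0"]) auto
  have weight: "v \<in> S" if "f \<in> all_roots" "v \<in> C.weight_space cartan f" for f v
    unfolding S_def using that wt(3) fin C.subspace_0[OF sub_cartan]
    by (intro CollectI bexI[of _ 0] exI[of _ "\<lambda>g. if g = f then v else 0"]) auto
  have root_plane: "(root_plane p l \<zeta> w, 0) \<in> S" if "p \<in> positions" "\<zeta> \<in> units" for p l \<zeta> w
  proof -
    have half: "root_plane p l \<zeta> (w / 2) + root_plane p l \<zeta> (w / 2) = root_plane p l \<zeta> w"
      by (simp flip: root_plane_ops(1))
    have "root_vector p l \<zeta> s (w / 2) \<in> S" if "s = 1 \<or> s = -1" for s
      using weight[OF root_in_all_roots root_vector_weight] \<open>p \<in> positions\<close> \<open>\<zeta> \<in> units\<close> that by blast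
    then have "root_vector p l \<zeta> 1 (w / 2) + root_vector p l \<zeta> (-1) (w / 2) \<in> S"
      by (intro add) auto
    then show ?thesis by (simp add: root_vector_def half)
  qed
  have real: "(u, 0) \<in> S" if "u \<in> W" for u
  proof -
    have "subspace {u. (u, 0) \<in> S}"
      unfolding subspace_def
    proof (intro conjI ballI allI; simp)
      show "(0, 0) \<in> S" using cartan C.subspace_0[OF sub_cartan] by (simp add: zero_prod_def)
      fix x assume x: "(x, 0) \<in> S"
      show "(r *\<^sub>R x, 0) \<in> S" for r
        using scale[OF x, of "of_real r"] by (simp add: complexified_scale_def)
      show "(x + y, 0) \<in> S" if "(y, 0) \<in> S" for y
        using add[OF x that] by simp
    qed
    moreover have "W_component 0 \<subseteq> {u. (u, 0) \<in> S}"
      using cartan W_component_0_ops(4) by (auto simp: cartan_def)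
    ultimately show ?thesis
      using W_spanned[OF that, of "{u. (u, 0) \<in> S}"] root_plane by blast
  qed
  have "x = (fst x, 0) + complexified_scale \<i> (snd x, 0)"
    by (simp add: complexified_scale_def prod_eq_iff)
  moreover have "(fst x, 0) + complexified_scale \<i> (snd x, 0) \<in> S"
    using assms by (intro add scale real) auto
  ultimately have "x \<in> S" by simp
  then show ?thesis by (simp add: S_def)
qed

lemma root_coroot_value:
  assumes "p \<in> positions" "\<zeta> \<in> units" "s = 1 \<or> s = -1"
  shows "root p l \<zeta> s (0, toral p l (of_real (s / 3) * \<i> * \<zeta>)) = 2"
proof -
  have "(0, toral p l (of_real (s / 3) * \<i> * \<zeta>)) \<in> cartan"
    using toral_in_W_component[OF assms(1)] W_component_0_ops(4) by (simp add: cartan_def)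
  then show ?thesis
    using assms(3) root_form_toral_i[OF assms(1,2), of l "s / 3"] linear_0[OF linear_root_form]
    by (auto simp: root_def complex_eq_iff)
qed

sublocale W: weight_decomposition complexified_scale "W \<times> W" cbr cartan all_roots
proof
  show "C.subspace cartan"
    unfolding cartan_def by (rule subspace_complexified[OF subspace_W_component])
  show "cartan \<subseteq> W \<times> W" by (rule cartan_subset)
  show "cbr x y = 0" if "x \<in> cartan" "y \<in> cartan" for x y
    using that by (auto simp: cartan_def complexified_bracket_def br_W_component_0 zero_prod_def)
  show "finite all_roots" by (simp add: all_roots_def positions_def units_def)
  show "\<exists>h\<in>cartan. f h \<noteq> 0" if prem: "f \<in> all_roots" for f
  proof -
    obtain p l \<zeta> s where *: "p \<in> positions" "\<zeta> \<in> units" "s = 1 \<or> s = -1" "f = root p l \<zeta> s"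
      using prem by (rule all_rootsE)
    have "(0, toral p l (of_real (s / 3) * \<i> * \<zeta>)) \<in> cartan"
      using toral_in_W_component[OF *(1)] W_component_0_ops(4) by (simp add: cartan_def)
    then show ?thesis using root_coroot_value[OF *(1-3), of l] *(4) by force
  qed
  show "\<exists>h\<in>cartan. \<exists>y. (\<forall>f\<in>all_roots. y f \<in> C.weight_space cartan f) \<and> x = h + sum y all_roots"
    if "x \<in> W \<times> W" for x
    using that by (rule W_decomposition)
qed

lemma root_is_root:
  assumes "p \<in> positions" "\<zeta> \<in> units" "s = 1 \<or> s = -1"
  shows "root p l \<zeta> s \<in> C.roots cartan"
proof -
  have sub: "C.subspace cartan" by (rule W.H(1))
  have dual: "root p l \<zeta> s \<in> C.dual_on cartan"
    unfolding C.dual_on_def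
    using C.subspace_add[OF sub] C.subspace_scale[OF sub]
    by (auto simp: root_def complex_eq_iff linear_add[OF linear_root_form] linear_diff[OF linear_root_form]
        linear_scale[OF linear_root_form] complexified_scale_def algebra_simps)
  have nonzero: "root p l \<zeta> s \<noteq> (\<lambda>_. 0)"
    using root_coroot_value[OF assms, of l] by auto
  have "root_plane p l \<zeta> 1 \<noteq> 0"
  proof
    assume "root_plane p l \<zeta> 1 = 0"
    then have "toral p l (9 * \<zeta> * (cnj 1 * \<i> - 1 * cnj \<i>)) = 0"
      using br_root_plane_root_plane[OF assms(1,2), of l 1 \<i>] by (simp only: br_simps)
    then have "root_form p l \<zeta> (toral p l (of_real 18 * \<i> * \<zeta>)) = 0"
      by (simp add: linear_0[OF linear_root_form] mult_ac)
    then show False using root_form_toral_i[OF assms(1,2), of l 18] by simp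
  qed
  then have "root_vector p l \<zeta> s 1 \<noteq> 0"
    by (auto simp: root_vector_def zero_prod_def)
  then have "C.weight_space cartan (root p l \<zeta> s) \<noteq> {0}"
    using root_vector_weight[OF assms] by blast
  then show ?thesis using dual nonzero by (simp add: C.roots_def)
qed

lemma roots_cartan: "C.roots cartan = all_roots"
proof
  show "all_roots \<subseteq> C.roots cartan"
    using root_is_root by (auto elim!: all_rootsE)
  show "C.roots cartan \<subseteq> all_roots"
  proof
    fix g assume g: "g \<in> C.roots cartan"
    obtain f where f: "f \<in> all_roots" "\<forall>h\<in>cartan. f h = g h" using W.root_in_R[OF g] by blast
    have "f h = g h" for h
    proof (cases "h \<in> cartan")
      case True
      then show ?thesis using f by blast
    next
      case False
      then have "g h = 0" using g by (cases h) (simp add: C.roots_def C.dual_on_def)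
      moreover have "f h = 0" using f(1) False by (auto simp: root_def elim!: all_rootsE)
      ultimately show ?thesis by simp
    qed
    then show "g \<in> all_roots" using f(1) by (metis ext)
  qed
qed

text \<open>The product of opposite root vectors is \<open>- 36 s\<close> times \<open>\<i>\<close> times the toral vector \<open>\<i> \<zeta>\<close>;
  the factor \<open>- 1 / 108\<close> normalises the value of the root to 2.\<close>
lemma is_coroot_toral:
  assumes "p \<in> positions" "\<zeta> \<in> units" "s = 1 \<or> s = -1"
  shows "C.is_coroot cartan (root p l \<zeta> s) (0, toral p l (of_real (s / 3) * \<i> * \<zeta>))"
proof -
  let ?f = "root p l \<zeta> s" and ?x = "root_vector p l \<zeta> s 1" and ?y = "root_vector p l \<zeta> (- s) 1"
  have x: "?x \<in> C.weight_space cartan ?f" by (rule root_vector_weight[OF assms])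
  have "root p l \<zeta> (- s) = (\<lambda>u. - ?f u)" by (auto simp: root_def complex_eq_iff fun_eq_iff)
  then have y: "?y \<in> C.weight_space cartan (\<lambda>u. - ?f u)"
    using root_vector_weight[OF assms(1,2), of "- s" l 1] assms(3) by auto
  have same: "br (root_plane p l \<zeta> z) (root_plane p l \<zeta> z) = 0" for z
    by (simp add: br_root_plane_root_plane[OF assms(1,2)] linear_0[OF linear_toral])
  have cross: "br (root_plane p l \<zeta> 1) (root_plane p l \<zeta> \<i>) = toral p l (18 * \<i> * \<zeta>)"
    "br (root_plane p l \<zeta> \<i>) (root_plane p l \<zeta> 1) = - toral p l (18 * \<i> * \<zeta>)"
    by (simp_all add: br_root_plane_root_plane[OF assms(1,2)] flip: linear_neg[OF linear_toral]) (simp_all add: algebra_simps)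
  have "cbr ?x ?y = (0, - (2 * s) *\<^sub>R toral p l (18 * \<i> * \<zeta>))"
    using assms(3) by (auto simp: complexified_bracket_def root_vector_def br_simps same cross scaleR_2 algebra_simps)
  also have "complexified_scale (of_real (- 1 / 108)) \<dots> = (0, toral p l (of_real (s / 3) * \<i> * \<zeta>))"
    by (simp add: complexified_scale_def linear_0[OF linear_toral] flip: linear_scale[OF linear_toral])
      (simp add: scaleR_conv_of_real field_simps)
  finally have eq: "complexified_scale (of_real (- 1 / 108)) (cbr ?x ?y)
      = (0, toral p l (of_real (s / 3) * \<i> * \<zeta>))" .
  let ?B = "{cbr x y |x y. x \<in> C.weight_space cartan ?f \<and> y \<in> C.weight_space cartan (\<lambda>u. - ?f u)}"
  have "cbr ?x ?y \<in> C.span ?B"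
    using x y by (intro C.span_base) blast
  then have "complexified_scale (of_real (- 1 / 108)) (cbr ?x ?y) \<in> C.span ?B"
    by (rule C.span_scale)
  then have "(0, toral p l (of_real (s / 3) * \<i> * \<zeta>)) \<in> C.span ?B"
    unfolding eq .
  then show ?thesis
    unfolding C.is_coroot_def using root_coroot_value[OF assms] by (rule conjI)
qed

end

section \<open>The Cartan matrix\<close>

text \<open>All 24 root forms on \<open>V\<^sub>0 \<inter> W\<close>, written in the real coordinates \<open>\<surd>3 Re x, Im x, \<surd>3 Re y,
  Im y\<close>. They are rational in these, which reduces the statements about roots to linear
  algebra.\<close>
lemma root_form_table:
  "root_form 0 True 1 (at_index 0 x y y) = 6 * Im x"
  "root_form 0 True \<omega> (at_index 0 x y y) = - 3 * (sqrt 3 * Re x) - 3 * Im x"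
  "root_form 0 True \<omega>' (at_index 0 x y y) = 3 * (sqrt 3 * Re x) - 3 * Im x"
  "root_form 0 False 1 (at_index 0 x y y) = 6 * Im y"
  "root_form 0 False \<omega> (at_index 0 x y y) = - 3 * (sqrt 3 * Re y) - 3 * Im y"
  "root_form 0 False \<omega>' (at_index 0 x y y) = 3 * (sqrt 3 * Re y) - 3 * Im y"
  "root_form 1 True 1 (at_index 0 x y y) = 1 * (sqrt 3 * Re x) + 3 * Im x + 2 * (sqrt 3 * Re y) + 6 * Im y"
  "root_form 1 True \<omega> (at_index 0 x y y) = - 2 * (sqrt 3 * Re x) - 4 * (sqrt 3 * Re y)"
  "root_form 1 True \<omega>' (at_index 0 x y y) = 1 * (sqrt 3 * Re x) - 3 * Im x + 2 * (sqrt 3 * Re y) - 6 * Im y"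
  "root_form 1 False 1 (at_index 0 x y y) = 1 * (sqrt 3 * Re x) - 3 * Im x - 1 * (sqrt 3 * Re y) + 3 * Im y"
  "root_form 1 False \<omega> (at_index 0 x y y) = 1 * (sqrt 3 * Re x) + 3 * Im x - 1 * (sqrt 3 * Re y) - 3 * Im y"
  "root_form 1 False \<omega>' (at_index 0 x y y) = - 2 * (sqrt 3 * Re x) + 2 * (sqrt 3 * Re y)"
  "root_form 3 True 1 (at_index 0 x y y) = 1 * (sqrt 3 * Re x) - 3 * Im x + 2 * (sqrt 3 * Re y) + 6 * Im y"
  "root_form 3 True \<omega> (at_index 0 x y y) = 1 * (sqrt 3 * Re x) + 3 * Im x - 4 * (sqrt 3 * Re y)"
  "root_form 3 True \<omega>' (at_index 0 x y y) = - 2 * (sqrt 3 * Re x) + 2 * (sqrt 3 * Re y) - 6 * Im y"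
  "root_form 3 False 1 (at_index 0 x y y) = 1 * (sqrt 3 * Re x) - 3 * Im x - 1 * (sqrt 3 * Re y) - 3 * Im y"
  "root_form 3 False \<omega> (at_index 0 x y y) = 1 * (sqrt 3 * Re x) + 3 * Im x + 2 * (sqrt 3 * Re y)"
  "root_form 3 False \<omega>' (at_index 0 x y y) = - 2 * (sqrt 3 * Re x) - 1 * (sqrt 3 * Re y) + 3 * Im y"
  "root_form 9 True 1 (at_index 0 x y y) = 1 * (sqrt 3 * Re x) + 3 * Im x + 2 * (sqrt 3 * Re y) - 6 * Im y"
  "root_form 9 True \<omega> (at_index 0 x y y) = - 2 * (sqrt 3 * Re x) + 2 * (sqrt 3 * Re y) + 6 * Im y"
  "root_form 9 True \<omega>' (at_index 0 x y y) = 1 * (sqrt 3 * Re x) - 3 * Im x - 4 * (sqrt 3 * Re y)"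
  "root_form 9 False 1 (at_index 0 x y y) = 1 * (sqrt 3 * Re x) + 3 * Im x - 1 * (sqrt 3 * Re y) + 3 * Im y"
  "root_form 9 False \<omega> (at_index 0 x y y) = - 2 * (sqrt 3 * Re x) - 1 * (sqrt 3 * Re y) - 3 * Im y"
  "root_form 9 False \<omega>' (at_index 0 x y y) = 1 * (sqrt 3 * Re x) - 3 * Im x + 2 * (sqrt 3 * Re y)"
  by (simp_all add: root_form_def coord_def axis_nth_13 vector_3 frame_simps scaled_matrix_nth theta_omega
      field_simps)

text \<open>The coefficients are those of the 24 positive roots of \<open>F\<^sub>4\<close>, up to the highest long root
  \<open>2, 3, 4, 2\<close> and the highest short root \<open>1, 2, 3, 2\<close>.\<close>
lemma root_form_combination:
  assumes "p \<in> positions" "\<zeta> \<in> units"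
  shows "\<exists>(a :: nat) (b :: nat) (c :: nat) (d :: nat) \<sigma> :: real. (\<sigma> = 1 \<or> \<sigma> = -1) \<and> (\<forall>v\<in>W_component 0. \<sigma> * root_form p l \<zeta> v =
    a * root_form 0 True 1 v + b * (- root_form 1 True 1 v) + c * root_form 0 False 1 v + d * root_form 0 False \<omega>' v)"
proof -
  define Q where "Q p l \<zeta> \<longleftrightarrow> (\<exists>(a :: nat) (b :: nat) (c :: nat) (d :: nat) \<sigma> :: real. (\<sigma> = 1 \<or> \<sigma> = -1) \<and>
    (\<forall>v\<in>W_component 0. \<sigma> * root_form p l \<zeta> v =
      a * root_form 0 True 1 v + b * (- root_form 1 True 1 v) + c * root_form 0 False 1 v + d * root_form 0 False \<omega>' v))"
    for p l \<zeta>
  have combI: "Q p l \<zeta>" if "\<sigma> = 1 \<or> \<sigma> = -1"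
    "\<And>x y. \<sigma> * root_form p l \<zeta> (at_index 0 x y y) = a * root_form 0 True 1 (at_index 0 x y y)
      + b * (- root_form 1 True 1 (at_index 0 x y y)) + c * root_form 0 False 1 (at_index 0 x y y)
      + d * root_form 0 False \<omega>' (at_index 0 x y y)" for p l \<zeta> \<sigma> and a b c d :: nat
    unfolding Q_def
    by (rule exI[of _ a], rule exI[of _ b], rule exI[of _ c], rule exI[of _ d], rule exI[of _ \<sigma>])
      (use that in \<open>auto simp: W_component_def\<close>)
  have c0: "Q 0 True 1" by (rule combI[where a = 1 and b = 0 and c = 0 and d = 0 and \<sigma> = "1"]) (simp_all add: root_form_table algebra_simps)
  have c1: "Q 0 True \<omega>" by (rule combI[where a = 1 and b = 3 and c = 4 and d = 2 and \<sigma> = "1"]) (simp_all add: root_form_table algebra_simps)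
  have c2: "Q 0 True \<omega>'" by (rule combI[where a = 2 and b = 3 and c = 4 and d = 2 and \<sigma> = "-1"]) (simp_all add: root_form_table algebra_simps)
  have c3: "Q 0 False 1" by (rule combI[where a = 0 and b = 0 and c = 1 and d = 0 and \<sigma> = "1"]) (simp_all add: root_form_table algebra_simps)
  have c4: "Q 0 False \<omega>" by (rule combI[where a = 0 and b = 0 and c = 1 and d = 1 and \<sigma> = "-1"]) (simp_all add: root_form_table algebra_simps)
  have c5: "Q 0 False \<omega>'" by (rule combI[where a = 0 and b = 0 and c = 0 and d = 1 and \<sigma> = "1"]) (simp_all add: root_form_table algebra_simps)
  have c6: "Q 1 True 1" by (rule combI[where a = 0 and b = 1 and c = 0 and d = 0 and \<sigma> = "-1"]) (simp_all add: root_form_table algebra_simps)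
  have c7: "Q 1 True \<omega>" by (rule combI[where a = 1 and b = 2 and c = 2 and d = 0 and \<sigma> = "1"]) (simp_all add: root_form_table algebra_simps)
  have c8: "Q 1 True \<omega>'" by (rule combI[where a = 1 and b = 1 and c = 2 and d = 0 and \<sigma> = "-1"]) (simp_all add: root_form_table algebra_simps)
  have c9: "Q 1 False 1" by (rule combI[where a = 1 and b = 1 and c = 1 and d = 1 and \<sigma> = "-1"]) (simp_all add: root_form_table algebra_simps)
  have c10: "Q 1 False \<omega>" by (rule combI[where a = 0 and b = 1 and c = 2 and d = 1 and \<sigma> = "-1"]) (simp_all add: root_form_table algebra_simps)
  have c11: "Q 1 False \<omega>'" by (rule combI[where a = 1 and b = 2 and c = 3 and d = 2 and \<sigma> = "1"]) (simp_all add: root_form_table algebra_simps)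
  have c12: "Q 3 True 1" by (rule combI[where a = 1 and b = 1 and c = 0 and d = 0 and \<sigma> = "-1"]) (simp_all add: root_form_table algebra_simps)
  have c13: "Q 3 True \<omega>" by (rule combI[where a = 0 and b = 1 and c = 2 and d = 2 and \<sigma> = "-1"]) (simp_all add: root_form_table algebra_simps)
  have c14: "Q 3 True \<omega>'" by (rule combI[where a = 1 and b = 2 and c = 2 and d = 2 and \<sigma> = "1"]) (simp_all add: root_form_table algebra_simps)
  have c15: "Q 3 False 1" by (rule combI[where a = 1 and b = 1 and c = 2 and d = 1 and \<sigma> = "-1"]) (simp_all add: root_form_table algebra_simps)
  have c16: "Q 3 False \<omega>" by (rule combI[where a = 0 and b = 1 and c = 1 and d = 0 and \<sigma> = "-1"]) (simp_all add: root_form_table algebra_simps)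
  have c17: "Q 3 False \<omega>'" by (rule combI[where a = 1 and b = 2 and c = 3 and d = 1 and \<sigma> = "1"]) (simp_all add: root_form_table algebra_simps)
  have c18: "Q 9 True 1" by (rule combI[where a = 0 and b = 1 and c = 2 and d = 0 and \<sigma> = "-1"]) (simp_all add: root_form_table algebra_simps)
  have c19: "Q 9 True \<omega>" by (rule combI[where a = 1 and b = 2 and c = 4 and d = 2 and \<sigma> = "1"]) (simp_all add: root_form_table algebra_simps)
  have c20: "Q 9 True \<omega>'" by (rule combI[where a = 1 and b = 1 and c = 2 and d = 2 and \<sigma> = "-1"]) (simp_all add: root_form_table algebra_simps)
  have c21: "Q 9 False 1" by (rule combI[where a = 0 and b = 1 and c = 1 and d = 1 and \<sigma> = "-1"]) (simp_all add: root_form_table algebra_simps)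
  have c22: "Q 9 False \<omega>" by (rule combI[where a = 1 and b = 2 and c = 2 and d = 1 and \<sigma> = "1"]) (simp_all add: root_form_table algebra_simps)
  have c23: "Q 9 False \<omega>'" by (rule combI[where a = 1 and b = 1 and c = 1 and d = 0 and \<sigma> = "-1"]) (simp_all add: root_form_table algebra_simps)
  have "Q p True \<zeta> \<and> Q p False \<zeta>"
    using assms unfolding positions_def units_def
    by (elim insertE emptyE; hypsubst) (simp_all only: c0 c1 c2 c3 c4 c5 c6 c7 c8 c9 c10 c11
      c12 c13 c14 c15 c16 c17 c18 c19 c20 c21 c22 c23 simp_thms)
  then have "Q p l \<zeta>" by (cases l) auto
  then show ?thesis by (simp only: Q_def)
qed

definition simple_root :: "nat \<Rightarrow> V \<times> V \<Rightarrow> complex" where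
  "simple_root i = [root 0 True 1 1, root 1 True 1 (-1), root 0 False 1 1, root 0 False \<omega>' 1] ! i"

definition simple_coroot :: "nat \<Rightarrow> V \<times> V" where
  "simple_coroot j = (0, [toral 0 True (of_real (1 / 3) * \<i> * 1), toral 1 True (of_real (-1 / 3) * \<i> * 1),
     toral 0 False (of_real (1 / 3) * \<i> * 1), toral 0 False (of_real (1 / 3) * \<i> * \<omega>')] ! j)"

lemma less_4_cases:
  assumes "i < (4 :: nat)"
  obtains "i = 0" | "i = 1" | "i = 2" | "i = 3"
  using assms by linarith

lemma sum_less_4: "(\<Sum>i<4. f i) = f 0 + f 1 + f 2 + f (3 :: nat)"
  by (simp add: eval_nat_numeral)

lemma simple_nth:
  "simple_root 0 = root 0 True 1 1" "simple_root 1 = root 1 True 1 (-1)"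
  "simple_root (Suc 0) = root 1 True 1 (-1)"
  "simple_root 2 = root 0 False 1 1" "simple_root 3 = root 0 False \<omega>' 1"
  "simple_coroot 0 = (0, toral 0 True (of_real (1 / 3) * \<i> * 1))"
  "simple_coroot 1 = (0, toral 1 True (of_real (-1 / 3) * \<i> * 1))"
  "simple_coroot (Suc 0) = (0, toral 1 True (of_real (-1 / 3) * \<i> * 1))"
  "simple_coroot 2 = (0, toral 0 False (of_real (1 / 3) * \<i> * 1))"
  "simple_coroot 3 = (0, toral 0 False (of_real (1 / 3) * \<i> * \<omega>'))"
  by (simp_all add: simple_root_def simple_coroot_def)

lemma cartan_integers:
  assumes "i < 4" "j < 4"
  shows "simple_root i (simple_coroot j) = of_int (cartan_matrix_F4 i j)"
proof -
  have theta: "\<theta> = Complex 0 (sqrt 3)" by (simp add: theta_omega complex_eq_iff)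
  have t0: "toral 0 True z = at_index 0 z 0 0" "toral 0 False z = at_index 0 0 z z"
    "toral 1 True z = at_index 0 (\<theta> / 3 * z * \<omega>') (\<theta> / 3 * z * \<omega>') (\<theta> / 3 * z * \<omega>')" for z
    by (simp_all add: toral_def Y_def X_explicit axis_add[symmetric] axis_eq_axis)
  have root_value: "root p l \<zeta> s (0, at_index 0 x y y) = of_real (s * root_form p l \<zeta> (at_index 0 x y y))"
    for p l \<zeta> s x y
  proof -
    have "(0, at_index 0 x y y) \<in> cartan"
      using W_component_0_ops(4) by (auto simp: cartan_def W_component_def)
    then show ?thesis by (simp add: root_def linear_0[OF linear_root_form] complex_eq_iff)
  qed
  show ?thesis
    by (cases rule: less_4_cases[OF assms(1)]; cases rule: less_4_cases[OF assms(2)])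
      (simp_all add: simple_nth t0 root_value root_form_table theta cartan_matrix_F4_def
        complex_eq_iff field_simps)
qed

context e6_product
begin

lemma simple_root_in_roots: "i < 4 \<Longrightarrow> simple_root i \<in> W.roots cartan"
  by (erule less_4_cases) (auto simp: simple_nth positions_def units_def intro!: root_is_root)

text \<open>Evaluation at the coroots turns a linear relation into one between the rows of the Cartan
  matrix, which is invertible.\<close>
lemma simple_roots_independent:
  assumes "\<forall>h. (\<Sum>i<4. c i * simple_root i h) = 0" "i < 4"
  shows "c i = 0"
proof -
  have eq: "(\<Sum>i<4. c i * of_int (cartan_matrix_F4 i j)) = 0" if "j < 4" for j
    using assms(1)[rule_format, of "simple_coroot j"] cartan_integers that by simp
  have "2 * c 0 - c 1 = 0" "- c 0 + 2 * c 1 - c 2 = 0" "- 2 * c 1 + 2 * c 2 - c 3 = 0" "- c 2 + 2 * c 3 = 0"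
    using eq[of 0] eq[of 1] eq[of 2] eq[of 3]
    by (simp_all add: sum_less_4 cartan_matrix_F4_def mult.commute)
  then have "c 0 = 0" "c 1 = 0" "c 2 = 0" "c 3 = 0"
    by algebra+
  with assms(2) show ?thesis by (auto elim: less_4_cases)
qed

lemma root_combination:
  assumes "f \<in> W.roots cartan"
  shows "\<exists>m :: nat \<Rightarrow> nat. (\<forall>h. f h = (\<Sum>i<4. of_nat (m i) * simple_root i h))
    \<or> (\<forall>h. f h = - (\<Sum>i<4. of_nat (m i) * simple_root i h))"
proof -
  have "f \<in> all_roots" using assms roots_cartan by simp
  then obtain p l \<zeta> s where *: "p \<in> positions" "\<zeta> \<in> units" "s = 1 \<or> s = -1" "f = root p l \<zeta> s"
    by (rule all_rootsE)
  obtain a b c d :: nat and \<sigma> :: real where \<sigma>: "\<sigma> = 1 \<or> \<sigma> = -1" and comb: "\<And>v. v \<in> W_component 0 \<Longrightarrow>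
      \<sigma> * root_form p l \<zeta> v = a * root_form 0 True 1 v + b * (- root_form 1 True 1 v) + c * root_form 0 False 1 v + d * root_form 0 False \<omega>' v"
    using root_form_combination[OF *(1,2), of l] by blast
  define m where "m i = [a, b, c, d] ! i" for i :: nat
  have sum: "(\<Sum>i<4. of_nat (m i) * simple_root i h) = root p l \<zeta> \<sigma> h" for h
  proof (cases "h \<in> cartan")
    case False
    then show ?thesis by (simp add: sum_less_4 simple_nth root_def)
  next
    case True
    then have "fst h \<in> W_component 0" "snd h \<in> W_component 0" by (auto simp: cartan_def)
    then show ?thesis
      using True comb[of "fst h"] comb[of "snd h"]
      by (simp add: sum_less_4 simple_nth root_def m_def complex_eq_iff)
  qed
  have "root p l \<zeta> (- \<sigma>) h = - root p l \<zeta> \<sigma> h" for h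
    by (simp add: root_def complex_eq_iff)
  then show ?thesis
    using *(3,4) \<sigma> sum by (intro exI[of _ m]) auto
qed

lemma has_cartan_matrix_W: "W.has_cartan_matrix 4 cartan_matrix_F4"
proof -
  have "W.root_base cartan 4 simple_root"
    unfolding W.root_base_def
    using simple_root_in_roots simple_roots_independent root_combination by blast
  moreover have "W.is_coroot cartan (simple_root j) (simple_coroot j)" if "j < 4" for j
    using that is_coroot_toral[of 0 1 1 True] is_coroot_toral[of 1 1 "-1" True]
      is_coroot_toral[of 0 1 1 False] is_coroot_toral[of 0 "\<omega>'" 1 False]
    by (auto elim!: less_4_cases simp: simple_nth positions_def units_def)
  ultimately show ?thesis
    unfolding W.has_cartan_matrix_def using W.cartan_H cartan_integers by blast
qed

end

section \<open>Simplicity and compactness\<close>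

lemma inner_X_Y:
  assumes "p \<in> positions" "q \<in> positions"
  shows "inner (X k p m w) (Y k q l z) = (if p = q \<and> (m = 1) = l then Re (w * cnj z) else 0)"
  using assms exhaust_3[of m] by (auto simp: Y_def inner_X inner_add_right)

lemma Y_eq_0D:
  assumes "p \<in> positions" "Y k p l z = 0"
  shows "z = 0"
  using inner_X_Y[OF assms(1,1), of k "if l then 1 else 2" z l z] assms(2)
  by (cases l) (auto simp: complex_eq_iff power2_eq_square[symmetric] sum_power2_eq_zero_iff)

lemma Y_sum_eq_0D:
  assumes "p \<in> positions" "q \<in> positions" "(p, l) \<noteq> (q, l')" "Y k p l a + Y k q l' b = 0"
  shows "a = 0" "b = 0"
proof -
  have "inner (X k p (if l then 1 else 2) a) (Y k p l a + Y k q l' b) = Re (a * cnj a)"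
    using assms(3) by (cases l; cases l') (auto simp: inner_add_right inner_X_Y[OF assms(1,1)] inner_X_Y[OF assms(1,2)])
  then show "a = 0"
    using assms(4) by (simp add: complex_eq_iff power2_eq_square[symmetric] sum_power2_eq_zero_iff)
  then have "Y k q l' b = 0" using assms(4) by (simp add: linear_0[OF linear_Y])
  then show "b = 0" by (rule Y_eq_0D[OF assms(2)])
qed

lemma shift_Y: "shift j (Y k t l z) = Y (j + k) t l z"
  by (simp add: Y_def shift_X linear_add[OF linear_shift])

lemma shift_W: "v \<in> W \<Longrightarrow> shift k v \<in> W"
  by (simp add: W_iff shift_def)

context e6_product
begin

text \<open>The centroid, with additive maps: homogeneity follows, as \<open>central_scalar\<close> shows.\<close>
definition central :: "(V \<Rightarrow> V) \<Rightarrow> bool" where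
  "central A \<longleftrightarrow> (\<forall>x\<in>W. A x \<in> W) \<and> (\<forall>x\<in>W. \<forall>y\<in>W. A (x + y) = A x + A y) \<and>
     (\<forall>x\<in>W. \<forall>y\<in>W. A (br x y) = br x (A y))"

lemma central_zero:
  assumes "central A"
  shows "A 0 = 0"
proof -
  have "A (0 + 0) = A 0 + A 0"
    using assms subspace_0[OF subspace_W] unfolding central_def by blast
  then show ?thesis by simp
qed

lemma central_minus:
  assumes "central A" "x \<in> W"
  shows "A (- x) = - A x"
proof -
  have "A (- x + x) = A (- x) + A x"
    using assms subspace_neg[OF subspace_W] unfolding central_def by blast
  then show ?thesis using central_zero[OF assms(1)] by (simp add: eq_neg_iff_add_eq_0)
qed

lemma central_left:
  assumes "central A" "x \<in> W" "y \<in> W"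
  shows "br (A x) y = br x (A y)"
proof -
  have "br (A x) y = - br y (A x)" by (rule br_antisym)
  also have "\<dots> = - A (br y x)" using assms by (simp add: central_def)
  also have "\<dots> = A (br x y)"
    using central_minus[OF assms(1) br_W_closed[OF assms(3,2)]] br_antisym[of x y] by simp
  finally show ?thesis using assms by (simp add: central_def)
qed

lemma central_shift:
  assumes "central A"
  shows "central (\<lambda>x. shift (- t) (A (shift t x)))"
proof -
  have "shift (- t) (br (shift t x) (A (shift t y))) = br x (shift (- t) (A (shift t y)))" for x y
    using symmetryD[OF symmetry_shift, of "- t" "shift t x" "A (shift t y)"]
    by (simp add: shift_shift) (simp add: shift_def)
  then show ?thesis
    using assms shift_W unfolding central_def
    by (simp add: linear_add[OF linear_shift] symmetryD[OF symmetry_shift, symmetric])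
qed

text \<open>An element of the centroid preserves centralizers, and the component at \<open>0\<close> is its own
  centralizer because it complexifies to a Cartan subalgebra.\<close>
lemma central_W_component_0:
  assumes "central A" "a \<in> W_component 0"
  shows "A a \<in> W_component 0"
proof -
  have "a \<in> W" using assms(2) by (simp add: W_component_iff)
  then have "A a \<in> W" using assms(1) by (simp add: central_def)
  have "br (A a) h = 0" if "h \<in> W_component 0" for h
  proof -
    have h: "h \<in> W" using that by (simp add: W_component_iff)
    have "br (A a) h = br a (A h)" by (rule central_left[OF assms(1) \<open>a \<in> W\<close> h])
    also have "\<dots> = A (br a h)" using assms(1) \<open>a \<in> W\<close> h by (simp add: central_def)
    finally show ?thesis using br_W_component_0[OF assms(2) that] central_zero[OF assms(1)] by simp
  qed
  then have comm: "cbr (A a, 0) h \<in> cartan" if "h \<in> cartan" for h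
    using that W_component_0_ops(4) by (auto simp: cartan_def complexified_bracket_def br_simps)
  have "(A a, 0) \<in> W \<times> W" using \<open>A a \<in> W\<close> subspace_0[OF subspace_W] by simp
  then have "(A a, 0) \<in> cartan" using comm by (rule W.normalizer_H)
  then show ?thesis by (simp add: cartan_def)
qed

lemma central_W_component:
  assumes "central A" "a \<in> W_component t"
  shows "A a \<in> W_component t"
proof -
  obtain x y where "a = at_index t x y y" using assms(2) by (auto simp: W_component_def)
  then have "shift (- t) a = at_index 0 x y y" by simp
  then have "shift (- t) a \<in> W_component 0" unfolding W_component_def by blast
  then have "shift (- t) (A (shift t (shift (- t) a))) \<in> W_component 0"
    by (rule central_W_component_0[OF central_shift[OF assms(1)]])
  moreover have "shift t (shift (- t) a) = a" by (simp add: shift_shift) (simp add: shift_def)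
  ultimately have *: "shift (- t) (A a) \<in> W_component 0" by simp
  have "a \<in> W" using assms(2) by (simp add: W_component_iff)
  then have "A a \<in> W" using assms(1) by (simp add: central_def)
  moreover have "A a $ s = 0" if "s \<noteq> t" for s
  proof -
    have "shift (- t) (A a) $ (s - t) = 0" using * that by (simp add: W_component_iff)
    then show ?thesis by (simp add: shift_def)
  qed
  ultimately show ?thesis by (simp add: W_component_iff)
qed

text \<open>Within a summand, the long part consists of the vectors that commute with the short part
  of another summand of the same line, and conversely.\<close>
lemma central_Y:
  assumes A: "central A" and p: "p \<in> {0, 1}"
  shows "\<exists>c. A (Y 0 p l z) = Y 0 p l c"
proof -
  have pos: "0 \<in> positions" "1 \<in> positions" "3 \<in> positions" "9 \<in> positions" "p \<in> positions"
    using p by (auto simp: positions_def)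
  have mem: "Y 0 p l z \<in> W_component p"
    using Y_in_W[OF pos(5)] p unfolding W_component_iff Y_def X_def by (auto simp: axis_nth_13)
  then have "A (Y 0 p l z) \<in> W_component (0 + p)" using central_W_component[OF A] by simp
  then obtain c d where cd: "A (Y 0 p l z) = Y 0 p l c + Y 0 p (\<not> l) d"
    unfolding W_component_def using W_component_expand[OF pos(5), of 0]
    by (cases l) (auto simp: add.commute)
  let ?q = "1 - p"
  have q: "p = 0 \<and> ?q = 1 \<or> p = 1 \<and> ?q = 0" using p by auto
  have "br (Y 0 ?q (\<not> l) 1) (A (Y 0 p l z)) = A (br (Y 0 ?q (\<not> l) 1) (Y 0 p l z))"
    using A Y_in_W[OF pos(5)] Y_in_W[OF pos(1)] Y_in_W[OF pos(2)] q unfolding central_def by auto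
  then have zero: "br (Y 0 ?q (\<not> l) 1) (Y 0 p (\<not> l) d) = 0"
    using q by (auto simp: cd br_simps br_Y central_zero[OF A])
  have "d = 0"
    using q
  proof
    assume "p = 0 \<and> ?q = 1"
    then have "Y 0 9 (\<not> l) (3 * cnj d) + Y 0 3 (\<not> l) (- (3 * d)) = 0"
      using zero by (simp add: br_Y Y_ops)
    then show ?thesis using Y_sum_eq_0D(2)[OF pos(4,3)] by force
  next
    assume "p = 1 \<and> ?q = 0"
    then have "Y 0 3 (\<not> l) (3 * d) + Y 0 9 (\<not> l) (- (3 * d)) = 0"
      using zero by (simp add: br_Y Y_ops)
    then show ?thesis using Y_sum_eq_0D(2)[OF pos(3,4)] by force
  qed
  then show ?thesis using cd by (auto simp: linear_0[OF linear_Y])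
qed

text \<open>On the long or short part of a line the centroid condition for \<open>[V\<^sub>0, V\<^sub>1]\<close> reads \<open>f(z) w
  = z g(w)\<close> together with the same equation for the conjugates of \<open>f(z)\<close> and \<open>z\<close>, which forces
  \<open>f\<close> and \<open>g\<close> to be multiplication by one real number.\<close>
lemma central_line:
  assumes A: "central A"
  shows "\<exists>r :: real. \<forall>z. A (Y 0 0 l z) = Y 0 0 l (of_real r * z) \<and> A (Y 0 1 l z) = Y 0 1 l (of_real r * z)"
proof -
  have pos: "0 \<in> positions" "1 \<in> positions" "3 \<in> positions" "9 \<in> positions"
    by (auto simp: positions_def)
  obtain f where f: "\<And>z. A (Y 0 0 l z) = Y 0 0 l (f z)" using central_Y[OF A, of 0] by auto metis
  obtain g where g: "\<And>z. A (Y 0 1 l z) = Y 0 1 l (g z)" using central_Y[OF A, of 1] by auto metis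
  have eq: "f z * w = z * g w" "cnj (f z) * w = cnj z * g w" for z w
  proof -
    have "br (A (Y 0 0 l z)) (Y 0 1 l w) = br (Y 0 0 l z) (A (Y 0 1 l w))"
      by (rule central_left[OF A Y_in_W[OF pos(1)] Y_in_W[OF pos(2)]])
    then have "Y 0 3 l (3 * f z * w) - Y 0 9 l (3 * cnj (f z) * w)
        = Y 0 3 l (3 * z * g w) - Y 0 9 l (3 * cnj z * g w)"
      by (simp add: f g br_Y)
    moreover have "Y 0 3 l (3 * f z * w - 3 * z * g w) + Y 0 9 l (3 * cnj z * g w - 3 * cnj (f z) * w)
        = (Y 0 3 l (3 * f z * w) - Y 0 9 l (3 * cnj (f z) * w))
          - (Y 0 3 l (3 * z * g w) - Y 0 9 l (3 * cnj z * g w))"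
      by (simp add: Y_ops)
    ultimately have "Y 0 3 l (3 * f z * w - 3 * z * g w) + Y 0 9 l (3 * cnj z * g w - 3 * cnj (f z) * w) = 0"
      by simp
    from Y_sum_eq_0D[OF pos(3,4) _ this]
    show "f z * w = z * g w" "cnj (f z) * w = cnj z * g w" by simp_all
  qed
  have "f 1 = g 1" "cnj (f 1) = g 1" using eq[of 1 1] by simp_all
  then have real: "f 1 = of_real (Re (f 1))" by (simp add: complex_eq_iff)
  have "f z = f 1 * z" for z using eq(1)[of z 1] \<open>f 1 = g 1\<close> by simp
  moreover have "g z = f 1 * z" for z using eq(1)[of 1 z] by simp
  ultimately show ?thesis
    using real f g by (intro exI[of _ "Re (f 1)"]) metis
qed

text \<open>The summand \<open>V\<close> at \<open>k + 1\<close> has position \<open>1\<close> on line \<open>k\<close> and position \<open>0\<close> on line \<open>k + 1\<close>.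
  The long part in the first sense, spanned by \<open>(1, 1, 1)\<close>, has nonzero long and short
  components in the second sense, so both scalars of line \<open>k + 1\<close> equal the long scalar of line
  \<open>k\<close>.\<close>
lemma central_scalar:
  assumes A: "central A"
  shows "\<exists>r. \<forall>x\<in>W. A x = r *\<^sub>R x"
proof -
  have pos: "0 \<in> positions" "1 \<in> positions" by (auto simp: positions_def)
  have "\<exists>r :: real. \<forall>z. A (Y k 0 l z) = Y k 0 l (of_real r * z) \<and> A (Y k 1 l z) = Y k 1 l (of_real r * z)" for k l
  proof -
    obtain r :: real where r: "\<And>z. shift (- k) (A (shift k (Y 0 0 l z))) = Y 0 0 l (of_real r * z)"
      "\<And>z. shift (- k) (A (shift k (Y 0 1 l z))) = Y 0 1 l (of_real r * z)"
      using central_line[OF central_shift[OF A, of k], of l] by auto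
    have undo: "shift k (shift (- k) v) = v" for v by (simp add: shift_shift) (simp add: shift_def)
    have "A (Y k 0 l z) = Y k 0 l (of_real r * z)" "A (Y k 1 l z) = Y k 1 l (of_real r * z)" for z
      using arg_cong[OF r(1)[of z], of "shift k"] arg_cong[OF r(2)[of z], of "shift k"]
      by (simp_all add: undo shift_Y)
    then show ?thesis by blast
  qed
  then obtain r :: "13 \<Rightarrow> bool \<Rightarrow> real" where
    r: "\<And>k l z. A (Y k 0 l z) = Y k 0 l (of_real (r k l) * z)" "\<And>k l z. A (Y k 1 l z) = Y k 1 l (of_real (r k l) * z)"
    by metis
  have A_add: "A (x + y) = A x + A y" if "x \<in> W" "y \<in> W" for x y
    using A that by (simp add: central_def)
  have step: "r (k + 1) True = r k True \<and> r (k + 1) False = r k True" for k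
  proof -
    let ?u = "\<theta> / 3 * \<omega>'"
    have "?u \<noteq> 0" using omega_neq by (simp add: complex_eq_iff theta_omega)
    have Y: "Y k 1 True z = Y (k + 1) 0 True (z * ?u) + Y (k + 1) 0 False (z * ?u)" for z
      by (simp add: Y_def X_explicit axis_add[symmetric] mult_ac)
    have "Y (k + 1) 0 True (r k True * ?u) + Y (k + 1) 0 False (r k True * ?u)
      = Y k 1 True (of_real (r k True) * 1)" by (simp only: Y mult_1_right)
    also have "\<dots> = A (Y k 1 True 1)" by (rule r(2)[symmetric])
    also have "\<dots> = Y (k + 1) 0 True (r (k + 1) True * ?u) + Y (k + 1) 0 False (r (k + 1) False * ?u)"
      unfolding Y by (simp add: A_add Y_in_W pos r)
    finally have "Y (k + 1) 0 True (r k True * ?u - r (k + 1) True * ?u)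
      + Y (k + 1) 0 False (r k True * ?u - r (k + 1) False * ?u) = 0"
      by (simp add: Y_ops algebra_simps)
    from Y_sum_eq_0D[OF pos(1,1) _ this] \<open>?u \<noteq> 0\<close>
    show ?thesis by (simp add: left_diff_distrib[symmetric] del: of_real_diff)
  qed
  define c where "c = r 0 True"
  have rT: "r k True = c" for k
    by (induction k rule: induct_13) (simp_all add: c_def step)
  have rF: "r k False = c" for k
    using step[of "k - 1"] rT by simp
  have comp: "A (at_index t x y y) = c *\<^sub>R at_index t x y y" for t x y
  proof -
    have "at_index t x y y = Y t 0 True x + Y t 0 False y"
      by (simp add: Y_def X_explicit axis_add[symmetric])
    then show ?thesis
      by (simp add: A_add Y_in_W pos r rT rF scaleR_right_distrib flip: linear_scale[OF linear_Y] scaleR_conv_of_real)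
  qed
  have sums: "A (sum f T) = (\<Sum>t\<in>T. A (f t))" if "finite T" "\<And>t. f t \<in> W" for f :: "13 \<Rightarrow> V" and T
    using that(1)
  proof (induction T rule: finite_induct)
    case empty
    then show ?case by (simp add: central_zero[OF A])
  next
    case (insert t T)
    then show ?case using that(2) by (simp add: A_add subspace_sum[OF subspace_W])
  qed
  have "A x = c *\<^sub>R x" if "x \<in> W" for x
  proof -
    have x: "axis t (x $ t) = at_index t (x $ t $ 1) (x $ t $ 2) (x $ t $ 2)" for t
      using that vector3_expand[of "x $ t"] by (simp add: W_iff)
    have "A (\<Sum>t\<in>UNIV. axis t (x $ t)) = c *\<^sub>R (\<Sum>t\<in>UNIV. axis t (x $ t))"
      by (subst sums) (simp_all add: x at_index_in_W comp scaleR_sum_right)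
    then show ?thesis by (simp only: sum_axis)
  qed
  then show ?thesis by blast
qed

lemma W_nonabelian: "\<exists>x\<in>W. \<exists>y\<in>W. br x y \<noteq> 0"
proof -
  have pos: "0 \<in> positions" "1 \<in> positions" "3 \<in> positions" "9 \<in> positions"
    by (auto simp: positions_def)
  have "br (Y 0 0 True 1) (Y 0 1 True 1) \<noteq> 0"
  proof
    assume "br (Y 0 0 True 1) (Y 0 1 True 1) = 0"
    then have "Y 0 3 True 3 + Y 0 9 True (- 3) = 0" by (simp add: br_Y Y_ops)
    then show False using Y_sum_eq_0D(1)[OF pos(3,4)] by force
  qed
  then show ?thesis using Y_in_W[OF pos(1)] Y_in_W[OF pos(2)] by blast
qed

lemma complex_simple_W: "lie_algebra.lie_simple complexified_scale (W \<times> W) cbr"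
proof -
  obtain x y where "x \<in> W" "y \<in> W" "br x y \<noteq> 0" using W_nonabelian by blast
  then show ?thesis
    by (intro complex_simple_if_central[OF lie_algebra_V bil skew subspace_W br_W_closed])
      (auto intro!: central_scalar simp: central_def)
qed

lemma compact_F4_W: "compact_F4 W br"
proof -
  interpret R: lie_algebra scaleR W br by (rule lie_algebra_W)
  have R_simple: "R.lie_simple"
    by (rule real_simple_if_complex_simple[OF lie_algebra_V subspace_W br_W_closed complex_simple_W])
  have "R.killing x x < 0" if x: "x \<in> W" "x \<noteq> 0" for x
  proof -
    obtain y where "y \<in> W" "br x y \<noteq> 0" using R.simple_imp_centerless[OF R_simple x] by blast
    then show ?thesis by (intro killing_negative[OF lie_algebra_W bil skew x(1)])
  qed
  moreover have "R.finite_dim"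
  proof -
    obtain B where "B \<subseteq> W" "independent B" "W \<subseteq> span B" using basis_exists[of W] by metis
    then have "finite B \<and> span B = W"
      using independent_imp_finite span_minimal[OF _ subspace_W] by blast
    then show ?thesis unfolding R.finite_dim_def span_raw_def[symmetric] by blast
  qed
  moreover have "W.finite_dim"
    unfolding W.finite_dim_def by (rule finite_dim_complexified[OF subspace_W])
  ultimately show ?thesis
    unfolding compact_real_form_of_type_def complex_simple_of_type_def
    using lie_algebra_W R_simple lie_algebra_complex_W complex_simple_W has_cartan_matrix_W by blast
qed

end

theorem mainTheorem4:
  fixes br :: "V \<Rightarrow> V \<Rightarrow> V"
  assumes "bilinear br"
    and "G_invariant br"
    and "br (at_index 0 1 0 0) (at_index 1 1 0 0) =
           at_index 3 \<omega>' 1 1 - at_index 9 1 \<omega>' \<omega>'"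
  shows "lie_algebra scaleR UNIV br \<and>
    (\<forall>t. dim (W_component t) = 4) \<and>
    dim W = 52 \<and>
    (\<forall>g \<in> {gen_a, gen_b, gen_c, gen_d}. g ` W \<subseteq> W) \<and>
    (\<forall>u\<in>W. \<forall>v\<in>W. br u v \<in> W) \<and>
    compact_F4 W br"
proof -
  interpret e6_product br by unfold_locales (fact assms)+
  show ?thesis
    using lie_algebra_V dim_W_component dim_W generators_preserve_W br_W_closed compact_F4_W by blast
qed

end
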